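(* Let $\hat{\mathbf u}=(\hat u_0,\dots,\hat u_{H-1})$, $\hat{\mathbf x}^n=(\hat x_0^n,\dots,\hat x_H^n)$ be an input and state sequence obtained by running the sampling-based GP-MPC-SQP algorithm described in the context until convergence (i.e. until $\Delta\mathbf x=0$ and $\Delta\mathbf u=0$ in its quadratic program). Then $\hat{\mathbf x}^n$ is equal to the state sequence generated by $$x_0^n=\bar x_0,\qquad x_{i+1}^n=f(x_i^n,\hat u_i)+B_d\,g^n(x_i^n,\hat u_i),\qquad i=0,\dots,H-1,$$ where $g^n\sim\mathcal{GP}_{[\underline g,\overline g]}(0,k;\bar{\mathcal D})$.
   Context: Setting: the system is $x(k+1)=f(x(k),u(k))+B_d\,g^{\mathrm{tr}}(x(k),u(k))$ with $x\in\mathbb R^{n_x}$, $u\in\mathbb R^{n_u}$, $z=(x,u)\in\mathbb R^{n_z}$, $n_z=n_x+n_u$; $f$ is known, $g^{\mathrm{tr}}$ is an unknown scalar-valued function, $B_d\in\mathbb R^{n_x\times1}$ has full column rank. $\mathcal Z=\{(x,u):h(x,u)\le0\}$ is the constraint set, $\{x:h_H(x)\le0\}$ the terminal set, $l_i$ are the stage costs, $H$ is the horizon. The functions $f,g^{\mathrm{tr}},h,h_H,l_i$ and the kernel $k$ are twice continuously differentiable. $\bar x_0$ is the initial state, at which all predicted trajectories of the MPC problem start. Gaussian process: $\bar{\mathcal D}=\{Z,Y\}$ is a data set of $D$ inputs $Z=[z_1,\dots,z_D]$ and noisy function-value targets $Y$ (Gaussian noise of variance $\lambda^2>0$). $\mathcal{GP}(0,k;\bar{\mathcal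 D})$ is the posterior with mean $\mu(z)=k(z,Z)\tilde K_{ZZ}^{-1}Y$ and covariance $\sigma^2(z,z')=k(z,z')-k(z,Z)\tilde K_{ZZ}^{-1}k(Z,z')$, where $\tilde K_{ZZ}=k(Z,Z)+\lambda^2I_D$; $\sigma(z)=\sqrt{\sigma^2(z,z)}$. Let $\underline g=\mu-\sqrt\beta\,\sigma$, $\overline g=\mu+\sqrt\beta\,\sigma$, with $\sqrt\beta>0$ a fixed confidence scaling, and $\mathcal G=\{g:\underline g(z)\le g(z)\le\overline g(z)\ \forall z\in\mathcal Z\}$. $\mathcal{GP}_{[\underline g,\overline g]}(0,k;\bar{\mathcal D})$ denotes the truncated distribution of functions $g\sim\mathcal{GP}(0,k;\bar{\mathcal D})$ that are contained in $\mathcal G$. Joint model of values and derivatives: a multi-output Gaussian process with matrix-valued kernel $$k_{\mathrm d}(z_a,z_b)=\begin{bmatrix}k(z_a,z_b)&\partial k(z_a,z_b)/\partial z_a\\(\partial k(z_a,z_b)/\partial z_b)^\top&\partial^2k(z_a,z_b)/\partial z_a\partial z_b\end{bmatrix}.$$ $\mu_{\mathrm d}(Z_\star)$ and $\Sigma_{\mathrm d}(Z_\star)$ denote the posterior mean and covariance of the function values and derivatives at inputs $Z_\star$, conditioned on the available data (the data in $\bar{\mathcal D}$ contain function values only). $\mathcal N_{[\underline g,\overline g]}(\mu_{\mathrm d}(Z_\star),\Sigma_{\mathrm d}(Z_\star);\mathcal D)$ denotes the truncated Gaussian distribution of function values and derivatives at $Z_\star$, conditioned on the data $\mathcal D$,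 in which only the value component is truncated: it is realized by discarding all Gaussian samples whose value component violates the bounds $[\underline g,\overline g]$ at any of the input locations $Z_\star$. Algorithm (sampling-based GP-MPC-SQP, with $N$ dynamics samples $n=1,\dots,N$). Input: initial guess $\hat x_i^n$ ($0\le i\le H$), $\hat u_i$ ($0\le i\le H-1$), and data sets $\mathcal D_0^n\supseteq\bar{\mathcal D}$. For $j=1,\dots,L$: (a) Set $\hat Z^n\leftarrow[\dots,(\hat x_i^n,\hat u_i),\dots]$. (b) Sample $\hat G^n\sim\mathcal N_{[\underline g,\overline g]}(\mu_{\mathrm d}(\hat Z^n),\Sigma_{\mathrm d}(\hat Z^n);\mathcal D^n_{0:j-1})$, where $\mathcal D^n_{0:j-1}$ comprises $\mathcal D_0^n,\dots,\mathcal D_{j-1}^n$. The entries of $\hat G^n$ are the function values and Jacobians denoted $g^n(\hat x_i^n,\hat u_i)$, $\partial g^n/\partial x(\hat x_i^n,\hat u_i)$, $\partial g^n/\partial u(\hat x_i^n,\hat u_i)$ in the next steps. (c) Compute $\hat A_i^n=\partial(f+B_dg^n)/\partial x$, $\hat B_i^n=\partial(f+B_dg^n)/\partial u$, $\hat H^n_{x,i}=\partial h/\partial x$, $\hat H^n_{u,i}=\partial h/\partial u$ at $(\hat x_i^n,\hat u_i)$, $\hat H^n_{x,H}=\partial h_H/\partial x$ at $\hat x_H^n$, a positive definite approximation $H_i^n$ of the Hessian of the Lagrangian, and cost gradients $q_i^n$. Set $\mathcal D_j^n\leftarrow\{\hat Z^n,\hat G^n\}$. (d) Solve for $\Delta\mathbf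 x=(\Delta x_i^n)$, $\Delta\mathbf u=(\Delta u_i)$ the quadratic program $$\min_{\Delta\mathbf u,\Delta\mathbf x}\ \frac1N\sum_{n=1}^N\sum_{i=0}^{H-1}\begin{bmatrix}\Delta x_i^n\\\Delta u_i\end{bmatrix}^\top H_i^n\begin{bmatrix}\Delta x_i^n\\\Delta u_i\end{bmatrix}+(q_i^n)^\top\begin{bmatrix}\Delta x_i^n\\\Delta u_i\end{bmatrix}$$ subject to, for all $i\in\{0,\dots,H-1\}$ and $n\in\{1,\dots,N\}$: $\Delta x_0^n=0$; $\Delta x_{i+1}^n=f(\hat x_i^n,\hat u_i)+B_dg^n(\hat x_i^n,\hat u_i)-\hat x_{i+1}^n+\hat A_i^n\Delta x_i^n+\hat B_i^n\Delta u_i$; $0\ge h(\hat x_i^n,\hat u_i)+\hat H^n_{x,i}\Delta x_i^n+\hat H^n_{u,i}\Delta u_i$; $0\ge h_H(\hat x_H^n)+\hat H^n_{x,H}\Delta x_H^n$. (e) Set $\hat{\mathbf x}\leftarrow\hat{\mathbf x}+\Delta\mathbf x$, $\hat{\mathbf u}\leftarrow\hat{\mathbf u}+\Delta\mathbf u$. Return $\hat x_i^n,\hat u_i,\mathcal D^n_{0:L}$.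
   Formalization: In step (b), samples are discarded if they violate the bounds anywhere on the constraint set, not only at the sampled inputs (else the law is wrong); data in D_0^n beyond the given data set come from earlier rounds of the same sampler; the set G is assumed to have positive probability. *)

theory Defs
  imports "HOL-Probability.Probability"
begin

section \<open>Smoothness, kernels\<close>

definition twice_cont_diff :: "('a::euclidean_space \<Rightarrow> 'b::euclidean_space) \<Rightarrow> bool" where
  "twice_cont_diff F \<longleftrightarrow>
    (\<exists>(F' :: 'a \<Rightarrow> 'a \<Rightarrow>\<^sub>L 'b) (F'' :: 'a \<Rightarrow> 'a \<Rightarrow>\<^sub>L 'a \<Rightarrow>\<^sub>L 'b).
      (\<forall>x. (F has_derivative blinfun_apply (F' x)) (at x)) \<and>
      (\<forall>x. (F' has_derivative blinfun_apply (F'' x)) (at x)) \<and>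
      continuous_on UNIV F'')"

definition psd_kernel :: "('z \<Rightarrow> 'z \<Rightarrow> real) \<Rightarrow> bool" where
  "psd_kernel k \<longleftrightarrow>
    (\<forall>z z'. k z z' = k z' z) \<and>
    (\<forall>S c. finite S \<longrightarrow> 0 \<le> (\<Sum>z\<in>S. \<Sum>z'\<in>S. c z * c z' * k z z'))"

text \<open>
  The matrix-valued kernel of a Gaussian process with outputs in \<^typ>\<open>'b\<close> is represented by its
  bilinear form: \<open>K z z' p q\<close> is the covariance of \<open>p \<bullet> \<gamma> z\<close> and \<open>q \<bullet> \<gamma> z'\<close>.
\<close>

type_synonym ('z, 'b) mkernel = "'z \<Rightarrow> 'z \<Rightarrow> 'b \<Rightarrow> 'b \<Rightarrow> real"

definition scalar_kernel :: "('z \<Rightarrow> 'z \<Rightarrow> real) \<Rightarrow> ('z, real) mkernel" where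
  "scalar_kernel k za zb a b = a * k za zb * b"

text \<open>
  Joint model of a function value and its gradient, with outputs \<open>(g z, \<nabla>g z)\<close> in
  \<^typ>\<open>real \<times> 'z\<close>.  The four summands are the four blocks of the matrix-valued kernel:
  the derivative in \<open>za\<close> goes with the gradient output at \<open>za\<close>, that in \<open>zb\<close> with the one at \<open>zb\<close>.
\<close>

definition deriv_kernel ::
  "('z::euclidean_space \<Rightarrow> 'z \<Rightarrow> real) \<Rightarrow> ('z, real \<times> 'z) mkernel" where
  "deriv_kernel k za zb p q =
     fst p * fst q * k za zb
     + fst q * frechet_derivative (\<lambda>z. k z zb) (at za) (snd p)
     + fst p * frechet_derivative (\<lambda>z'. k za z') (at zb) (snd q)
     + frechet_derivative (\<lambda>z. frechet_derivative (\<lambda>z'. k z z') (at zb) (snd q)) (at za) (snd p)"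

section \<open>Gaussian conditioning on data\<close>

text \<open>
  An observation \<open>(z, p, y, v)\<close> is the scalar \<open>y\<close> observed for \<open>p \<bullet> \<gamma> z\<close>, with independent
  Gaussian noise of variance \<open>v\<close> (\<open>v = 0\<close>: noise-free).
\<close>

type_synonym ('z, 'b) obs = "'z \<times> 'b \<times> real \<times> real"

definition gram :: "('z, 'b) mkernel \<Rightarrow> ('z, 'b) obs list \<Rightarrow> nat \<Rightarrow> nat \<Rightarrow> real" where
  "gram K D r s =
    (case (D ! r, D ! s) of ((z, p, y, v), (z', p', y', v')) \<Rightarrow>
       K z z' p p' + (if r = s then v else 0))"

definition cross :: "('z, 'b) mkernel \<Rightarrow> ('z, 'b) obs list \<Rightarrow> 'z \<Rightarrow> 'b \<Rightarrow> nat \<Rightarrow> real" where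
  "cross K D z p r = (case D ! r of (z', p', y', v') \<Rightarrow> K z' z p' p)"

text \<open>
  The weights \<open>w\<close> solve \<open>gram w = cross\<close>, i.e. \<open>w\<close> is the inverse Gram matrix applied to
  \<open>cross\<close> whenever the Gram matrix is invertible.  Gram matrices containing noise-free data may be
  singular (an input can be sampled repeatedly); the system is still solvable for positive
  semidefinite kernels, the posterior covariance does not depend on the choice of the solution, and
  neither does the posterior mean for observed values in the range of the Gram matrix, which is an
  event of probability one.
\<close>

definition post_weights ::
  "('z, 'b) mkernel \<Rightarrow> ('z, 'b) obs list \<Rightarrow> 'z \<Rightarrow> 'b \<Rightarrow> nat \<Rightarrow> real" where
  "post_weights K D z p =
    (SOME w. \<forall>r<length D. (\<Sum>s<length D. gram K D r s * w s) = cross K D z p r)"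

definition post_mean :: "('z, 'b) mkernel \<Rightarrow> ('z, 'b) obs list \<Rightarrow> 'z \<Rightarrow> 'b \<Rightarrow> real" where
  "post_mean K D z p = (\<Sum>r<length D. post_weights K D z p r * fst (snd (snd (D ! r))))"

definition post_cov :: "('z, 'b) mkernel \<Rightarrow> ('z, 'b) obs list \<Rightarrow> ('z, 'b) mkernel" where
  "post_cov K D z z' p q =
    K z z' p q - (\<Sum>r<length D. post_weights K D z p r * cross K D z' q r)"

definition value_data :: "'b \<Rightarrow> 'z list \<Rightarrow> real list \<Rightarrow> real \<Rightarrow> ('z, 'b) obs list" where
  "value_data e Z Y lam = map (\<lambda>(z, y). (z, e, y, lam\<^sup>2)) (zip Z Y)"

definition basis_list :: "'b::euclidean_space list" where
  "basis_list = (SOME bs. distinct bs \<and> set bs = Basis)"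

text \<open>The noise-free observation of all outputs at \<open>z\<close>, as one scalar observation per coordinate.\<close>

definition exact_data :: "'z \<Rightarrow> 'b::euclidean_space \<Rightarrow> ('z, 'b) obs list" where
  "exact_data z G = map (\<lambda>b. (z, b, b \<bullet> G, 0)) basis_list"

section \<open>Laws of Gaussian processes and their truncation\<close>

text \<open>
  Path space: the direction \<open>e\<close> selects the value component \<open>e \<bullet> \<gamma> z\<close> of the outputs, which is
  required to be continuous in \<open>z\<close>.  Without continuity the bounds on an uncountable set of inputs
  would not be an event of the product sigma-algebra.  The gradient component of a Gaussian process
  with a twice continuously differentiable kernel is a derivative in mean square; its paths need not
  be continuous and are not restricted.
\<close>

definition paths :: "'b::euclidean_space \<Rightarrow> ('z::euclidean_space \<Rightarrow> 'b) measure" where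
  "paths e = restrict_space (PiM UNIV (\<lambda>_. borel)) {\<gamma>. continuous_on UNIV (\<lambda>z. e \<bullet> \<gamma> z)}"

definition gauss :: "real \<Rightarrow> real \<Rightarrow> real measure" where
  "gauss m v = (if v = 0 then return borel m else density lborel (\<lambda>x. ennreal (normal_density m (sqrt v) x)))"

definition is_gp_law ::
  "'b::euclidean_space \<Rightarrow> ('z::euclidean_space \<Rightarrow> 'b \<Rightarrow> real) \<Rightarrow> ('z, 'b) mkernel \<Rightarrow>
   ('z \<Rightarrow> 'b) measure \<Rightarrow> bool" where
  "is_gp_law e m C P \<longleftrightarrow>
    prob_space P \<and> sets P = sets (paths e) \<and>
    (\<forall>ts. distr P borel (\<lambda>\<gamma>. \<Sum>(z, p)\<leftarrow>ts. p \<bullet> \<gamma> z) =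
      gauss (\<Sum>(z, p)\<leftarrow>ts. m z p) (\<Sum>(z, p)\<leftarrow>ts. \<Sum>(z', q)\<leftarrow>ts. C z z' p q))"

text \<open>
  The law of the posterior process given the data \<open>D\<close>.  The law is unique; the zero measure stands
  in where no law exists, so positivity of the mass of a set of paths includes existence.
\<close>

definition gp_law ::
  "'b::euclidean_space \<Rightarrow> ('z::euclidean_space, 'b) mkernel \<Rightarrow> ('z, 'b) obs list \<Rightarrow>
   ('z \<Rightarrow> 'b) measure" where
  "gp_law e K D =
    (if \<exists>P. is_gp_law e (post_mean K D) (post_cov K D) P
     then THE P. is_gp_law e (post_mean K D) (post_cov K D) P
     else null_measure (paths e))"

definition bounded_paths ::
  "'b::euclidean_space \<Rightarrow> 'z::euclidean_space set \<Rightarrow> ('z \<Rightarrow> real) \<Rightarrow> ('z \<Rightarrow> real) \<Rightarrow> ('z \<Rightarrow> 'b) set" where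
  "bounded_paths e S lo up =
    {\<gamma> \<in> space (paths e). \<forall>z\<in>S. lo z \<le> e \<bullet> \<gamma> z \<and> e \<bullet> \<gamma> z \<le> up z}"

definition trunc_gp_law ::
  "'b::euclidean_space \<Rightarrow> 'z::euclidean_space set \<Rightarrow> ('z \<Rightarrow> real) \<Rightarrow> ('z \<Rightarrow> real) \<Rightarrow>
   ('z, 'b) mkernel \<Rightarrow> ('z, 'b) obs list \<Rightarrow> ('z \<Rightarrow> 'b) measure" where
  "trunc_gp_law e S lo up K D = uniform_measure (gp_law e K D) (bounded_paths e S lo up)"

text \<open>
  The truncated Gaussian distribution of the outputs at the inputs \<open>zs 0, \<dots>, zs (n - 1)\<close>, given
  the data \<open>D\<close>: samples whose value component violates the bounds on \<open>S\<close> are discarded.  Here \<open>S\<close>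
  is independent of the inputs, so that these are the finite-dimensional distributions of one
  process.  Discarding on the basis of the bounds at \<open>zs\<close> alone does not give a consistent family:
  successive conditional draws would then not be the values of a function with law
  \<open>trunc_gp_law e S lo up K D\<close>.
\<close>

definition trunc_gp_at ::
  "'b::euclidean_space \<Rightarrow> 'z::euclidean_space set \<Rightarrow> ('z \<Rightarrow> real) \<Rightarrow> ('z \<Rightarrow> real) \<Rightarrow>
   ('z, 'b) mkernel \<Rightarrow> ('z, 'b) obs list \<Rightarrow> nat \<Rightarrow> (nat \<Rightarrow> 'z) \<Rightarrow> (nat \<Rightarrow> 'b) measure" where
  "trunc_gp_at e S lo up K D n zs =
    distr (trunc_gp_law e S lo up K D) (PiM {..<n} (\<lambda>_. borel)) (\<lambda>\<gamma>. \<lambda>i\<in>{..<n}. \<gamma> (zs i))"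

definition gp_mean :: "('z \<Rightarrow> 'z \<Rightarrow> real) \<Rightarrow> 'z list \<Rightarrow> real list \<Rightarrow> real \<Rightarrow> 'z \<Rightarrow> real" where
  "gp_mean k Z Y lam z = post_mean (scalar_kernel k) (value_data 1 Z Y lam) z 1"

definition gp_sd :: "('z \<Rightarrow> 'z \<Rightarrow> real) \<Rightarrow> 'z list \<Rightarrow> real list \<Rightarrow> real \<Rightarrow> 'z \<Rightarrow> real" where
  "gp_sd k Z Y lam z = sqrt (post_cov (scalar_kernel k) (value_data 1 Z Y lam) z z 1 1)"

definition g_lower ::
  "('z \<Rightarrow> 'z \<Rightarrow> real) \<Rightarrow> 'z list \<Rightarrow> real list \<Rightarrow> real \<Rightarrow> real \<Rightarrow> 'z \<Rightarrow> real" where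
  "g_lower k Z Y lam \<beta> z = gp_mean k Z Y lam z - sqrt \<beta> * gp_sd k Z Y lam z"

definition g_upper ::
  "('z \<Rightarrow> 'z \<Rightarrow> real) \<Rightarrow> 'z list \<Rightarrow> real list \<Rightarrow> real \<Rightarrow> real \<Rightarrow> 'z \<Rightarrow> real" where
  "g_upper k Z Y lam \<beta> z = gp_mean k Z Y lam z + sqrt \<beta> * gp_sd k Z Y lam z"

section \<open>Sampling\<close>

text \<open>
  \<open>\<nu>\<close> is a version of the regular conditional distribution of \<open>X\<close>, with values in \<open>S\<close>, given \<open>F\<close>.
\<close>

definition has_cond_law ::
  "'w measure \<Rightarrow> 'w measure \<Rightarrow> 's measure \<Rightarrow> ('w \<Rightarrow> 's) \<Rightarrow> ('w \<Rightarrow> 's measure) \<Rightarrow> bool" where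
  "has_cond_law M F S X \<nu> \<longleftrightarrow>
    X \<in> measurable M S \<and>
    (\<forall>A\<in>sets S. AE \<omega> in M.
       real_cond_exp M F (indicator (X -` A \<inter> space M)) \<omega> = measure (\<nu> \<omega>) A)"

text \<open>
  The data collected in the sampling rounds \<open>1, \<dots>, r - 1\<close>; in round \<open>t\<close>, the outputs \<open>G t i\<close> are
  drawn at the inputs \<open>\<zeta> t i\<close>, \<open>i < m t\<close>.
\<close>

definition sampled_data ::
  "(nat \<Rightarrow> nat) \<Rightarrow> (nat \<Rightarrow> nat \<Rightarrow> 'z) \<Rightarrow> (nat \<Rightarrow> nat \<Rightarrow> 'b::euclidean_space) \<Rightarrow> nat \<Rightarrow> ('z, 'b) obs list" where
  "sampled_data m \<zeta> G r =
    concat (map (\<lambda>t. concat (map (\<lambda>i. exact_data (\<zeta> t i) (G t i)) [0..<m t])) [1..<r])"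

section \<open>The quadratic program and the dynamics\<close>

definition pos_def :: "('z::euclidean_space \<Rightarrow> 'z) \<Rightarrow> bool" where
  "pos_def A \<longleftrightarrow> linear A \<and> (\<forall>v w. A v \<bullet> w = v \<bullet> A w) \<and> (\<forall>v. v \<noteq> 0 \<longrightarrow> 0 < v \<bullet> A v)"

definition grad :: "('z::euclidean_space \<Rightarrow> real) \<Rightarrow> 'z \<Rightarrow> 'z" where
  "grad F z = (\<Sum>b\<in>Basis. frechet_derivative F (at z) b *\<^sub>R b)"

definition jac_x ::
  "((real^'nx) \<times> (real^'nu) \<Rightarrow> real^'m) \<Rightarrow> (real^'nx) \<times> (real^'nu) \<Rightarrow> real^'nx^'m" where
  "jac_x F z = matrix (\<lambda>v. frechet_derivative F (at z) (v, 0))"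

definition jac_u ::
  "((real^'nx) \<times> (real^'nu) \<Rightarrow> real^'m) \<Rightarrow> (real^'nx) \<times> (real^'nu) \<Rightarrow> real^'nu^'m" where
  "jac_u F z = matrix (\<lambda>v. frechet_derivative F (at z) (0, v))"

text \<open>
  In the next two definitions, \<open>G = (g z, (\<partial>g/\<partial>x, \<partial>g/\<partial>u))\<close> is a sampled value with its gradient,
  and \<open>f + Bd g\<close> is differentiated at \<open>z\<close>.
\<close>

definition A_hat ::
  "((real^'nx) \<times> (real^'nu) \<Rightarrow> real^'nx) \<Rightarrow> real^1^'nx \<Rightarrow> (real^'nx) \<times> (real^'nu) \<Rightarrow>
   real \<times> (real^'nx) \<times> (real^'nu) \<Rightarrow> real^'nx^'nx" where
  "A_hat f Bd z G = jac_x f z + Bd ** (\<chi> i. fst (snd G))"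

definition B_hat ::
  "((real^'nx) \<times> (real^'nu) \<Rightarrow> real^'nx) \<Rightarrow> real^1^'nx \<Rightarrow> (real^'nx) \<times> (real^'nu) \<Rightarrow>
   real \<times> (real^'nx) \<times> (real^'nu) \<Rightarrow> real^'nu^'nx" where
  "B_hat f Bd z G = jac_u f z + Bd ** (\<chi> i. snd (snd G))"

text \<open>
  Arguments are indexed by the sample \<open>n\<close> (where applicable) and the time \<open>i\<close>.
\<close>

definition qp_feasible ::
  "((real^'nx) \<times> (real^'nu) \<Rightarrow> real^'nx) \<Rightarrow> real^1^'nx \<Rightarrow>
   ((real^'nx) \<times> (real^'nu) \<Rightarrow> real^'nh) \<Rightarrow> (real^'nx \<Rightarrow> real^'nt) \<Rightarrow> nat \<Rightarrow> nat \<Rightarrow>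
   (nat \<Rightarrow> nat \<Rightarrow> real^'nx) \<Rightarrow> (nat \<Rightarrow> real^'nu) \<Rightarrow>
   (nat \<Rightarrow> nat \<Rightarrow> real \<times> (real^'nx) \<times> (real^'nu)) \<Rightarrow>
   (nat \<Rightarrow> nat \<Rightarrow> real^'nx) \<Rightarrow> (nat \<Rightarrow> real^'nu) \<Rightarrow> bool" where
  "qp_feasible f Bd h hH N H xh uh G dx du \<longleftrightarrow>
    (\<forall>n\<in>{1..N}.
       dx n 0 = 0 \<and>
       (\<forall>i<H. dx n (Suc i) =
          f (xh n i, uh i) + Bd *v vec (fst (G n i)) - xh n (Suc i)
          + A_hat f Bd (xh n i, uh i) (G n i) *v dx n i
          + B_hat f Bd (xh n i, uh i) (G n i) *v du i) \<and>
       (\<forall>i<H. 0 \<ge> h (xh n i, uh i) + jac_x h (xh n i, uh i) *v dx n i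
          + jac_u h (xh n i, uh i) *v du i) \<and>
       0 \<ge> hH (xh n H) + matrix (frechet_derivative hH (at (xh n H))) *v dx n H)"

definition qp_cost ::
  "(nat \<Rightarrow> (real^'nx) \<times> (real^'nu) \<Rightarrow> real) \<Rightarrow> nat \<Rightarrow> nat \<Rightarrow>
   (nat \<Rightarrow> nat \<Rightarrow> real^'nx) \<Rightarrow> (nat \<Rightarrow> real^'nu) \<Rightarrow>
   (nat \<Rightarrow> nat \<Rightarrow> (real^'nx) \<times> (real^'nu) \<Rightarrow> (real^'nx) \<times> (real^'nu)) \<Rightarrow>
   (nat \<Rightarrow> nat \<Rightarrow> real^'nx) \<Rightarrow> (nat \<Rightarrow> real^'nu) \<Rightarrow> real" where
  "qp_cost l N H xh uh Hess dx du =
    1 / real N * (\<Sum>n=1..N. \<Sum>i<H.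
      (dx n i, du i) \<bullet> Hess n i (dx n i, du i) + grad (l i) (xh n i, uh i) \<bullet> (dx n i, du i))"

definition qp_solution ::
  "((real^'nx) \<times> (real^'nu) \<Rightarrow> real^'nx) \<Rightarrow> real^1^'nx \<Rightarrow>
   ((real^'nx) \<times> (real^'nu) \<Rightarrow> real^'nh) \<Rightarrow> (real^'nx \<Rightarrow> real^'nt) \<Rightarrow>
   (nat \<Rightarrow> (real^'nx) \<times> (real^'nu) \<Rightarrow> real) \<Rightarrow> nat \<Rightarrow> nat \<Rightarrow>
   (nat \<Rightarrow> nat \<Rightarrow> real^'nx) \<Rightarrow> (nat \<Rightarrow> real^'nu) \<Rightarrow>
   (nat \<Rightarrow> nat \<Rightarrow> real \<times> (real^'nx) \<times> (real^'nu)) \<Rightarrow>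
   (nat \<Rightarrow> nat \<Rightarrow> (real^'nx) \<times> (real^'nu) \<Rightarrow> (real^'nx) \<times> (real^'nu)) \<Rightarrow>
   (nat \<Rightarrow> nat \<Rightarrow> real^'nx) \<Rightarrow> (nat \<Rightarrow> real^'nu) \<Rightarrow> bool" where
  "qp_solution f Bd h hH l N H xh uh G Hess dx du \<longleftrightarrow>
    qp_feasible f Bd h hH N H xh uh G dx du \<and>
    (\<forall>dx' du'. qp_feasible f Bd h hH N H xh uh G dx' du' \<longrightarrow>
       qp_cost l N H xh uh Hess dx du \<le> qp_cost l N H xh uh Hess dx' du')"

primrec trajectory ::
  "((real^'nx) \<times> (real^'nu) \<Rightarrow> real^'nx) \<Rightarrow> real^1^'nx \<Rightarrow> ((real^'nx) \<times> (real^'nu) \<Rightarrow> real) \<Rightarrow>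
   real^'nx \<Rightarrow> (nat \<Rightarrow> real^'nu) \<Rightarrow> nat \<Rightarrow> real^'nx" where
  "trajectory f Bd g x0 u 0 = x0"
| "trajectory f Bd g x0 u (Suc i) =
    f (trajectory f Bd g x0 u i, u i) + Bd *v vec (g (trajectory f Bd g x0 u i, u i))"

end

theory Submission
  imports Defs
begin

text \<open>
  A path of the posterior process can be drawn in stages: first its outputs at finitely many inputs,
  then the whole path from the posterior given these outputs in addition. Truncation respects this,
  because the bounds are imposed on the same set of inputs in every round: with \<open>P\<close> the law of the
  process, \<open>P\<^sub>x\<close> its conditional law given observed outputs \<open>x\<close> and \<open>B\<close> the set of bounded paths,
  averaging \<open>P\<^sub>x (A \<inter> B) / P\<^sub>x B\<close> over the law of \<open>x\<close> under \<open>P (\<cdot> | B)\<close> gives \<open>P (A | B)\<close>. Hence a path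
  drawn after the last round from the truncated posterior given all the samples has the truncated
  posterior given the original data as its marginal law, and it interpolates the samples. At
  convergence the equality constraints of the quadratic program are the dynamics with the sampled
  values, which are values of that path.

  That Gaussian laws on path space are unique and depend measurably on the data both follows from the
  algebra of trigonometric polynomials in finitely many coordinates.
\<close>

section \<open>Kernels determined by an algebra of bounded functions\<close>

text \<open>Two obstacles shape the argument. The weights behind the posterior moments are an
  arbitrary solution of a possibly singular linear system, so neither measurable dependence on
  random data nor a meaning of the mean for values outside the range of the Gram matrix is visible
  from the definitions. The moments are therefore recomputed by recursions in kernel values, and
  data contradicting a deterministic prediction, an event of probability zero, are assigned the null
  measure. Secondly, conditional laws of whole paths over an uncountable index set are needed. They
  are built by an explicit transformation of paths and identified by the integrals of cosines of
  finite linear functionals; products of such cosines are again sums of cosines, and they generate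
  the path sigma-algebra. Finally, the sampled inputs are random, so that evaluating the drawn path
  there is a measurable operation only thanks to the continuity of its value component.\<close>

lemma real_polynomial_function_comp_closed:
  fixes p :: "real \<Rightarrow> real"
  assumes p: "real_polynomial_function p"
    and const: "\<And>c. (\<lambda>x. c) \<in> A"
    and add: "\<And>f g. f \<in> A \<Longrightarrow> g \<in> A \<Longrightarrow> (\<lambda>x. f x + g x) \<in> A"
    and mult: "\<And>f g. f \<in> A \<Longrightarrow> g \<in> A \<Longrightarrow> (\<lambda>x. f x * g x) \<in> A"
    and f: "f \<in> A"
  shows "(\<lambda>x. p (f x)) \<in> A"
  using p
proof induction
  case (linear h)
  have "h y = h 1 * y" for y
    using linear_scale[OF bounded_linear.linear[OF linear], of y 1] by simp
  then have "(\<lambda>x. h (f x)) = (\<lambda>x. h 1 * f x)"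
    by blast
  then show ?case using assms(4)[OF assms(2)[of "h 1"] f] by simp
next
  case (const c)
  show ?case by (rule assms(2))
next
  case (add g h)
  show ?case by (rule assms(3)[OF add.IH])
next
  case (mult g h)
  show ?case by (rule assms(4)[OF mult.IH])
qed

text \<open>Steep continuous ramps tend pointwise to the indicator of the open half-line, and
  Weierstrass replaces each ramp by a polynomial with error below \<open>1 / (k + 1)\<close>. The
  bound 2 is 1 for the ramp plus 1 for the error; it serves dominated convergence.\<close>

lemma indicator_polynomial_approximation:
  fixes c B :: real
  obtains p where "\<And>k::nat. real_polynomial_function (p k)"
    "\<And>k x. \<bar>x\<bar> \<le> B \<Longrightarrow> \<bar>p k x\<bar> \<le> 2"
    "\<And>x. \<bar>x\<bar> \<le> B \<Longrightarrow> (\<lambda>k. p k x) \<longlonglongrightarrow> indicator {c<..} x"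
proof -
  define q where "q k x = min 1 (max 0 (real k * (x - c)))" for k x
  have "\<exists>g. real_polynomial_function g \<and> (\<forall>x\<in>{-B..B}. \<bar>q k x - g x\<bar> < 1 / real (Suc k))" for k
  proof -
    have "continuous_on {-B..B} (q k)"
      unfolding q_def by (intro continuous_intros)
    then show ?thesis
      using Stone_Weierstrass_real_polynomial_function[of "{-B..B}" "q k" "1 / real (Suc k)"]
      by (metis compact_Icc of_nat_0_less_iff zero_less_Suc zero_less_divide_1_iff)
  qed
  then obtain p where p: "\<And>k. real_polynomial_function (p k)"
    and pq: "\<And>k x. x \<in> {-B..B} \<Longrightarrow> \<bar>q k x - p k x\<bar> < 1 / real (Suc k)"
    by metis
  have q01: "0 \<le> q k x" "q k x \<le> 1" for k x
    by (auto simp: q_def)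
  have "\<bar>p k x\<bar> \<le> 2" if "\<bar>x\<bar> \<le> B" for k x
  proof -
    have "\<bar>q k x - p k x\<bar> < 1 / real (Suc k)" using that by (intro pq) auto
    also have "\<dots> \<le> 1" by (simp add: divide_simps)
    finally show ?thesis using q01[of k x] by linarith
  qed
  moreover have "(\<lambda>k. p k x) \<longlonglongrightarrow> indicator {c<..} x" if "\<bar>x\<bar> \<le> B" for x
  proof -
    have "(\<lambda>k. q k x) \<longlonglongrightarrow> indicator {c<..} x"
    proof (cases "x > c")
      case True
      have "\<forall>\<^sub>F k in sequentially. q k x = 1"
      proof -
        obtain k0 :: nat where k0: "1 / (x - c) < real k0" using reals_Archimedean2 by blast
        have "q k x = 1" if "k \<ge> k0" for k
        proof -
          have "1 / (x - c) < real k" using k0 that by linarith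
          then have "1 < real k * (x - c)" using True by (simp add: field_simps)
          then show ?thesis by (simp add: q_def)
        qed
        then show ?thesis using eventually_sequentially by blast
      qed
      then show ?thesis using True by (simp add: tendsto_eventually)
    next
      case False
      then have "q k x = 0" for k
        by (simp add: q_def mult_nonneg_nonpos)
      then show ?thesis using False by simp
    qed
    moreover have "(\<lambda>k. q k x - p k x) \<longlonglongrightarrow> 0"
    proof (rule Lim_null_comparison)
      show "\<forall>\<^sub>F k in sequentially. norm (q k x - p k x) \<le> 1 / real (Suc k)"
        using that by (intro always_eventually allI less_imp_le) (auto intro!: pq simp del: of_nat_Suc)
      show "(\<lambda>k. 1 / real (Suc k)) \<longlonglongrightarrow> 0"
        using LIMSEQ_inverse_real_of_nat by (simp add: inverse_eq_divide)
    qed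
    ultimately have "(\<lambda>k. q k x - (q k x - p k x)) \<longlonglongrightarrow> indicator {c<..} x - 0"
      by (rule tendsto_diff)
    then show ?thesis by simp
  qed
  ultimately show ?thesis using p that by blast
qed

text \<open>A monotone class argument. The indicator of a finite intersection of sets
  \<open>f > c\<close> is a bounded pointwise limit of products of polynomials in such
  \<open>f\<close>, which stay in the algebra \<open>A\<close>; dominated convergence carries
  measurability of the integrals over to the measures of these sets, and they form an
  intersection-stable generator.\<close>

lemma measurable_subprob_algebra_function_algebra:
  fixes \<kappa> :: "'a \<Rightarrow> 'b measure" and A :: "('b \<Rightarrow> real) set"
  assumes sub: "\<And>\<omega>. \<omega> \<in> space N \<Longrightarrow> subprob_space (\<kappa> \<omega>)"
    and sets: "\<And>\<omega>. \<omega> \<in> space N \<Longrightarrow> sets (\<kappa> \<omega>) = sets S"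
    and bounded: "\<And>f. f \<in> A \<Longrightarrow> \<exists>B. \<forall>x\<in>space S. \<bar>f x\<bar> \<le> B"
    and meas: "\<And>f. f \<in> A \<Longrightarrow> f \<in> borel_measurable S"
    and const: "\<And>c. (\<lambda>x. c) \<in> A"
    and add: "\<And>f g. f \<in> A \<Longrightarrow> g \<in> A \<Longrightarrow> (\<lambda>x. f x + g x) \<in> A"
    and mult: "\<And>f g. f \<in> A \<Longrightarrow> g \<in> A \<Longrightarrow> (\<lambda>x. f x * g x) \<in> A"
    and int: "\<And>f. f \<in> A \<Longrightarrow> (\<lambda>\<omega>. \<integral>x. f x \<partial>\<kappa> \<omega>) \<in> borel_measurable N"
    and gen: "sets S \<subseteq> sigma_sets (space S) {{x \<in> space S. f x > c} |f c. f \<in> A}"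
  shows "\<kappa> \<in> N \<rightarrow>\<^sub>M subprob_algebra S"
proof (rule measurable_subprob_algebra_generated)
  \<comment> \<open>Indexing by lists makes intersection the concatenation of lists and the whole
    space the case of the empty list.\<close>
  define G where "G = {{x \<in> space S. \<forall>(f, c)\<in>set l. f x > c} |l. set l \<subseteq> A \<times> UNIV}"
  have bas: "{x \<in> space S. f x > c} \<in> sets S" if "f \<in> A" for f c
    using meas[OF that] by measurable
  have GS: "G \<subseteq> sets S"
  proof
    fix X assume "X \<in> G"
    then obtain l where l: "X = {x \<in> space S. \<forall>(f, c)\<in>set l. f x > c}" "set l \<subseteq> A \<times> UNIV"
      by (auto simp: G_def)
    have "{x \<in> space S. \<forall>(f, c)\<in>set l. f x > c} \<in> sets S" using l(2)
    proof (induction l)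
      case (Cons a l)
      obtain f c where a: "a = (f, c)" by (cases a)
      have "{x \<in> space S. f x > c} \<inter> {x \<in> space S. \<forall>(f, c)\<in>set l. f x > c} \<in> sets S"
        using Cons bas a by auto
      then show ?case by (rule back_subst[of "\<lambda>X. X \<in> sets S"]) (auto simp: a)
    qed simp
    then show "X \<in> sets S" using l by simp
  qed
  show "sets S = sigma_sets (space S) G"
  proof
    have "{{x \<in> space S. f x > c} |f c. f \<in> A} \<subseteq> G"
    proof safe
      fix f c assume "f \<in> A"
      then show "{x \<in> space S. f x > c} \<in> G"
        unfolding G_def by (intro CollectI exI[of _ "[(f, c)]"]) auto
    qed
    then show "sets S \<subseteq> sigma_sets (space S) G"
      using gen sigma_sets_mono'[of _ G] by blast
    show "sigma_sets (space S) G \<subseteq> sets S"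
      using GS by (rule sets.sigma_sets_subset)
  qed
  show "Int_stable G"
  proof (rule Int_stableI)
    fix X Y assume "X \<in> G" "Y \<in> G"
    then obtain l l' where l: "X = {x \<in> space S. \<forall>(f, c)\<in>set l. f x > c}" "set l \<subseteq> A \<times> UNIV"
      and l': "Y = {x \<in> space S. \<forall>(f, c)\<in>set l'. f x > c}" "set l' \<subseteq> A \<times> UNIV"
      by (auto simp: G_def)
    have "X \<inter> Y = {x \<in> space S. \<forall>(f, c)\<in>set (l @ l'). f x > c}" "set (l @ l') \<subseteq> A \<times> UNIV"
      using l l' by auto
    then show "X \<inter> Y \<in> G" unfolding G_def by blast
  qed
  show "G \<subseteq> Pow (space S)" by (auto simp: G_def)
  show "subprob_space (\<kappa> \<omega>)" "sets (\<kappa> \<omega>) = sets S" if "\<omega> \<in> space N" for \<omega>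
    using that by (fact sub sets)+
  have *: "(\<lambda>\<omega>. emeasure (\<kappa> \<omega>) X) \<in> borel_measurable N" if "X \<in> G" for X
  proof -
    obtain l where l: "X = {x \<in> space S. \<forall>(f, c)\<in>set l. f x > c}" "set l \<subseteq> A \<times> UNIV"
      using \<open>X \<in> G\<close> by (auto simp: G_def)
    have "\<exists>r. (\<forall>k. r k \<in> A) \<and> (\<exists>B. \<forall>k. \<forall>x\<in>space S. \<bar>r k x\<bar> \<le> B) \<and>
        (\<forall>x\<in>space S. (\<lambda>k. r k x) \<longlonglongrightarrow> indicator {x. \<forall>(f, c)\<in>set l. f x > c} x)"
      using l(2)
    proof (induction l)
      case Nil
      then show ?case
        using const by (intro exI[of _ "\<lambda>k x. 1"]) (auto intro: exI[of _ 1])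
    next
      case (Cons a l)
      obtain f c where a: "a = (f, c)" by (cases a)
      then have f: "f \<in> A" using Cons by auto
      obtain r Br where r: "\<And>k. r k \<in> A" "\<And>k x. x \<in> space S \<Longrightarrow> \<bar>r k x\<bar> \<le> Br"
        "\<And>x. x \<in> space S \<Longrightarrow> (\<lambda>k. r k x) \<longlonglongrightarrow> indicator {x. \<forall>(f, c)\<in>set l. f x > c} x"
        using Cons.IH Cons.prems unfolding set_simps insert_subset by blast
      obtain B where B: "\<And>x. x \<in> space S \<Longrightarrow> \<bar>f x\<bar> \<le> B" using bounded[OF f] by auto
      obtain p where p: "\<And>k::nat. real_polynomial_function (p k)"
        "\<And>k x. \<bar>x\<bar> \<le> B \<Longrightarrow> \<bar>p k x\<bar> \<le> 2"
        "\<And>x. \<bar>x\<bar> \<le> B \<Longrightarrow> (\<lambda>k. p k x) \<longlonglongrightarrow> indicator {c<..} x"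
        by (rule indicator_polynomial_approximation[of B c]) blast
      have "(\<lambda>x. p k (f x) * r k x) \<in> A" for k
        by (rule mult[OF real_polynomial_function_comp_closed[OF p(1) const add mult f] r(1)])
      moreover have "\<bar>p k (f x) * r k x\<bar> \<le> 2 * Br" if "x \<in> space S" for k x
        unfolding abs_mult using p(2)[OF B[OF that]] r(2)[OF that] by (intro mult_mono) auto
      moreover have "(\<lambda>k. p k (f x) * r k x) \<longlonglongrightarrow> indicator {x. \<forall>(f, c)\<in>set (a # l). f x > c} x"
        if "x \<in> space S" for x
      proof -
        have "(\<lambda>k. p k (f x) * r k x) \<longlonglongrightarrow>
            indicator {c<..} (f x) * indicator {x. \<forall>(f, c)\<in>set l. f x > c} x"
          using p(3)[OF B[OF that]] r(3)[OF that] by (rule tendsto_mult)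
        also have "indicator {c<..} (f x) * indicator {x. \<forall>(f, c)\<in>set l. f x > c} x =
            (indicator {x. \<forall>(f, c)\<in>set (a # l). f x > c} x :: real)"
          by (auto simp: a indicator_def)
        finally show ?thesis .
      qed
      ultimately show ?case
        by (intro exI[of _ "\<lambda>k x. p k (f x) * r k x"]) blast
    qed
    then obtain r B where r: "\<And>k. r k \<in> A" "\<And>k x. x \<in> space S \<Longrightarrow> \<bar>r k x\<bar> \<le> B"
        "\<And>x. x \<in> space S \<Longrightarrow> (\<lambda>k. r k x) \<longlonglongrightarrow> indicator {x. \<forall>(f, c)\<in>set l. f x > c} x"
      by blast
    have XS: "X \<in> sets S" using GS that by auto
    have "(\<lambda>\<omega>. measure (\<kappa> \<omega>) X) \<in> borel_measurable N"
    proof (rule borel_measurable_LIMSEQ_real)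
      fix \<omega> assume \<omega>: "\<omega> \<in> space N"
      interpret subprob_space "\<kappa> \<omega>" by (rule sub[OF \<omega>])
      have sp: "space (\<kappa> \<omega>) = space S" using sets[OF \<omega>] by (rule sets_eq_imp_space_eq)
      have "(\<lambda>k. \<integral>x. r k x \<partial>\<kappa> \<omega>) \<longlonglongrightarrow> (\<integral>x. indicator X x \<partial>\<kappa> \<omega>)"
      proof (rule integral_dominated_convergence[where w="\<lambda>_. B"])
        show "AE x in \<kappa> \<omega>. (\<lambda>k. r k x) \<longlonglongrightarrow> indicator X x"
        proof (rule AE_I2)
          fix x assume x: "x \<in> space (\<kappa> \<omega>)"
          have "indicator X x = (indicator {x. \<forall>(f, c)\<in>set l. f x > c} x :: real)"
            using x sp by (auto simp: l indicator_def)
          then show "(\<lambda>k. r k x) \<longlonglongrightarrow> indicator X x" using r(3)[of x] x sp by simp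
        qed
        show "AE x in \<kappa> \<omega>. norm (r k x) \<le> B" for k
          using r(2) sp by auto
        show "r k \<in> borel_measurable (\<kappa> \<omega>)" for k
          using meas[OF r(1)] sets[OF \<omega>] by (simp cong: measurable_cong_sets)
        show "indicator X \<in> borel_measurable (\<kappa> \<omega>)"
          using XS sets[OF \<omega>] by simp
      qed simp
      also have "(\<integral>x. indicator X x \<partial>\<kappa> \<omega>) = measure (\<kappa> \<omega>) X"
        using XS sets[OF \<omega>] by simp
      finally show "(\<lambda>k. \<integral>x. r k x \<partial>\<kappa> \<omega>) \<longlonglongrightarrow> measure (\<kappa> \<omega>) X" .
    qed (use int r in auto)
    then have "(\<lambda>\<omega>. ennreal (measure (\<kappa> \<omega>) X)) \<in> borel_measurable N" by measurable
    also have "?this \<longleftrightarrow> ?thesis"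
    proof (rule measurable_cong)
      fix \<omega> assume \<omega>: "\<omega> \<in> space N"
      interpret subprob_space "\<kappa> \<omega>" by (rule sub[OF \<omega>])
      show "ennreal (measure (\<kappa> \<omega>) X) = emeasure (\<kappa> \<omega>) X"
        by (simp add: emeasure_eq_measure)
    qed
    finally show ?thesis .
  qed
  then show "\<And>X. X \<in> G \<Longrightarrow> (\<lambda>\<omega>. emeasure (\<kappa> \<omega>) X) \<in> borel_measurable N" .
  have "space S \<in> G" unfolding G_def by (intro CollectI exI[of _ "[]"]) auto
  then show "(\<lambda>\<omega>. emeasure (\<kappa> \<omega>) (space S)) \<in> borel_measurable N" by (rule *)
qed

section \<open>Recursive Gaussian conditioning\<close>

text \<open>A list of pairs \<open>(z, p)\<close> encodes the linear functional that sums
  \<open>p \<bullet> \<gamma> z\<close>. Gaussian laws on path space are tested on these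
  functionals, and \<open>lin_mean\<close> and \<open>lin_cov\<close> are their mean and
  covariance.\<close>

definition lin_mean :: "('z \<Rightarrow> 'b \<Rightarrow> real) \<Rightarrow> ('z \<times> 'b) list \<Rightarrow> real" where
  "lin_mean m ts = (\<Sum>(z, p)\<leftarrow>ts. m z p)"

definition lin_cov :: "('z, 'b) mkernel \<Rightarrow> ('z \<times> 'b) list \<Rightarrow> ('z \<times> 'b) list \<Rightarrow> real" where
  "lin_cov C ts us = (\<Sum>(z, p)\<leftarrow>ts. \<Sum>(z', q)\<leftarrow>us. C z z' p q)"

abbreviation scale_list :: "real \<Rightarrow> ('z \<times> 'b::real_vector) list \<Rightarrow> ('z \<times> 'b) list" where
  "scale_list c ts \<equiv> map (\<lambda>(z, p). (z, c *\<^sub>R p)) ts"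

lemma lin_mean_simps [simp]:
  "lin_mean m [] = 0" "lin_mean m ((z, p) # ts) = m z p + lin_mean m ts"
  "lin_mean m (ts @ us) = lin_mean m ts + lin_mean m us"
  by (simp_all add: lin_mean_def)

lemma lin_cov_simps [simp]:
  "lin_cov C [] us = 0"
  "lin_cov C ((z, p) # ts) us = (\<Sum>(z', q)\<leftarrow>us. C z z' p q) + lin_cov C ts us"
  "lin_cov C (ts @ ts') us = lin_cov C ts us + lin_cov C ts' us"
  "lin_cov C ts [] = 0"
  "lin_cov C ts (us @ us') = lin_cov C ts us + lin_cov C ts us'"
proof -
  show "lin_cov C [] us = 0"
    "lin_cov C ((z, p) # ts) us = (\<Sum>(z', q)\<leftarrow>us. C z z' p q) + lin_cov C ts us"
    "lin_cov C (ts @ ts') us = lin_cov C ts us + lin_cov C ts' us"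
    by (simp_all add: lin_cov_def)
  show "lin_cov C ts [] = 0"
    by (induction ts) (auto simp: lin_cov_def)
  show "lin_cov C ts (us @ us') = lin_cov C ts us + lin_cov C ts us'"
    by (induction ts) (auto simp: lin_cov_def)
qed

lemma lin_mean_scale:
  assumes "\<And>z. linear (m z)"
  shows "lin_mean m (scale_list c ts) = c * lin_mean m ts"
  by (induction ts) (auto simp: linear_scale[OF assms] algebra_simps)

text \<open>A class of covariances that is stable under conditioning, so that inductions over the
  data can stay inside it. Continuity has two uses: updated paths keep a continuous value component,
  and the kernel can be evaluated measurably at random inputs.\<close>

locale gp_kernel =
  fixes C :: "('z::euclidean_space, 'b::euclidean_space) mkernel"
  assumes linear1: "linear (\<lambda>p. C z z' p q)"
    and sym: "C z z' p q = C z' z q p"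
    and psd: "0 \<le> lin_cov C ts ts"
    and cont: "continuous_on UNIV (\<lambda>(z, z'). C z z' p q)"
begin

lemma linear2: "linear (\<lambda>q. C z z' p q)"
  using linear1[of z' z p] by (simp add: sym[of z z' p])

lemma lin_cov_sym: "lin_cov C ts us = lin_cov C us ts"
proof (induction ts)
  case (Cons a ts)
  obtain z p where a: "a = (z, p)" by (cases a)
  have "lin_cov C us (a # ts) = lin_cov C us [a] + lin_cov C us ts"
    using lin_cov_simps(5)[of C us "[a]" ts] by simp
  moreover have "lin_cov C us [a] = (\<Sum>(z', q)\<leftarrow>us. C z z' p q)"
    by (induction us) (auto simp: a sym[of _ z _ p])
  ultimately show ?case using Cons by (simp add: a)
qed simp

lemma lin_cov_scale2: "lin_cov C ts (scale_list c us) = c * lin_cov C ts us"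
proof (induction ts)
  case (Cons a ts)
  obtain z p where a: "a = (z, p)" by (cases a)
  have "(\<Sum>(z', q)\<leftarrow>scale_list c us. C z z' p q) = c * (\<Sum>(z', q)\<leftarrow>us. C z z' p q)"
    by (induction us) (auto simp: linear_scale[OF linear2] algebra_simps)
  with Cons show ?case by (simp add: a algebra_simps)
qed simp

lemma lin_cov_scale1: "lin_cov C (scale_list c ts) us = c * lin_cov C ts us"
  by (subst (1 2) lin_cov_sym) (rule lin_cov_scale2)

lemma var_nonneg: "0 \<le> C z z p p"
  using psd[of "[(z, p)]"] by simp

lemma Cauchy_Schwarz: "(lin_cov C ts us)\<^sup>2 \<le> lin_cov C ts ts * lin_cov C us us"
proof -
  define a b c where "a = lin_cov C ts ts" and "b = lin_cov C ts us" and "c = lin_cov C us us"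
  have pos: "0 \<le> t\<^sup>2 * a + 2 * t * b + c" for t
  proof -
    have "lin_cov C (scale_list t ts @ us) (scale_list t ts @ us) = t * (t * a) + t * b + (t * b + c)"
      unfolding a_def b_def c_def lin_cov_simps lin_cov_scale1 lin_cov_scale2
      by (simp add: lin_cov_sym[of us ts])
    with psd[of "scale_list t ts @ us"] show ?thesis
      by (simp add: power2_eq_square algebra_simps)
  qed
  have a: "a \<ge> 0" using psd by (simp add: a_def)
  show ?thesis
  proof (cases "a = 0")
    case True
    have "b = 0"
    proof (rule ccontr)
      assume "b \<noteq> 0"
      \<comment> \<open>For \<open>a = 0\<close> the polynomial is affine in \<open>t\<close>, and
        this choice of \<open>t\<close> gives it the value -1.\<close>
      then show False using pos[of "- (c + 1) / (2 * b)"] True by (simp add: field_simps)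
    qed
    then show ?thesis using True by (simp add: a_def b_def)
  next
    case False
    then have "0 \<le> a * ((- b / a)\<^sup>2 * a + 2 * (- b / a) * b + c)"
      using pos[of "- b / a"] a by simp
    also have "\<dots> = a * c - b\<^sup>2" using False by (simp add: field_simps power2_eq_square)
    finally show ?thesis by (simp add: a_def b_def c_def)
  qed
qed

lemma cov_eq_0: "C z0 z0 p0 p0 = 0 \<Longrightarrow> C z0 z p0 p = 0"
  using Cauchy_Schwarz[of "[(z0, p0)]" "[(z, p)]"] by simp

lemma cont_comp: "continuous_on UNIV f \<Longrightarrow> continuous_on UNIV g \<Longrightarrow> continuous_on UNIV (\<lambda>x. C (f x) (g x) p q)"
  using continuous_on_compose2[OF cont, of UNIV "\<lambda>x. (f x, g x)" p q]
  by (auto intro: continuous_intros)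

lemma measurable_comp:
  "f \<in> borel_measurable N \<Longrightarrow> g \<in> borel_measurable N \<Longrightarrow> (\<lambda>x. C (f x) (g x) p q) \<in> borel_measurable N"
  using borel_measurable_continuous_onI[OF cont, of p q] 
  by (auto dest: measurable_compose[OF borel_measurable_Pair])

end

text \<open>The Schur complement for one scalar observation; together with \<open>cond_mean\<close>
  it is the Kalman measurement update.\<close>

definition cond_cov :: "('z, 'b) mkernel \<Rightarrow> ('z, 'b) obs \<Rightarrow> ('z, 'b) mkernel" where
  "cond_cov C d z z' p q = (case d of (z0, p0, y0, v0) \<Rightarrow>
     C z z' p q - C z0 z p0 p * C z0 z' p0 q / (C z0 z0 p0 p0 + v0))"

definition cond_mean ::
  "('z, 'b) mkernel \<Rightarrow> ('z \<Rightarrow> 'b \<Rightarrow> real) \<Rightarrow> ('z, 'b) obs \<Rightarrow> 'z \<Rightarrow> 'b \<Rightarrow> real" where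
  "cond_mean C m d z p = (case d of (z0, p0, y0, v0) \<Rightarrow>
     m z p + C z0 z p0 p / (C z0 z0 p0 p0 + v0) * (y0 - m z0 p0))"

text \<open>
  Conditioning on one scalar observation at a time needs no matrix inverse. The recursions run over
  the reversed data list, so the last observation is conditioned on last. If the denominator
  vanishes, so do all numerators, and the update is trivial.
\<close>

primrec rec_cov :: "('z, 'b) mkernel \<Rightarrow> ('z, 'b) obs list \<Rightarrow> ('z, 'b) mkernel" where
  "rec_cov K [] = K"
| "rec_cov K (d # D) = cond_cov (rec_cov K D) d"

primrec rec_mean :: "('z, 'b) mkernel \<Rightarrow> ('z, 'b) obs list \<Rightarrow> 'z \<Rightarrow> 'b \<Rightarrow> real" where
  "rec_mean K [] = (\<lambda>z p. 0)"
| "rec_mean K (d # D) = cond_mean (rec_cov K D) (rec_mean K D) d"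

text \<open>An observation with zero predictive variance is already determined by the earlier data,
  so only one value is admissible. Consistency puts the observed values into the range of the Gram
  matrix, which makes the posterior mean independent of the choice of weights.\<close>

primrec consistent :: "('z, 'b) mkernel \<Rightarrow> ('z, 'b) obs list \<Rightarrow> bool" where
  "consistent K [] \<longleftrightarrow> True"
| "consistent K (d # D) \<longleftrightarrow> consistent K D \<and>
     (case d of (z0, p0, y0, v0) \<Rightarrow>
       rec_cov K D z0 z0 p0 p0 + v0 = 0 \<longrightarrow> y0 = rec_mean K D z0 p0)"

definition noise_nonneg :: "('z, 'b) obs list \<Rightarrow> bool" where
  "noise_nonneg D \<longleftrightarrow> (\<forall>(z, p, y, v)\<in>set D. 0 \<le> v)"

context gp_kernel
begin

lemma lin_cov_cond_cov:
  "lin_cov (cond_cov C (z0, p0, y0, v0)) ts us =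
    lin_cov C ts us - lin_cov C [(z0, p0)] ts * lin_cov C [(z0, p0)] us / (C z0 z0 p0 p0 + v0)"
proof (induction ts)
  case (Cons a ts)
  obtain z p where a: "a = (z, p)" by (cases a)
  have "(\<Sum>(z', q)\<leftarrow>us. cond_cov C (z0, p0, y0, v0) z z' p q) =
      (\<Sum>(z', q)\<leftarrow>us. C z z' p q) - C z0 z p0 p * lin_cov C [(z0, p0)] us / (C z0 z0 p0 p0 + v0)"
    by (induction us) (auto simp: cond_cov_def algebra_simps add_divide_distrib)
  with Cons show ?case by (simp add: a algebra_simps add_divide_distrib)
qed simp

text \<open>Positive semidefiniteness of the update is the Cauchy-Schwarz inequality between an
  arbitrary functional and the observed one.\<close>

lemma gp_kernel_cond_cov:
  assumes "v0 \<ge> 0"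
  shows "gp_kernel (cond_cov C (z0, p0, y0, v0))"
proof (rule gp_kernel.intro)
  fix z z' :: 'z and p q :: 'b and ts :: "('z \<times> 'b) list"
  show "linear (\<lambda>p. cond_cov C (z0, p0, y0, v0) z z' p q)"
    by (rule linearI)
      (simp_all add: cond_cov_def linear_add[OF linear1] linear_scale[OF linear1] linear_add[OF linear2]
        linear_scale[OF linear2] algebra_simps add_divide_distrib)
  show "cond_cov C (z0, p0, y0, v0) z z' p q = cond_cov C (z0, p0, y0, v0) z' z q p"
    by (simp add: cond_cov_def sym[of z z' p q])
  show "continuous_on UNIV (\<lambda>(z, z'). cond_cov C (z0, p0, y0, v0) z z' p q)"
    unfolding cond_cov_def case_prod_beta fst_conv snd_conv divide_inverse
    by (intro continuous_intros cont_comp)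
  define e where "e = [(z0, p0)]"
  have s: "C z0 z0 p0 p0 = lin_cov C e e" by (simp add: e_def)
  have "(lin_cov C e ts)\<^sup>2 / (lin_cov C e e + v0) \<le> lin_cov C ts ts"
  proof (cases "lin_cov C e e + v0 = 0")
    case False
    then have "lin_cov C e e + v0 > 0" using psd[of e] assms by linarith
    moreover have "(lin_cov C e ts)\<^sup>2 \<le> lin_cov C ts ts * (lin_cov C e e + v0)"
      using Cauchy_Schwarz[of e ts] mult_nonneg_nonneg[OF psd[of ts] assms]
      by (simp add: algebra_simps)
    ultimately show ?thesis by (simp add: pos_divide_le_eq)
  qed (use psd in auto)
  then show "0 \<le> lin_cov (cond_cov C (z0, p0, y0, v0)) ts ts"
    unfolding lin_cov_cond_cov e_def[symmetric] s by (simp add: power2_eq_square)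
qed

lemma gp_kernel_rec_cov: "noise_nonneg D \<Longrightarrow> gp_kernel (rec_cov C D)"
proof (induction D)
  case Nil
  then show ?case by (simp add: gp_kernel_axioms)
next
  case (Cons d D)
  obtain z p y v where d: "d = (z, p, y, v)" by (cases d)
  have "gp_kernel (rec_cov C D)" "0 \<le> v" using Cons by (auto simp: noise_nonneg_def d)
  then show ?case using gp_kernel.gp_kernel_cond_cov by (simp add: d)
qed

lemma linear_rec_mean: "noise_nonneg D \<Longrightarrow> linear (rec_mean C D z)"
proof (induction D arbitrary: z)
  case Nil
  then show ?case by (simp add: linear_zero)
next
  case (Cons d D)
  obtain z0 p y v where d: "d = (z0, p, y, v)" by (cases d)
  interpret D: gp_kernel "rec_cov C D"
    using Cons.prems by (intro gp_kernel_rec_cov) (auto simp: noise_nonneg_def)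
  have m: "linear (rec_mean C D z)" using Cons by (auto simp: noise_nonneg_def)
  show ?case
    by (rule linearI)
      (simp_all add: d cond_mean_def linear_add[OF m] linear_scale[OF m] linear_add[OF D.linear2]
        linear_scale[OF D.linear2] algebra_simps add_divide_distrib)
qed

end

section \<open>Agreement of matrix conditioning with recursive conditioning\<close>

definition is_weights ::
  "('z, 'b) mkernel \<Rightarrow> ('z, 'b) obs list \<Rightarrow> 'z \<Rightarrow> 'b \<Rightarrow> (nat \<Rightarrow> real) \<Rightarrow> bool" where
  "is_weights K D z p w \<longleftrightarrow> (\<forall>r<length D. (\<Sum>s<length D. gram K D r s * w s) = cross K D z p r)"

lemma gram_append:
  "r < length D \<Longrightarrow> s < length D \<Longrightarrow> gram K (D @ E) r s = gram K D r s"
  by (simp add: gram_def nth_append)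

lemma cross_append: "r < length D \<Longrightarrow> cross K (D @ E) z p r = cross K D z p r"
  by (simp add: cross_def nth_append)

lemma gram_snoc:
  assumes "r < length D"
  shows "gram K (D @ [(z, p, y, v)]) r (length D) = cross K D z p r"
  using assms by (auto simp: gram_def cross_def nth_append split: prod.splits)

lemma cross_snoc [simp]: "cross K (D @ [(z0, p0, y, v)]) z p (length D) = K z0 z p0 p"
  by (auto simp: cross_def)

context gp_kernel
begin

lemma gram_sym: "gram C D r s = gram C D s r"
proof -
  obtain z p y v z' p' y' v' where "D ! r = (z, p, y, v)" "D ! s = (z', p', y', v')"
    using prod_cases4 by metis
  then show ?thesis using sym[of z z' p p'] by (auto simp: gram_def)
qed

lemma gram_snoc': "r < length D \<Longrightarrow> gram C (D @ [(z, p, y, v)]) (length D) r = cross C D z p r"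
  by (subst gram_sym) (rule gram_snoc)

lemma gram_snoc_last [simp]: "gram C (D @ [(z, p, y, v)]) (length D) (length D) = C z z p p + v"
  by (simp add: gram_def)

text \<open>Both sides are the bilinear form of the symmetric Gram matrix at \<open>w\<close> and
  \<open>w'\<close>. Fixing one of the two solutions shows that the subtracted term of the posterior
  covariance does not depend on the other.\<close>

lemma weights_cross_commute:
  assumes w: "is_weights C D z p w" and w': "is_weights C D z' q w'"
  shows "(\<Sum>r<length D. w r * cross C D z' q r) = (\<Sum>r<length D. w' r * cross C D z p r)"
proof -
  have "(\<Sum>r<length D. w r * cross C D z' q r) = (\<Sum>r<length D. w r * (\<Sum>s<length D. gram C D r s * w' s))"
    using w' by (simp add: is_weights_def)
  also have "\<dots> = (\<Sum>r<length D. \<Sum>s<length D. w' s * (gram C D s r * w r))"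
    by (simp add: sum_distrib_left gram_sym[of _ "_::nat"] mult_ac)
  also have "\<dots> = (\<Sum>s<length D. w' s * (\<Sum>r<length D. gram C D s r * w r))"
    by (subst sum.swap) (simp add: sum_distrib_left)
  also have "\<dots> = (\<Sum>r<length D. w' r * cross C D z p r)"
    using w by (simp add: is_weights_def)
  finally show ?thesis .
qed

text \<open>Block elimination for a Gram matrix enlarged by one row and column. The new weight
  \<open>b\<close> is the regression coefficient on the part of the last observation not explained
  by \<open>D\<close>, and the old weights are corrected by \<open>b\<close> times the weights
  \<open>we\<close> that predict this observation from \<open>D\<close>. Data lists grow at the end,
  hence at the head of \<open>rev D\<close>, where the recursions act.\<close>

lemma recursive_conditioning:
  assumes "noise_nonneg D"
  shows "\<exists>w. is_weights C D z p w \<and>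
      (\<forall>z' q. C z z' p q - (\<Sum>r<length D. w r * cross C D z' q r) = rec_cov C (rev D) z z' p q) \<and>
      (consistent C (rev D) \<longrightarrow>
        (\<Sum>r<length D. w r * fst (snd (snd (D ! r)))) = rec_mean C (rev D) z p)"
    and "consistent C (rev D) \<Longrightarrow>
      \<exists>a. \<forall>r<length D. (\<Sum>s<length D. gram C D r s * a s) = fst (snd (snd (D ! r)))"
proof -
  let ?y = "\<lambda>D r. fst (snd (snd (D ! r)))"
  have "(\<forall>z p. \<exists>w. is_weights C D z p w \<and>
      (\<forall>z' q. C z z' p q - (\<Sum>r<length D. w r * cross C D z' q r) = rec_cov C (rev D) z z' p q) \<and>
      (consistent C (rev D) \<longrightarrow> (\<Sum>r<length D. w r * ?y D r) = rec_mean C (rev D) z p)) \<and>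
    (consistent C (rev D) \<longrightarrow>
      (\<exists>a. \<forall>r<length D. (\<Sum>s<length D. gram C D r s * a s) = ?y D r))"
    using assms
  proof (induction D rule: rev_induct)
    case Nil
    then show ?case by (simp add: is_weights_def)
  next
    case (snoc d D)
    obtain z0 p0 y0 v0 where d: "d = (z0, p0, y0, v0)" by (cases d)
    define n where "n = length D"
    have nn: "noise_nonneg D" "noise_nonneg (rev D)" "v0 \<ge> 0"
      using snoc.prems by (auto simp: noise_nonneg_def d)
    interpret D: gp_kernel "rec_cov C (rev D)"
      using nn by (intro gp_kernel_rec_cov)
    define s0 where "s0 = rec_cov C (rev D) z0 z0 p0 p0 + v0"
    \<comment> \<open>If \<open>s0 = 0\<close>, both of its nonnegative summands vanish, and a
      functional of zero variance is uncorrelated with every other.\<close>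
    have s0_0: "rec_cov C (rev D) z0 z p0 p = 0" if "s0 = 0" for z p
      using D.cov_eq_0[of z0 p0 z p] D.var_nonneg[of z0 p0] that nn(3) by (simp add: s0_def)
    obtain we where we: "is_weights C D z0 p0 we"
      "\<And>z' q. C z0 z' p0 q - (\<Sum>r<n. we r * cross C D z' q r) = rec_cov C (rev D) z0 z' p0 q"
      "consistent C (rev D) \<Longrightarrow> (\<Sum>r<n. we r * ?y D r) = rec_mean C (rev D) z0 p0"
      using snoc.IH[OF nn(1)] unfolding n_def by blast
    have gr: "gram C (D @ [d]) r s = gram C D r s" "gram C (D @ [d]) r n = cross C D z0 p0 r"
      "gram C (D @ [d]) n r = cross C D z0 p0 r" "gram C (D @ [d]) n n = C z0 z0 p0 p0 + v0"
      if "r < n" "s < n" for r s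
      using that by (simp_all add: n_def gram_append gram_snoc gram_snoc' d)
    have gr': "gram C (D @ [d]) n n = C z0 z0 p0 p0 + v0" by (simp add: n_def d)
    have cr: "cross C (D @ [d]) z p r = cross C D z p r" "cross C (D @ [d]) z p n = C z0 z p0 p"
      if "r < n" for r z p
      using that by (simp_all add: n_def cross_append d)
    have cr': "cross C (D @ [d]) z p n = C z0 z p0 p" for z p
      by (simp add: n_def d)
    have y: "r < n \<Longrightarrow> ?y (D @ [d]) r = ?y D r" "?y (D @ [d]) n = y0" for r
      by (simp_all add: n_def nth_append d)
    have len: "length (D @ [d]) = Suc n" by (simp add: n_def)
    have weights: "\<exists>w. is_weights C (D @ [d]) z p w \<and>
      (\<forall>z' q. C z z' p q - (\<Sum>r<length (D @ [d]). w r * cross C (D @ [d]) z' q r) =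
        rec_cov C (rev (D @ [d])) z z' p q) \<and>
      (consistent C (rev (D @ [d])) \<longrightarrow>
        (\<Sum>r<length (D @ [d]). w r * ?y (D @ [d]) r) = rec_mean C (rev (D @ [d])) z p)" for z p
    proof -
      obtain w where w: "is_weights C D z p w"
        "\<And>z' q. C z z' p q - (\<Sum>r<n. w r * cross C D z' q r) = rec_cov C (rev D) z z' p q"
        "consistent C (rev D) \<Longrightarrow> (\<Sum>r<n. w r * ?y D r) = rec_mean C (rev D) z p"
        using snoc.IH[OF nn(1)] unfolding n_def by blast
      \<comment> \<open>For \<open>s0 = 0\<close> division by zero yields \<open>b = 0\<close>: a
        redundant observation gets no weight, which is a valid solution because the covariance
        vanishes too.\<close>
      define b where "b = rec_cov C (rev D) z0 z p0 p / s0"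
      have b: "b * s0 = rec_cov C (rev D) z0 z p0 p"
        using s0_0 by (cases "s0 = 0") (auto simp: b_def)
      define w' where "w' r = (if r < n then w r - b * we r else b)" for r
      have w'n: "w' n = b" by (simp add: w'_def)
      have sum_w': "(\<Sum>r<n. w' r * F r) = (\<Sum>r<n. w r * F r) - b * (\<Sum>r<n. we r * F r)" for F
        by (simp add: w'_def sum_distrib_left sum_subtractf[symmetric] algebra_simps)
      have "is_weights C (D @ [d]) z p w'"
        unfolding is_weights_def len
      proof (intro allI impI)
        fix r assume "r < Suc n"
        then consider "r < n" | "r = n" by linarith
        then show "(\<Sum>s<Suc n. gram C (D @ [d]) r s * w' s) = cross C (D @ [d]) z p r"
        proof cases
          case 1
          have "(\<Sum>s<Suc n. gram C (D @ [d]) r s * w' s) =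
              (\<Sum>s<n. w' s * gram C D r s) + b * cross C D z0 p0 r"
            using 1 by (simp add: gr w'n mult.commute)
          also have "\<dots> = cross C D z p r"
            unfolding sum_w' using we(1) w(1) 1
            by (simp add: is_weights_def n_def mult.commute[of _ "gram _ _ _ _"])
          finally show ?thesis using 1 by (simp add: cr)
        next
          case 2
          have "(\<Sum>s<Suc n. gram C (D @ [d]) r s * w' s) =
              (\<Sum>s<n. w' s * cross C D z0 p0 s) + b * (C z0 z0 p0 p0 + v0)"
            using 2 by (simp add: gr gr' w'n mult.commute)
          also have "(\<Sum>s<n. w' s * cross C D z0 p0 s) =
              C z0 z p0 p - rec_cov C (rev D) z0 z p0 p - b * (C z0 z0 p0 p0 + v0 - s0)"
            unfolding sum_w' s0_def using w(2)[of z0 p0] we(2)[of z0 p0]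
            by (simp add: sym[of z z0 p p0] D.sym[of z z0 p p0] algebra_simps)
          finally show ?thesis using b by (simp add: 2 cr' algebra_simps)
        qed
      qed
      moreover have "C z z' p q - (\<Sum>r<length (D @ [d]). w' r * cross C (D @ [d]) z' q r) =
        rec_cov C (rev (D @ [d])) z z' p q" for z' q
      proof -
        have "(\<Sum>r<length (D @ [d]). w' r * cross C (D @ [d]) z' q r) =
            (\<Sum>r<n. w' r * cross C D z' q r) + b * C z0 z' p0 q"
          unfolding len by (simp add: cr cr' w'n)
        moreover have "rec_cov C (rev (D @ [d])) z z' p q =
            rec_cov C (rev D) z z' p q - b * rec_cov C (rev D) z0 z' p0 q"
          by (simp add: d cond_cov_def b_def s0_def)
        ultimately show ?thesis
          unfolding sum_w' w(2)[of z' q, symmetric] we(2)[of z' q, symmetric]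
          by (simp add: algebra_simps)
      qed
      moreover have "(\<Sum>r<length (D @ [d]). w' r * ?y (D @ [d]) r) = rec_mean C (rev (D @ [d])) z p"
        if "consistent C (rev (D @ [d]))"
      proof -
        have c: "consistent C (rev D)" using that by simp
        have "(\<Sum>r<length (D @ [d]). w' r * ?y (D @ [d]) r) = (\<Sum>r<n. w' r * ?y D r) + b * y0"
          unfolding len by (simp add: y w'n)
        then show ?thesis
          unfolding sum_w' w(3)[OF c] we(3)[OF c]
          by (simp add: d cond_mean_def b_def s0_def algebra_simps diff_divide_distrib)
      qed
      ultimately show ?thesis by blast
    qed
    moreover have "\<exists>a. \<forall>r<length (D @ [d]). (\<Sum>s<length (D @ [d]). gram C (D @ [d]) r s * a s) = ?y (D @ [d]) r"
      if cons: "consistent C (rev (D @ [d]))"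
    proof -
      have c: "consistent C (rev D)" "s0 = 0 \<Longrightarrow> y0 = rec_mean C (rev D) z0 p0"
        using cons by (auto simp: d s0_def)
      obtain a where a: "\<And>r. r < n \<Longrightarrow> (\<Sum>s<n. gram C D r s * a s) = ?y D r"
        using snoc.IH[OF nn(1)] c(1) unfolding n_def by blast
      \<comment> \<open>The same elimination with the observed values as right-hand side; here
        consistency supplies the vanishing numerator for \<open>s0 = 0\<close>.\<close>
      define b where "b = (y0 - rec_mean C (rev D) z0 p0) / s0"
      have b: "b * s0 = y0 - rec_mean C (rev D) z0 p0"
        using c(2) by (cases "s0 = 0") (auto simp: b_def)
      define a' where "a' r = (if r < n then a r - b * we r else b)" for r
      have a'n: "a' n = b" by (simp add: a'_def)
      have sum_a': "(\<Sum>r<n. a' r * F r) = (\<Sum>r<n. a r * F r) - b * (\<Sum>r<n. we r * F r)" for F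
        by (simp add: a'_def sum_distrib_left sum_subtractf[symmetric] algebra_simps)
      have "(\<Sum>s<Suc n. gram C (D @ [d]) r s * a' s) = ?y (D @ [d]) r" if r: "r < Suc n" for r
      proof -
        consider "r < n" | "r = n" using r by linarith
        then show ?thesis
        proof cases
          case 1
          have "(\<Sum>s<Suc n. gram C (D @ [d]) r s * a' s) =
              (\<Sum>s<n. a' s * gram C D r s) + b * cross C D z0 p0 r"
            using 1 by (simp add: gr a'n mult.commute)
          also have "\<dots> = ?y D r"
            unfolding sum_a' using we(1) a[OF 1] 1
            by (simp add: is_weights_def n_def mult.commute[of _ "gram _ _ _ _"])
          finally show ?thesis using 1 by (simp add: y)
        next
          case 2
          have "(\<Sum>s<Suc n. gram C (D @ [d]) r s * a' s) =
              (\<Sum>s<n. a' s * cross C D z0 p0 s) + b * (C z0 z0 p0 p0 + v0)"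
            using 2 by (simp add: gr gr' a'n mult.commute)
          \<comment> \<open>Symmetry of the Gram matrix again: \<open>a\<close> represents the
            values and \<open>we\<close> the cross-covariances, so each may be applied to the
            other's right-hand side.\<close>
          also have "(\<Sum>s<n. a s * cross C D z0 p0 s) = (\<Sum>r<n. we r * ?y D r)"
          proof -
            have "(\<Sum>s<n. a s * cross C D z0 p0 s) = (\<Sum>s<n. a s * (\<Sum>r<n. gram C D s r * we r))"
              using we(1) by (simp add: is_weights_def n_def)
            also have "\<dots> = (\<Sum>s<n. \<Sum>r<n. we r * (gram C D r s * a s))"
              by (simp add: sum_distrib_left gram_sym[of _ "_::nat"] mult_ac)
            also have "\<dots> = (\<Sum>r<n. we r * (\<Sum>s<n. gram C D r s * a s))"
              by (subst sum.swap) (simp add: sum_distrib_left)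
            finally show ?thesis by (simp add: a)
          qed
          then have "(\<Sum>s<n. a' s * cross C D z0 p0 s) =
              rec_mean C (rev D) z0 p0 - b * (C z0 z0 p0 p0 + v0 - s0)"
            unfolding sum_a' s0_def using we(2)[of z0 p0] we(3)[OF c(1)]
            by (simp add: algebra_simps)
          finally show ?thesis using b by (simp add: 2 y algebra_simps)
        qed
      qed
      then show ?thesis unfolding len by blast
    qed
    ultimately show ?case by blast
  qed
  then show "\<exists>w. is_weights C D z p w \<and>
      (\<forall>z' q. C z z' p q - (\<Sum>r<length D. w r * cross C D z' q r) = rec_cov C (rev D) z z' p q) \<and>
      (consistent C (rev D) \<longrightarrow>
        (\<Sum>r<length D. w r * fst (snd (snd (D ! r)))) = rec_mean C (rev D) z p)"
    and "consistent C (rev D) \<Longrightarrow>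
      \<exists>a. \<forall>r<length D. (\<Sum>s<length D. gram C D r s * a s) = fst (snd (snd (D ! r)))"
    by blast+
qed

lemma is_weights_post_weights:
  assumes "noise_nonneg D"
  shows "is_weights C D z p (post_weights C D z p)"
proof -
  have "\<exists>w. is_weights C D z p w"
    using recursive_conditioning(1)[OF assms, of z p] by blast
  then show ?thesis
    unfolding post_weights_def is_weights_def by (rule someI_ex)
qed

lemma rec_cov_weights:
  assumes nn: "noise_nonneg D" and u: "is_weights C D z p u"
  shows "rec_cov C (rev D) z z' p q = C z z' p q - (\<Sum>r<length D. u r * cross C D z' q r)"
proof -
  obtain w where w: "is_weights C D z p w"
    "\<And>z' q. C z z' p q - (\<Sum>r<length D. w r * cross C D z' q r) = rec_cov C (rev D) z z' p q"
    using recursive_conditioning(1)[OF nn, of z p] by blast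
  obtain w' where w': "is_weights C D z' q w'"
    using recursive_conditioning(1)[OF nn, of z' q] by blast
  show ?thesis
    using weights_cross_commute[OF u w'] weights_cross_commute[OF w(1) w'] w(2)[of z' q] by simp
qed

text \<open>Writing the values as the Gram matrix applied to some \<open>a\<close>, the sum against
  \<open>u\<close> becomes the sum of \<open>a\<close> against the cross-covariances, in which
  \<open>u\<close> no longer occurs.\<close>

lemma rec_mean_weights:
  assumes nn: "noise_nonneg D" and cons: "consistent C (rev D)" and u: "is_weights C D z p u"
  shows "rec_mean C (rev D) z p = (\<Sum>r<length D. u r * fst (snd (snd (D ! r))))"
proof -
  let ?y = "\<lambda>r. fst (snd (snd (D ! r)))"
  obtain w where w: "is_weights C D z p w" "(\<Sum>r<length D. w r * ?y r) = rec_mean C (rev D) z p"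
    using recursive_conditioning(1)[OF nn, of z p] cons by blast
  obtain a where a: "\<And>r. r < length D \<Longrightarrow> (\<Sum>s<length D. gram C D r s * a s) = ?y r"
    using recursive_conditioning(2)[OF nn cons] by blast
  have *: "(\<Sum>r<length D. u r * ?y r) = (\<Sum>s<length D. a s * cross C D z p s)"
    if u: "is_weights C D z p u" for u
  proof -
    have "(\<Sum>r<length D. u r * ?y r) = (\<Sum>r<length D. u r * (\<Sum>s<length D. gram C D r s * a s))"
      by (simp add: a)
    also have "\<dots> = (\<Sum>r<length D. \<Sum>s<length D. a s * (gram C D s r * u r))"
      by (simp add: sum_distrib_left gram_sym[of _ "_::nat"] mult_ac)
    also have "\<dots> = (\<Sum>s<length D. a s * (\<Sum>r<length D. gram C D s r * u r))"
      by (subst sum.swap) (simp add: sum_distrib_left)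
    finally show ?thesis using u by (simp add: is_weights_def)
  qed
  show ?thesis using *[OF w(1)] *[OF u] w(2) by simp
qed

lemma post_cov_eq_rec_cov: "noise_nonneg D \<Longrightarrow> post_cov C D = rec_cov C (rev D)"
  by (intro ext) (simp add: post_cov_def rec_cov_weights[OF _ is_weights_post_weights])

lemma post_mean_eq_rec_mean:
  "noise_nonneg D \<Longrightarrow> consistent C (rev D) \<Longrightarrow> post_mean C D = rec_mean C (rev D)"
  by (intro ext) (simp add: post_mean_def rec_mean_weights[OF _ _ is_weights_post_weights])

text \<open>Without noise, column \<open>j\<close> of the Gram matrix is itself the vector of
  cross-covariances, so a unit vector solves the system. With these weights the posterior visibly
  interpolates, as used in \<open>rec_exact\<close>.\<close>

lemma is_weights_exact:
  assumes "j < length D" "D ! j = (z, p, y, 0)"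
  shows "is_weights C D z p (\<lambda>r. if r = j then 1 else 0)"
  unfolding is_weights_def
proof (intro allI impI)
  fix r assume "r < length D"
  have "(\<Sum>s<length D. gram C D r s * (if s = j then 1 else 0)) = gram C D r j"
    using assms(1) by (simp add: if_distrib cong: if_cong)
  also have "\<dots> = cross C D z p r"
    using assms(2) by (auto simp: gram_def cross_def split: prod.splits)
  finally show "(\<Sum>s<length D. gram C D r s * (if s = j then 1 else 0)) = cross C D z p r" .
qed

lemma rec_exact:
  assumes nn: "noise_nonneg D" and d: "(z, p, y, 0) \<in> set D"
  shows "rec_cov C (rev D) z z p p = 0"
    and "consistent C (rev D) \<Longrightarrow> rec_mean C (rev D) z p = y"
proof -
  obtain j where j: "j < length D" "D ! j = (z, p, y, 0)"
    using d by (metis in_set_conv_nth)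
  note w = is_weights_exact[OF j]
  have "cross C D z p j = C z z p p" by (simp add: cross_def j)
  then show "rec_cov C (rev D) z z p p = 0"
    using j by (simp add: rec_cov_weights[OF nn w] if_distrib[of "\<lambda>x. x * _"] cong: if_cong)
  show "rec_mean C (rev D) z p = y" if "consistent C (rev D)"
    using j by (simp add: rec_mean_weights[OF nn that w] if_distrib[of "\<lambda>x. x * _"] cong: if_cong)
qed

end

section \<open>Laws of Gaussian processes\<close>

definition lin_val :: "('z \<times> 'b::euclidean_space) list \<Rightarrow> ('z \<Rightarrow> 'b) \<Rightarrow> real" where
  "lin_val ts g = (\<Sum>(z, p)\<leftarrow>ts. p \<bullet> g z)"

lemma lin_val_simps [simp]:
  "lin_val [] g = 0" "lin_val ((z, p) # ts) g = p \<bullet> g z + lin_val ts g"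
  "lin_val (ts @ us) g = lin_val ts g + lin_val us g"
  by (simp_all add: lin_val_def)

lemma lin_val_scale: "lin_val (scale_list c ts) g = c * lin_val ts g"
  by (induction ts) (auto simp: algebra_simps)

lemma space_paths: "space (paths e) = {g. continuous_on UNIV (\<lambda>z. e \<bullet> g z)}"
  by (auto simp: paths_def space_restrict_space space_PiM)

lemma space_paths_nonempty: "space (paths e) \<noteq> {}"
proof -
  have "(\<lambda>_. 0) \<in> space (paths e)" by (simp add: space_paths)
  then show ?thesis by blast
qed

lemma measurable_paths_component [measurable]: "(\<lambda>g. g z) \<in> borel_measurable (paths e)"
  unfolding paths_def by (intro measurable_restrict_space1) simp

lemma measurable_lin_val [measurable]: "lin_val ts \<in> borel_measurable (paths e)"
proof (induction ts)
  case Nil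
  then show ?case by (simp add: lin_val_def)
next
  case (Cons a ts)
  obtain z p where a: "a = (z, p)" by (cases a)
  have "(\<lambda>g. p \<bullet> g z + lin_val ts g) \<in> borel_measurable (paths e)"
    using Cons by measurable
  also have "(\<lambda>g. p \<bullet> g z + lin_val ts g) = lin_val (a # ts)" by (simp add: a fun_eq_iff)
  finally show ?case .
qed

lemma measurable_pathsI:
  assumes "\<And>z. (\<lambda>x. f x z) \<in> borel_measurable M"
    and "\<And>x. x \<in> space M \<Longrightarrow> continuous_on UNIV (\<lambda>z. e \<bullet> f x z)"
  shows "f \<in> M \<rightarrow>\<^sub>M paths e"
  unfolding paths_def
proof (rule measurable_restrict_space2)
  show "f \<in> M \<rightarrow>\<^sub>M Pi\<^sub>M UNIV (\<lambda>_. borel)"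
    using measurable_PiM_single'[of UNIV "\<lambda>z x. f x z" M "\<lambda>_. borel"] assms(1) by auto
qed (use assms(2) in auto)

text \<open>Phases account for sines and the empty list for constants. The product-to-sum formula
  turns the span of these cosines into an algebra of bounded functions.\<close>

inductive_set trig :: "(('z \<Rightarrow> 'b::euclidean_space) \<Rightarrow> real) set" where
  cos: "(\<lambda>\<gamma>. c * cos (lin_val ts \<gamma> + \<phi>)) \<in> trig"
| add: "f \<in> trig \<Longrightarrow> g \<in> trig \<Longrightarrow> (\<lambda>\<gamma>. f \<gamma> + g \<gamma>) \<in> trig"

lemma trig_const: "(\<lambda>_. c) \<in> trig"
  using trig.cos[of c "[]" 0] by simp

lemma trig_mult_cos:
  assumes "f \<in> trig"
  shows "(\<lambda>\<gamma>. f \<gamma> * (c * cos (lin_val ts \<gamma> + \<phi>))) \<in> trig"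
  using assms
proof induction
  case (cos d us \<psi>)
  have "(\<lambda>\<gamma>. (c * d / 2) * cos (lin_val (us @ ts) \<gamma> + (\<psi> + \<phi>)) +
      (c * d / 2) * cos (lin_val (us @ scale_list (- 1) ts) \<gamma> + (\<psi> - \<phi>))) \<in> trig"
    by (intro trig.intros)
  also have "(\<lambda>\<gamma>. (c * d / 2) * cos (lin_val (us @ ts) \<gamma> + (\<psi> + \<phi>)) +
      (c * d / 2) * cos (lin_val (us @ scale_list (- 1) ts) \<gamma> + (\<psi> - \<phi>))) =
    (\<lambda>\<gamma>. d * cos (lin_val us \<gamma> + \<psi>) * (c * cos (lin_val ts \<gamma> + \<phi>)))"
  proof
    fix \<gamma> :: "'a \<Rightarrow> 'b"
    have "cos (lin_val us \<gamma> + \<psi>) * cos (lin_val ts \<gamma> + \<phi>) =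
      (cos (lin_val us \<gamma> + \<psi> - (lin_val ts \<gamma> + \<phi>)) + cos (lin_val us \<gamma> + \<psi> + (lin_val ts \<gamma> + \<phi>))) / 2"
      by (rule cos_times_cos)
    then have "d * cos (lin_val us \<gamma> + \<psi>) * (c * cos (lin_val ts \<gamma> + \<phi>)) = c * d / 2 *
      (cos (lin_val us \<gamma> + \<psi> - (lin_val ts \<gamma> + \<phi>)) + cos (lin_val us \<gamma> + \<psi> + (lin_val ts \<gamma> + \<phi>)))"
      by simp
    then show "(c * d / 2) * cos (lin_val (us @ ts) \<gamma> + (\<psi> + \<phi>)) +
      (c * d / 2) * cos (lin_val (us @ scale_list (- 1) ts) \<gamma> + (\<psi> - \<phi>)) =
      d * cos (lin_val us \<gamma> + \<psi>) * (c * cos (lin_val ts \<gamma> + \<phi>))"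
      unfolding lin_val_simps lin_val_scale by (simp add: algebra_simps diff_diff_eq)
  qed
  finally show ?case .
next
  case (add f g)
  then show ?case unfolding distrib_right by (intro trig.add)
qed

lemma trig_mult: "g \<in> trig \<Longrightarrow> f \<in> trig \<Longrightarrow> (\<lambda>\<gamma>. f \<gamma> * g \<gamma>) \<in> trig"
proof (induction g rule: trig.induct)
  case (cos c ts \<phi>)
  then show ?case by (rule trig_mult_cos)
next
  case (add f g)
  then show ?case unfolding distrib_left by (intro trig.add) blast+
qed

lemma trig_bounded: "f \<in> trig \<Longrightarrow> \<exists>B. \<forall>\<gamma>. \<bar>f \<gamma>\<bar> \<le> B"
proof (induction f rule: trig.induct)
  case (cos c ts \<phi>)
  have "\<bar>c * cos (lin_val ts \<gamma> + \<phi>)\<bar> \<le> \<bar>c\<bar>" for \<gamma>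
    by (simp add: abs_mult mult_left_le)
  then show ?case by blast
next
  case (add f g)
  then obtain B B' where "\<And>\<gamma>. \<bar>f \<gamma>\<bar> \<le> B" "\<And>\<gamma>. \<bar>g \<gamma>\<bar> \<le> B'" by blast
  then have "\<bar>f \<gamma> + g \<gamma>\<bar> \<le> B + B'" for \<gamma>
    by (rule order_trans[OF abs_triangle_ineq add_mono])
  then show ?case by blast
qed

lemma trig_measurable: "f \<in> trig \<Longrightarrow> f \<in> borel_measurable (paths e)"
proof (induction f rule: trig.induct)
  case (cos c ts \<phi>)
  have [measurable]: "lin_val ts \<in> borel_measurable (paths e)" by (rule measurable_lin_val)
  show ?case by measurable
next
  case (add f g)
  then show ?case by (intro borel_measurable_add)
qed

text \<open>Coordinates are unbounded and not in \<open>trig\<close>, but a real \<open>x\<close> is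
  the limit of \<open>(n + 1) * sin (x / (n + 1))\<close>, with the sine written as a cosine of
  phase \<open>- (pi / 2)\<close>.\<close>

lemma sets_paths_trig:
  fixes e :: "'b::euclidean_space"
  shows "sets (paths e :: ('z::euclidean_space \<Rightarrow> 'b) measure) \<subseteq> sigma_sets (space (paths e)) {{g \<in> space (paths e). f g > c} |f c. f \<in> trig}"
proof -
  define G :: "('z \<Rightarrow> 'b) set set" where "G = {{g \<in> space (paths e). f g > c} |f c. f \<in> trig}"
  define S where "S = sigma (space (paths e)) G"
  have G: "G \<subseteq> Pow (space (paths e))" by (auto simp: G_def)
  then have S: "space S = space (paths e)" "sets S = sigma_sets (space (paths e)) G"
    by (simp_all add: S_def)
  have trig: "f \<in> borel_measurable S" if "f \<in> trig" for f :: "('z \<Rightarrow> 'b) \<Rightarrow> real"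
    unfolding borel_measurable_iff_greater S G_def
    using that by blast
  have "(\<lambda>g. g) \<in> S \<rightarrow>\<^sub>M paths e"
  proof (rule measurable_pathsI)
    fix z :: 'z
    show "(\<lambda>g. g z) \<in> borel_measurable S"
    proof (subst borel_measurable_euclidean_space, rule ballI)
      fix b :: 'b
      have "(\<lambda>g. real (Suc n) * cos (lin_val [(z, (1 / real (Suc n)) *\<^sub>R b)] g + - (pi / 2)))
          \<in> borel_measurable S" for n
        by (intro trig trig.cos)
      moreover have "(\<lambda>n. real (Suc n) * cos (lin_val [(z, (1 / real (Suc n)) *\<^sub>R b)] g + - (pi / 2)))
          \<longlonglongrightarrow> g z \<bullet> b" for g :: "'z \<Rightarrow> 'b"
      proof -
        let ?x = "g z \<bullet> b"
        have "((\<lambda>h. sin (?x * h)) has_real_derivative cos (?x * 0) * ?x) (at 0)"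
          by (auto intro!: derivative_eq_intros)
        then have "(\<lambda>h. sin (?x * h) / h) \<midarrow>0\<rightarrow> ?x"
          by (simp add: DERIV_def)
        moreover have "filterlim (\<lambda>n. 1 / real (Suc n)) (at 0) sequentially"
          using LIMSEQ_inverse_real_of_nat
          by (auto simp: filterlim_at inverse_eq_divide simp del: of_nat_Suc)
        ultimately have "(\<lambda>n. sin (?x * (1 / real (Suc n))) / (1 / real (Suc n))) \<longlonglongrightarrow> ?x"
          by (rule filterlim_compose)
        then show ?thesis
          by (simp add: cos_diff inner_commute mult.commute)
      qed
      ultimately show "(\<lambda>g. g z \<bullet> b) \<in> borel_measurable S"
        by (rule borel_measurable_LIMSEQ_real[rotated])
    qed
  qed (auto simp: S space_paths)
  then have "A \<in> sets S" if "A \<in> sets (paths e)" for A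
    using measurable_sets[of "\<lambda>g. g" S "paths e" A] that sets.sets_into_space[OF that] S(1)
    by (simp add: Int_absorb2)
  then show ?thesis unfolding S G_def by blast
qed

text \<open>Reduces measurability of a kernel into path space to its finite-dimensional
  characteristic functions: linearity of the integral passes from single cosines to all of
  \<open>trig\<close>.\<close>

lemma measurable_kernel_pathsI:
  fixes \<kappa> :: "'w \<Rightarrow> ('z::euclidean_space \<Rightarrow> 'b::euclidean_space) measure"
  assumes sub: "\<And>w. w \<in> space N \<Longrightarrow> subprob_space (\<kappa> w)"
    and sets: "\<And>w. w \<in> space N \<Longrightarrow> sets (\<kappa> w) = sets (paths e)"
    and cos: "\<And>ts \<phi>. (\<lambda>w. \<integral>\<gamma>. cos (lin_val ts \<gamma> + \<phi>) \<partial>\<kappa> w) \<in> borel_measurable N"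
  shows "\<kappa> \<in> N \<rightarrow>\<^sub>M subprob_algebra (paths e)"
proof (rule measurable_subprob_algebra_function_algebra[where A = trig, OF sub sets _ _ trig_const trig.add _ _ sets_paths_trig])
  show "\<exists>B. \<forall>x\<in>space (paths e). \<bar>f x\<bar> \<le> B" if "f \<in> trig" for f :: "('z \<Rightarrow> 'b) \<Rightarrow> real"
    using trig_bounded[OF that] by blast
  show "f \<in> borel_measurable (paths e)" if "f \<in> trig" for f :: "('z \<Rightarrow> 'b) \<Rightarrow> real"
    using that by (rule trig_measurable)
  show "(\<lambda>x. f x * g x) \<in> trig" if "f \<in> trig" "g \<in> trig" for f g :: "('z \<Rightarrow> 'b) \<Rightarrow> real"
    using trig_mult that by blast
  show "(\<lambda>w. integral\<^sup>L (\<kappa> w) f) \<in> borel_measurable N" if "f \<in> trig" for f :: "('z \<Rightarrow> 'b) \<Rightarrow> real"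
    using that
  proof induction
    case (cos c ts \<phi>)
    then show ?case using assms(3)[of ts \<phi>] by simp
  next
    case (add f g)
    have "integral\<^sup>L (\<kappa> w) (\<lambda>\<gamma>. f \<gamma> + g \<gamma>) = integral\<^sup>L (\<kappa> w) f + integral\<^sup>L (\<kappa> w) g"
      if w: "w \<in> space N" for w
    proof (rule Bochner_Integration.integral_add)
      interpret subprob_space "\<kappa> w" by (rule sub[OF w])
      have "integrable (\<kappa> w) h" if h: "h \<in> trig" for h :: "('z \<Rightarrow> 'b) \<Rightarrow> real"
      proof -
        obtain B where "\<And>\<gamma>. \<bar>h \<gamma>\<bar> \<le> B" using trig_bounded[OF h] by blast
        moreover have "h \<in> borel_measurable (\<kappa> w)"
          using trig_measurable[OF that, of e] sets[OF w] by (simp cong: measurable_cong_sets)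
        ultimately show ?thesis by (intro integrable_const_bound[of _ B]) auto
      qed
      then show "integrable (\<kappa> w) f" "integrable (\<kappa> w) g" using add.hyps by blast+
    qed
    then have "(\<lambda>w. integral\<^sup>L (\<kappa> w) (\<lambda>\<gamma>. f \<gamma> + g \<gamma>)) \<in> borel_measurable N \<longleftrightarrow>
        (\<lambda>w. integral\<^sup>L (\<kappa> w) f + integral\<^sup>L (\<kappa> w) g) \<in> borel_measurable N"
      by (rule measurable_cong)
    then show ?case using add.IH by simp
  qed
qed

text \<open>The sigma-algebra \<open>{{}, UNIV}\<close> on the parameter space turns measurability into constancy.\<close>

lemma prob_paths_eqI:
  fixes P Q :: "('z::euclidean_space \<Rightarrow> 'b::euclidean_space) measure"
  assumes P: "prob_space P" "sets P = sets (paths e)" and Q: "prob_space Q" "sets Q = sets (paths e)"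
    and cos: "\<And>ts \<phi>. (\<integral>g. cos (lin_val ts g + \<phi>) \<partial>P) = (\<integral>g. cos (lin_val ts g + \<phi>) \<partial>Q)"
  shows "P = Q"
proof (rule measure_eqI)
  show "sets P = sets Q" using P Q by simp
  fix A assume "A \<in> sets P"
  then have A: "A \<in> sets (paths e)" using P by simp
  define N :: "bool measure" where "N = sigma UNIV {}"
  have N: "space N = UNIV" "sets N = {{}, UNIV}"
    by (auto simp: N_def sigma_sets_empty_eq)
  let ?\<kappa> = "\<lambda>b. if b then P else Q"
  have "?\<kappa> \<in> N \<rightarrow>\<^sub>M subprob_algebra (paths e)"
  proof (rule measurable_kernel_pathsI)
    show "subprob_space (?\<kappa> b)" "sets (?\<kappa> b) = sets (paths e)" for b
      using P Q by (auto intro: prob_space_imp_subprob_space)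
    fix ts \<phi>
    have "(\<lambda>b. \<integral>g. cos (lin_val ts g + \<phi>) \<partial>?\<kappa> b) = (\<lambda>b. \<integral>g. cos (lin_val ts g + \<phi>) \<partial>P)"
      using cos by auto
    then show "(\<lambda>b. \<integral>g. cos (lin_val ts g + \<phi>) \<partial>?\<kappa> b) \<in> borel_measurable N" by simp
  qed
  from measurable_emeasure_kernel[OF this A]
  have "(\<lambda>b. emeasure (?\<kappa> b) A) -` {emeasure P A} \<inter> space N \<in> sets N"
    by (rule measurable_sets) simp
  then have "(\<lambda>b. emeasure (?\<kappa> b) A) -` {emeasure P A} \<in> {{}, UNIV}"
    by (simp add: N)
  moreover have "True \<in> (\<lambda>b. emeasure (?\<kappa> b) A) -` {emeasure P A}" by simp
  ultimately have "False \<in> (\<lambda>b. emeasure (?\<kappa> b) A) -` {emeasure P A}" by blast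
  then show "emeasure P A = emeasure Q A" by simp
qed

section \<open>One-dimensional Gaussian laws and uniqueness of process laws\<close>

lemma prob_space_gauss: "v \<ge> 0 \<Longrightarrow> prob_space (gauss m v)"
  by (auto simp: gauss_def prob_space_normal_density intro: prob_space_return)

lemma sets_gauss [simp]: "sets (gauss m v) = sets borel"
  by (simp add: gauss_def)

lemma space_gauss [simp]: "space (gauss m v) = UNIV"
  using sets_eq_imp_space_eq[OF sets_gauss] by simp

lemma integral_cos_std_normal:
  "(\<integral>x. cos (b * x + a) \<partial>std_normal_distribution) = exp (- (b\<^sup>2) / 2) * cos a"
proof -
  interpret real_distribution std_normal_distribution by (rule real_dist_normal_dist)
  have "(\<integral>x. cos (b * x + a) \<partial>std_normal_distribution) =
      (\<integral>x. Re (iexp a * iexp (b * x)) \<partial>std_normal_distribution)"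
    by (simp add: exp_add[symmetric] Re_exp algebra_simps)
  also have "\<dots> = Re (\<integral>x. iexp a * iexp (b * x) \<partial>std_normal_distribution)"
    by (intro integral_Re integrable_mult_right integrable_iexp) auto
  also have "(\<integral>x. iexp a * iexp (b * x) \<partial>std_normal_distribution) =
      iexp a * char std_normal_distribution b"
    by (simp add: char_def)
  also have "Re \<dots> = exp (- (b\<^sup>2) / 2) * cos a"
    by (simp add: char_std_normal_distribution Re_exp)
  finally show ?thesis .
qed

lemma integral_cos_gauss:
  assumes "v \<ge> 0"
  shows "(\<integral>x. cos (b * x + a) \<partial>gauss m v) = exp (- (b\<^sup>2 * v) / 2) * cos (b * m + a)"
proof (cases "v = 0")
  case True
  then show ?thesis by (simp add: gauss_def integral_return)
next
  case False
  then have s: "sqrt v > 0" using assms by simp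
  have "(\<integral>x. cos (b * x + a) \<partial>gauss m v) =
      (\<integral>x. normal_density m (sqrt v) x *\<^sub>R cos (b * x + a) \<partial>lborel)"
    using False by (simp add: gauss_def integral_density)
  also have "\<dots> = \<bar>sqrt v\<bar> *\<^sub>R (\<integral>x. normal_density m (sqrt v) (m + sqrt v * x) *\<^sub>R
      cos (b * (m + sqrt v * x) + a) \<partial>lborel)"
    using s by (intro lborel_integral_real_affine) auto
  also have "\<dots> = (\<integral>x. sqrt v * (normal_density m (sqrt v) (m + sqrt v * x) *
      cos (b * (m + sqrt v * x) + a)) \<partial>lborel)"
    using s by simp
  also have "\<dots> = (\<integral>x. std_normal_density x *\<^sub>R cos ((b * sqrt v) * x + (b * m + a)) \<partial>lborel)"
  proof (rule Bochner_Integration.integral_cong[OF refl])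
    fix x
    have "sqrt v * normal_density m (sqrt v) (m + sqrt v * x) = std_normal_density x"
      using s by (simp add: normal_density_def real_sqrt_mult power_mult_distrib field_simps)
    then show "sqrt v * (normal_density m (sqrt v) (m + sqrt v * x) *
        cos (b * (m + sqrt v * x) + a)) = std_normal_density x *\<^sub>R cos ((b * sqrt v) * x + (b * m + a))"
      by (simp add: algebra_simps)
  qed
  also have "\<dots> = (\<integral>x. cos ((b * sqrt v) * x + (b * m + a)) \<partial>std_normal_distribution)"
    by (simp add: integral_density)
  also have "\<dots> = exp (- (b\<^sup>2 * v) / 2) * cos (b * m + a)"
    unfolding integral_cos_std_normal using assms by (simp add: power_mult_distrib)
  finally show ?thesis .
qed

text \<open>The phases 0 and \<open>- pi / 2\<close> give the real and the imaginary part of the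
  characteristic function.\<close>

lemma real_distribution_eqI_cos:
  assumes P: "real_distribution P" and Q: "real_distribution Q"
    and cos: "\<And>b a. (\<integral>x. cos (b * x + a) \<partial>P) = (\<integral>x. cos (b * x + a) \<partial>Q)"
  shows "P = Q"
proof (rule Levy_uniqueness[OF P Q], rule ext)
  fix t
  have char: "char R t = complex_of_real (\<integral>x. cos (t * x + 0) \<partial>R) +
      \<i> * complex_of_real (\<integral>x. cos (t * x + (- pi / 2)) \<partial>R)" if R: "real_distribution R" for R
  proof -
    interpret real_distribution R by fact
    have int: "integrable R (\<lambda>x. iexp (t * x))" by (intro integrable_iexp) auto
    have "char R t = complex_of_real (Re (char R t)) + \<i> * complex_of_real (Im (char R t))"
      by (rule complex_eq)
    moreover have "Re (char R t) = (\<integral>x. cos (t * x + 0) \<partial>R)"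
      unfolding char_def using int by (subst integral_Re[symmetric]) (simp_all add: Re_exp)
    moreover have "Im (char R t) = (\<integral>x. cos (t * x + (- pi / 2)) \<partial>R)"
      unfolding char_def using int by (subst integral_Im[symmetric]) (simp_all add: Im_exp cos_diff)
    ultimately show ?thesis by simp
  qed
  show "char P t = char Q t"
    unfolding char[OF P] char[OF Q] cos ..
qed

lemma lin_val_eq: "lin_val ts = (\<lambda>g. \<Sum>(z, p)\<leftarrow>ts. p \<bullet> g z)"
  by (simp add: lin_val_def fun_eq_iff)

lemma is_gp_lawD:
  assumes "is_gp_law e m C P"
  shows "prob_space P" "sets P = sets (paths e)"
    "distr P borel (lin_val ts) = gauss (lin_mean m ts) (lin_cov C ts ts)"
  using assms by (simp_all add: is_gp_law_def lin_mean_def lin_cov_def lin_val_eq)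

text \<open>A Cramer-Wold argument: the prescribed one-dimensional laws of all linear functionals
  fix the integrals of all cosines.\<close>

lemma is_gp_law_unique:
  assumes "is_gp_law e m C P" "is_gp_law e m C Q"
  shows "P = Q"
proof (rule prob_paths_eqI[OF is_gp_lawD(1,2)[OF assms(1)] is_gp_lawD(1,2)[OF assms(2)]])
  fix ts and \<phi> :: real
  have "(\<integral>g. cos (lin_val ts g + \<phi>) \<partial>R) = (\<integral>x. cos (x + \<phi>) \<partial>gauss (lin_mean m ts) (lin_cov C ts ts))"
    if "is_gp_law e m C R" for R
  proof -
    have "lin_val ts \<in> borel_measurable R"
      using measurable_lin_val[of ts e] is_gp_lawD(2)[OF that] by (simp cong: measurable_cong_sets)
    then show ?thesis
      unfolding is_gp_lawD(3)[OF that, symmetric] by (subst integral_distr) auto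
  qed
  then show "(\<integral>g. cos (lin_val ts g + \<phi>) \<partial>P) = (\<integral>g. cos (lin_val ts g + \<phi>) \<partial>Q)"
    using assms by simp
qed

lemma gp_law_eqI:
  assumes "is_gp_law e (post_mean K D) (post_cov K D) P"
  shows "gp_law e K D = P"
proof -
  have "(THE P. is_gp_law e (post_mean K D) (post_cov K D) P) = P"
    using assms is_gp_law_unique[OF _ assms] by (rule the_equality)
  then show ?thesis using assms unfolding gp_law_def by auto
qed

lemma is_gp_law_gp_law:
  assumes "\<exists>P. is_gp_law e (post_mean K D) (post_cov K D) P"
  shows "is_gp_law e (post_mean K D) (post_cov K D) (gp_law e K D)"
  using assms gp_law_eqI by metis

lemma sets_gp_law [simp]: "sets (gp_law e K D) = sets (paths e)"
proof (cases "\<exists>P. is_gp_law e (post_mean K D) (post_cov K D) P")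
  case True
  then show ?thesis by (intro is_gp_lawD(2)[OF is_gp_law_gp_law])
qed (simp add: gp_law_def)

lemma space_gp_law [simp]: "space (gp_law e K D) = space (paths e)"
  by (rule sets_eq_imp_space_eq) simp

context gp_kernel
begin

lemma integral_cos_gp_law:
  assumes "is_gp_law e m C P"
  shows "(\<integral>g. cos (lin_val ts g + \<phi>) \<partial>P) = exp (- lin_cov C ts ts / 2) * cos (lin_mean m ts + \<phi>)"
proof -
  have "lin_val ts \<in> borel_measurable P"
    using measurable_lin_val[of ts e] is_gp_lawD(2)[OF assms] by (simp cong: measurable_cong_sets)
  then have "(\<integral>g. cos (lin_val ts g + \<phi>) \<partial>P) = (\<integral>x. cos (1 * x + \<phi>) \<partial>distr P borel (lin_val ts))"
    by (subst integral_distr) auto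
  also have "\<dots> = exp (- lin_cov C ts ts / 2) * cos (lin_mean m ts + \<phi>)"
    unfolding is_gp_lawD(3)[OF assms] by (subst integral_cos_gauss) (simp_all add: psd)
  finally show ?thesis .
qed

text \<open>Scaling the list \<open>ts\<close> by \<open>b\<close> scales its functional by
  \<open>b\<close>; hence the assumed formula, applied to scaled lists, gives the characteristic
  function of each functional at every frequency.\<close>

lemma is_gp_lawI:
  assumes P: "prob_space P" "sets P = sets (paths e)" and m: "\<And>z. linear (m z)"
    and cos: "\<And>ts \<phi>. (\<integral>g. cos (lin_val ts g + \<phi>) \<partial>P) =
      exp (- lin_cov C ts ts / 2) * cos (lin_mean m ts + \<phi>)"
  shows "is_gp_law e m C P"
proof -
  interpret prob_space P by fact
  have meas: "lin_val ts \<in> borel_measurable P" for ts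
    using measurable_lin_val[of ts e] P(2) by (simp cong: measurable_cong_sets)
  have "distr P borel (lin_val ts) = gauss (lin_mean m ts) (lin_cov C ts ts)" for ts
  proof (rule real_distribution_eqI_cos)
    show "real_distribution (distr P borel (lin_val ts))"
      using meas by (rule real_distribution_distr)
    show "real_distribution (gauss (lin_mean m ts) (lin_cov C ts ts))"
      by (simp add: real_distribution_def real_distribution_axioms_def prob_space_gauss psd)
    fix b a :: real
    have "(\<integral>x. cos (b * x + a) \<partial>distr P borel (lin_val ts)) = (\<integral>g. cos (lin_val (scale_list b ts) g + a) \<partial>P)"
      using meas by (subst integral_distr) (auto simp: lin_val_scale)
    also have "\<dots> = (\<integral>x. cos (b * x + a) \<partial>gauss (lin_mean m ts) (lin_cov C ts ts))"
      unfolding cos integral_cos_gauss[OF psd]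
      by (simp add: lin_mean_scale[OF m] lin_cov_scale1 lin_cov_scale2 power2_eq_square mult.assoc)
    finally show "(\<integral>x. cos (b * x + a) \<partial>distr P borel (lin_val ts)) =
        (\<integral>x. cos (b * x + a) \<partial>gauss (lin_mean m ts) (lin_cov C ts ts))" .
  qed
  then show ?thesis
    using P by (simp add: is_gp_law_def lin_mean_def lin_cov_def lin_val_eq)
qed

end

section \<open>Disintegration of a Gaussian process along observations\<close>

text \<open>The pathwise update (Matheron's rule) that makes the observation of \<open>p0 \<bullet> g z0\<close> equal to \<open>x\<close>.\<close>

definition cond_path ::
  "('z, 'b::euclidean_space) mkernel \<Rightarrow> 'z \<Rightarrow> 'b \<Rightarrow> real \<Rightarrow> ('z \<Rightarrow> 'b) \<Rightarrow> 'z \<Rightarrow> 'b" where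
  "cond_path C z0 p0 x g z =
    g z + ((x - p0 \<bullet> g z0) / C z0 z0 p0 p0) *\<^sub>R (\<Sum>b\<in>Basis. C z0 z p0 b *\<^sub>R b)"

text \<open>The sum is the Riesz representative of \<open>f\<close>. In \<open>cond_path\<close> it
  makes the update move each functional in proportion to its covariance with the
  observation.\<close>

lemma linear_eq_inner_sum:
  fixes f :: "'b::euclidean_space \<Rightarrow> real"
  assumes "linear f"
  shows "p \<bullet> (\<Sum>b\<in>Basis. f b *\<^sub>R b) = f p"
proof -
  have "f p = f (\<Sum>b\<in>Basis. (p \<bullet> b) *\<^sub>R b)" by (simp add: euclidean_representation)
  also have "\<dots> = (\<Sum>b\<in>Basis. (p \<bullet> b) * f b)"
    using assms by (simp add: linear_sum linear_scale)
  finally show ?thesis by (simp add: inner_sum_right mult.commute)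
qed

context gp_kernel
begin

lemma inner_cond_path:
  "p \<bullet> cond_path C z0 p0 x g z = p \<bullet> g z + (x - p0 \<bullet> g z0) / C z0 z0 p0 p0 * C z0 z p0 p"
  unfolding cond_path_def inner_add_right inner_scaleR_right linear_eq_inner_sum[OF linear2] ..

lemma lin_val_cond_path:
  "lin_val ts (cond_path C z0 p0 x g) =
    lin_val ts g + (x - p0 \<bullet> g z0) * (lin_cov C [(z0, p0)] ts / C z0 z0 p0 p0)"
proof (induction ts)
  case (Cons a ts)
  obtain z p where a: "a = (z, p)" by (cases a)
  show ?case
    using Cons by (simp add: a inner_cond_path algebra_simps add_divide_distrib)
qed simp

lemma measurable_cond_path:
  "(\<lambda>(x, g). cond_path C z0 p0 x g) \<in> borel \<Otimes>\<^sub>M paths e \<rightarrow>\<^sub>M paths e"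
proof (rule measurable_pathsI)
  fix z :: 'z
  have [measurable]: "(\<lambda>x. snd x z) \<in> borel_measurable (borel \<Otimes>\<^sub>M paths e)" for z :: 'z
    by (rule measurable_compose[OF measurable_snd measurable_paths_component])
  show "(\<lambda>x. (case x of (x, g) \<Rightarrow> cond_path C z0 p0 x g) z) \<in> borel_measurable (borel \<Otimes>\<^sub>M paths e)"
    unfolding case_prod_beta cond_path_def by measurable
next
  fix x :: "real \<times> ('z \<Rightarrow> 'b)"
  assume "x \<in> space (borel \<Otimes>\<^sub>M paths e)"
  then have "continuous_on UNIV (\<lambda>z. e \<bullet> snd x z)"
    by (auto simp: space_pair_measure space_paths)
  then show "continuous_on UNIV (\<lambda>z. e \<bullet> (case x of (x, g) \<Rightarrow> cond_path C z0 p0 x g) z)"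
    unfolding case_prod_beta inner_cond_path
    by (intro continuous_on_add continuous_on_mult continuous_on_const cont_comp continuous_on_id)
qed

lemma measurable_cond_path_snd: "cond_path C z0 p0 x \<in> paths e \<rightarrow>\<^sub>M paths e"
  using measurable_compose[OF measurable_Pair1'[of x borel] measurable_cond_path[of z0 p0 e]] by simp

text \<open>After the update, the functional \<open>ts\<close> is its regression residual on the
  observation plus the constant \<open>a ts * x\<close>. The residual is the linear functional of
  the enlarged list \<open>?ts\<close>, so the Gaussian cosine formula applies to it.\<close>

lemma integral_cos_cond_path:
  fixes z0 :: 'z and p0 :: 'b
  assumes P: "is_gp_law e m C P" and m: "\<And>z. linear (m z)"
  defines "a \<equiv> \<lambda>ts. lin_cov C [(z0, p0)] ts / C z0 z0 p0 p0"
  shows "(\<integral>g. cos (lin_val ts (cond_path C z0 p0 x g) + \<phi>) \<partial>P) =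
    exp (- (lin_cov C ts ts - a ts * lin_cov C [(z0, p0)] ts) / 2) *
    cos (a ts * x + (lin_mean m ts - a ts * m z0 p0 + \<phi>))"
proof -
  \<comment> \<open>This also holds for a degenerate observation: Cauchy-Schwarz then makes the
    covariance zero.\<close>
  have as: "a ts * C z0 z0 p0 p0 = lin_cov C [(z0, p0)] ts"
    using Cauchy_Schwarz[of "[(z0, p0)]" ts] by (cases "C z0 z0 p0 p0 = 0") (auto simp: a_def)
  let ?ts = "ts @ scale_list (- a ts) [(z0, p0)]"
  have "(\<integral>g. cos (lin_val ts (cond_path C z0 p0 x g) + \<phi>) \<partial>P) =
      (\<integral>g. cos (lin_val ?ts g + (a ts * x + \<phi>)) \<partial>P)"
  proof -
    have "lin_cov C [(z0, p0)] ts / C z0 z0 p0 p0 = a ts" by (simp only: a_def)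
    then show ?thesis
      unfolding lin_val_cond_path lin_val_simps(3) lin_val_scale by (simp add: algebra_simps)
  qed
  also have "\<dots> = exp (- lin_cov C ?ts ?ts / 2) * cos (lin_mean m ?ts + (a ts * x + \<phi>))"
    by (rule integral_cos_gp_law[OF P])
  also have "lin_mean m ?ts = lin_mean m ts - a ts * m z0 p0"
    unfolding lin_mean_simps(3) lin_mean_scale[OF m] by simp
  also have "lin_cov C ?ts ?ts = lin_cov C ts ts - 2 * a ts * lin_cov C [(z0, p0)] ts +
      a ts * (a ts * C z0 z0 p0 p0)"
    unfolding lin_cov_simps(3,5) lin_cov_scale1 lin_cov_scale2 lin_cov_sym[of ts "[(z0, p0)]"]
    by (simp add: algebra_simps)
  finally show ?thesis unfolding as by (simp add: algebra_simps)
qed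

lemma lin_mean_cond_mean:
  "lin_mean (cond_mean C m (z0, p0, x, v)) ts =
    lin_mean m ts + lin_cov C [(z0, p0)] ts / (C z0 z0 p0 p0 + v) * (x - m z0 p0)"
proof (induction ts)
  case (Cons a ts)
  obtain z p where a: "a = (z, p)" by (cases a)
  show ?case
    using Cons by (simp add: a cond_mean_def algebra_simps add_divide_distrib)
qed simp

lemma linear_cond_mean:
  assumes m: "\<And>z. linear (m z)"
  shows "linear (cond_mean C m (z0, p0, x, v) z)"
  by (rule linearI)
    (simp_all add: cond_mean_def linear_add[OF m] linear_scale[OF m] linear_add[OF linear2]
      linear_scale[OF linear2] algebra_simps add_divide_distrib)

text \<open>Exhibits the conditional law as an image of \<open>P\<close>, so that existence of a law
  passes from the old data to the data with one more exact observation.\<close>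

lemma is_gp_law_cond_path:
  assumes P: "is_gp_law e m C P" and m: "\<And>z. linear (m z)"
  shows "is_gp_law e (cond_mean C m (z0, p0, x, 0)) (cond_cov C (z0, p0, x, 0))
    (distr P (paths e) (cond_path C z0 p0 x))"
proof -
  interpret C': gp_kernel "cond_cov C (z0, p0, x, 0)"
    by (rule gp_kernel_cond_cov) simp
  interpret prob_space P by (rule is_gp_lawD[OF P])
  have meas: "cond_path C z0 p0 x \<in> P \<rightarrow>\<^sub>M paths e"
    using measurable_cond_path_snd[of z0 p0 x e] is_gp_lawD(2)[OF P] by (simp cong: measurable_cong_sets)
  show ?thesis
  proof (rule C'.is_gp_lawI)
    show "prob_space (distr P (paths e) (cond_path C z0 p0 x))"
      using meas by (rule prob_space_distr)
    show "linear (cond_mean C m (z0, p0, x, 0) z)" for z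
      using m by (rule linear_cond_mean)
    fix ts \<phi>
    have "(\<integral>g. cos (lin_val ts g + \<phi>) \<partial>distr P (paths e) (cond_path C z0 p0 x)) =
        (\<integral>g. cos (lin_val ts (cond_path C z0 p0 x g) + \<phi>) \<partial>P)"
      using meas by (subst integral_distr) auto
    then show "(\<integral>g. cos (lin_val ts g + \<phi>) \<partial>distr P (paths e) (cond_path C z0 p0 x)) =
        exp (- lin_cov (cond_cov C (z0, p0, x, 0)) ts ts / 2) *
        cos (lin_mean (cond_mean C m (z0, p0, x, 0)) ts + \<phi>)"
      unfolding integral_cos_cond_path[OF P m] lin_cov_cond_cov lin_mean_cond_mean
      by (simp add: algebra_simps diff_divide_distrib)
  qed simp
qed

lemma distr_observation:
  assumes "is_gp_law e m C P"
  shows "distr P borel (\<lambda>g. p0 \<bullet> g z0) = gauss (m z0 p0) (C z0 z0 p0 p0)"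
  using is_gp_lawD(3)[OF assms, of "[(z0, p0)]"] by (simp add: lin_val_eq)

lemma measurable_observation:
  assumes "is_gp_law e m C P"
  shows "(\<lambda>g. p0 \<bullet> g z0) \<in> borel_measurable P"
proof -
  have "(\<lambda>g. p0 \<bullet> g z0) \<in> borel_measurable (paths e)" by measurable
  then show ?thesis
    using is_gp_lawD(2)[OF assms] by (simp cong: measurable_cong_sets)
qed

text \<open>
  A path of the process is recovered by the pathwise update of an independent path towards an
  independent observation: both sides have the same finite-dimensional characteristic functions.
\<close>

lemma gp_law_mixture:
  assumes P: "is_gp_law e m C P" and m: "\<And>z. linear (m z)"
    and f: "f \<in> borel_measurable (paths e)"
  shows "(\<integral>\<^sup>+g. f g \<partial>P) =
    (\<integral>\<^sup>+g'. \<integral>\<^sup>+g. f g \<partial>distr P (paths e) (cond_path C z0 p0 (p0 \<bullet> g' z0)) \<partial>P)"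
proof -
  define Q where "Q = distr P borel (\<lambda>g. p0 \<bullet> g z0)"
  have Q: "Q = gauss (m z0 p0) (C z0 z0 p0 p0)"
    unfolding Q_def by (rule distr_observation[OF P])
  interpret P: prob_space P by (rule is_gp_lawD[OF P])
  interpret Q: prob_space Q unfolding Q by (rule prob_space_gauss) (rule var_nonneg)
  interpret QP: pair_prob_space Q P ..
  have sP: "sets P = sets (paths e)" by (rule is_gp_lawD[OF P])
  have sQ: "sets Q = sets borel" by (simp add: Q)
  have sQP: "sets (Q \<Otimes>\<^sub>M P) = sets (borel \<Otimes>\<^sub>M paths e)"
    using sP sQ by (rule sets_pair_measure_cong[rotated])
  define T where "T = (\<lambda>(x, g). cond_path C z0 p0 x g)"
  have T: "T \<in> Q \<Otimes>\<^sub>M P \<rightarrow>\<^sub>M paths e"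
    using measurable_cond_path[of z0 p0 e] sQP unfolding T_def by (simp cong: measurable_cong_sets)
  have "is_gp_law e m C (distr (Q \<Otimes>\<^sub>M P) (paths e) T)"
  proof (rule is_gp_lawI[OF _ _ m])
    show "prob_space (distr (Q \<Otimes>\<^sub>M P) (paths e) T)"
      using T by (rule QP.prob_space_distr)
    fix ts :: "('z \<times> 'b) list" and \<phi> :: real
    define a where "a = lin_cov C [(z0, p0)] ts / C z0 z0 p0 p0"
    have as: "a * C z0 z0 p0 p0 = lin_cov C [(z0, p0)] ts"
      using Cauchy_Schwarz[of "[(z0, p0)]" ts] by (cases "C z0 z0 p0 p0 = 0") (auto simp: a_def)
    have cosT: "(\<lambda>x. cos (lin_val ts (T x) + \<phi>)) \<in> borel_measurable (Q \<Otimes>\<^sub>M P)"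
      using measurable_compose[OF T measurable_lin_val, of ts] by measurable
    have "(\<integral>g. cos (lin_val ts g + \<phi>) \<partial>distr (Q \<Otimes>\<^sub>M P) (paths e) T) =
        (\<integral>x. cos (lin_val ts (T x) + \<phi>) \<partial>(Q \<Otimes>\<^sub>M P))"
      using T by (subst integral_distr) auto
    also have "\<dots> = (\<integral>x. \<integral>g. cos (lin_val ts (T (x, g)) + \<phi>) \<partial>P \<partial>Q)"
      using cosT by (intro QP.integral_fst'[symmetric] QP.integrable_const_bound[of _ 1]) auto
    also have "\<dots> = (\<integral>x. exp (- (lin_cov C ts ts - a * lin_cov C [(z0, p0)] ts) / 2) *
        cos (a * x + (lin_mean m ts - a * m z0 p0 + \<phi>)) \<partial>Q)"
      unfolding T_def prod.case integral_cos_cond_path[OF P m] a_def ..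
    also have "\<dots> = exp (- (lin_cov C ts ts - a * lin_cov C [(z0, p0)] ts) / 2) *
        (exp (- (a\<^sup>2 * C z0 z0 p0 p0) / 2) * cos (lin_mean m ts + \<phi>))"
      unfolding Q by (simp add: integral_cos_gauss[OF var_nonneg])
    \<comment> \<open>Law of total variance: averaging over the observation contributes the
      explained variance, exactly what the residual variance lacks.\<close>
    also have "\<dots> = exp (- lin_cov C ts ts / 2) * cos (lin_mean m ts + \<phi>)"
    proof -
      have "a\<^sup>2 * C z0 z0 p0 p0 = a * lin_cov C [(z0, p0)] ts"
        unfolding power2_eq_square mult.assoc as ..
      then have "- (lin_cov C ts ts - a * lin_cov C [(z0, p0)] ts) / 2 + - (a\<^sup>2 * C z0 z0 p0 p0) / 2 =
          - lin_cov C ts ts / 2"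
        by (simp add: field_simps)
      then show ?thesis by (simp only: mult.assoc[symmetric] exp_add[symmetric])
    qed
    finally show "(\<integral>g. cos (lin_val ts g + \<phi>) \<partial>distr (Q \<Otimes>\<^sub>M P) (paths e) T) =
        exp (- lin_cov C ts ts / 2) * cos (lin_mean m ts + \<phi>)" .
  qed simp
  then have eq: "P = distr (Q \<Otimes>\<^sub>M P) (paths e) T"
    using P is_gp_law_unique by blast
  have fT: "(\<lambda>x. f (T x)) \<in> borel_measurable (Q \<Otimes>\<^sub>M P)"
    using T f by (rule measurable_compose)
  then have meas: "(\<lambda>x. \<integral>\<^sup>+g. f (T (x, g)) \<partial>P) \<in> borel_measurable borel"
    using P.borel_measurable_nn_integral_fst[of "\<lambda>x. f (T x)" Q] sQ by (simp cong: measurable_cong_sets)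
  have "(\<integral>\<^sup>+g. f g \<partial>P) = (\<integral>\<^sup>+x. f (T x) \<partial>(Q \<Otimes>\<^sub>M P))"
    using T f by (subst eq) (simp add: nn_integral_distr)
  also have "\<dots> = (\<integral>\<^sup>+x. \<integral>\<^sup>+g. f (T (x, g)) \<partial>P \<partial>Q)"
    using fT by (rule P.nn_integral_fst[symmetric])
  also have "\<dots> = (\<integral>\<^sup>+g'. \<integral>\<^sup>+g. f (T (p0 \<bullet> g' z0, g)) \<partial>P \<partial>P)"
    unfolding Q_def using meas by (subst nn_integral_distr[OF measurable_observation[OF P]]) auto
  also have "\<dots> = (\<integral>\<^sup>+g'. \<integral>\<^sup>+g. f g \<partial>distr P (paths e) (cond_path C z0 p0 (p0 \<bullet> g' z0)) \<partial>P)"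
  proof (rule nn_integral_cong)
    fix g'
    have "cond_path C z0 p0 (p0 \<bullet> g' z0) \<in> P \<rightarrow>\<^sub>M paths e"
      using measurable_cond_path_snd[of z0 p0 _ e] sP by (simp cong: measurable_cong_sets)
    then show "(\<integral>\<^sup>+g. f (T (p0 \<bullet> g' z0, g)) \<partial>P) =
        (\<integral>\<^sup>+g. f g \<partial>distr P (paths e) (cond_path C z0 p0 (p0 \<bullet> g' z0)))"
      using f by (simp add: nn_integral_distr T_def)
  qed
  finally show ?thesis .
qed

end

section \<open>Posterior laws as kernels in the data\<close>

definition exact :: "('z, 'b) obs list \<Rightarrow> bool" where
  "exact E \<longleftrightarrow> (\<forall>(z, p, y, v)\<in>set E. v = 0)"

definition data_at :: "('z \<times> 'b::euclidean_space) list \<Rightarrow> ('z \<Rightarrow> 'b) \<Rightarrow> ('z, 'b) obs list" where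
  "data_at ts g = map (\<lambda>(z, p). (z, p, p \<bullet> g z, 0)) ts"

lemma exact_simps [simp]:
  "exact []" "exact (E @ E') \<longleftrightarrow> exact E \<and> exact E'" "exact (data_at ts g)"
  "exact ((z, p, y, v) # E) \<longleftrightarrow> v = 0 \<and> exact E"
  by (simp_all add: exact_def data_at_def ball_Un split_beta)

lemma data_at_append: "data_at (ts @ us) g = data_at ts g @ data_at us g"
  by (simp add: data_at_def)

text \<open>For inconsistent data the posterior mean would depend on the choice hidden in
  \<open>post_weights\<close>, and measurability in the data would be out of reach. Replacing the
  law by the null measure on this event of probability zero yields a genuine subprobability
  kernel.\<close>

definition cond_gp_law ::
  "'b::euclidean_space \<Rightarrow> ('z::euclidean_space, 'b) mkernel \<Rightarrow> ('z, 'b) obs list \<Rightarrow>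
   ('z \<Rightarrow> 'b) measure" where
  "cond_gp_law e K D = (if consistent K (rev D) then gp_law e K D else null_measure (paths e))"

lemma sets_cond_gp_law [simp]: "sets (cond_gp_law e K D) = sets (paths e)"
  by (simp add: cond_gp_law_def)

lemma space_cond_gp_law [simp]: "space (cond_gp_law e K D) = space (paths e)"
  by (rule sets_eq_imp_space_eq) simp

text \<open>Inputs and values of symbolic observations are random variables, while directions and
  noise levels are constants. Instantiating a fixed symbolic list at \<open>w\<close> permits
  induction over the list with \<open>w\<close> as a parameter.\<close>

definition inst_obs :: "'w \<Rightarrow> ('w \<Rightarrow> 'z) \<times> 'b \<times> ('w \<Rightarrow> real) \<times> real \<Rightarrow> ('z, 'b) obs" where
  "inst_obs w = (\<lambda>(zf, p, yf, v). (zf w, p, yf w, v))"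

definition measurable_obs ::
  "'w measure \<Rightarrow> (('w \<Rightarrow> 'z::euclidean_space) \<times> 'b \<times> ('w \<Rightarrow> real) \<times> real) list \<Rightarrow> bool" where
  "measurable_obs N R \<longleftrightarrow> (\<forall>(zf, p, yf, v)\<in>set R. zf \<in> borel_measurable N \<and> yf \<in> borel_measurable N)"

lemma measurable_obs_simps [simp]:
  "measurable_obs N []"
  "measurable_obs N ((zf, p, yf, v) # R) \<longleftrightarrow>
    zf \<in> borel_measurable N \<and> yf \<in> borel_measurable N \<and> measurable_obs N R"
  "measurable_obs N (R @ R') \<longleftrightarrow> measurable_obs N R \<and> measurable_obs N R'"
  "measurable_obs N (rev R) \<longleftrightarrow> measurable_obs N R"
  by (simp_all add: measurable_obs_def ball_Un)

lemma inst_obs_simp [simp]: "inst_obs w (zf, p, yf, v) = (zf w, p, yf w, v)"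
  by (simp add: inst_obs_def)

context gp_kernel
begin

text \<open>The arguments \<open>a\<close> and \<open>b\<close> have to be random as well, since one
  step of the recursion evaluates the previous covariance at the random input of the
  observation.\<close>

lemma measurable_rec_cov:
  assumes "measurable_obs N R" "a \<in> borel_measurable N" "b \<in> borel_measurable N"
  shows "(\<lambda>w. rec_cov C (map (inst_obs w) R) (a w) (b w) p q) \<in> borel_measurable N"
  using assms
proof (induction R arbitrary: a b p q)
  case Nil
  then show ?case by (simp add: measurable_comp)
next
  case (Cons r R)
  obtain zf p0 yf v where r: "r = (zf, p0, yf, v)" using prod_cases4 by blast
  have zf: "zf \<in> borel_measurable N" and R: "measurable_obs N R"
    using Cons.prems by (simp_all add: r)
  have [measurable]: "(\<lambda>w. rec_cov C (map (inst_obs w) R) (a w) (b w) p q) \<in> borel_measurable N"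
    if "a \<in> borel_measurable N" "b \<in> borel_measurable N" for a b p q
    using Cons.IH[OF R that] .
  show ?case
    unfolding r list.map inst_obs_simp rec_cov.simps cond_cov_def prod.case
    using zf Cons.prems(2,3) by measurable
qed

lemma measurable_rec_mean:
  assumes "measurable_obs N R" "a \<in> borel_measurable N"
  shows "(\<lambda>w. rec_mean C (map (inst_obs w) R) (a w) p) \<in> borel_measurable N"
  using assms
proof (induction R arbitrary: a p)
  case Nil
  then show ?case by simp
next
  case (Cons r R)
  obtain zf p0 yf v where r: "r = (zf, p0, yf, v)" using prod_cases4 by blast
  have zf: "zf \<in> borel_measurable N" "yf \<in> borel_measurable N" and R: "measurable_obs N R"
    using Cons.prems by (simp_all add: r)
  note [measurable] = Cons.IH[OF R] measurable_rec_cov[OF R]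
  show ?case
    unfolding r list.map inst_obs_simp rec_mean.simps cond_mean_def prod.case
    using zf Cons.prems(2) by measurable
qed

lemma measurable_consistent:
  assumes "measurable_obs N R"
  shows "Measurable.pred N (\<lambda>w. consistent C (map (inst_obs w) R))"
  using assms
proof (induction R)
  case Nil
  then show ?case by simp
next
  case (Cons r R)
  obtain zf p0 yf v where r: "r = (zf, p0, yf, v)" using prod_cases4 by blast
  have zf: "zf \<in> borel_measurable N" "yf \<in> borel_measurable N" and R: "measurable_obs N R"
    using Cons.prems by (simp_all add: r)
  note [measurable] = Cons.IH[OF R] measurable_rec_mean[OF R] measurable_rec_cov[OF R]
  show ?case
    unfolding r list.map inst_obs_simp consistent.simps prod.case
    using zf by measurable
qed

end

lemma measurable_lin_mean:
  assumes "\<And>z p. (\<lambda>w. m w z p) \<in> borel_measurable N"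
  shows "(\<lambda>w. lin_mean (m w) ts) \<in> borel_measurable N"
proof (induction ts)
  case (Cons a ts)
  obtain z p where a: "a = (z, p)" by (cases a)
  show ?case using Cons assms[of z p] by (simp add: a)
qed simp

lemma measurable_lin_cov:
  assumes "\<And>z z' p q. (\<lambda>w. C w z z' p q) \<in> borel_measurable N"
  shows "(\<lambda>w. lin_cov (C w) ts us) \<in> borel_measurable N"
proof (induction ts)
  case (Cons a ts)
  obtain z p where a: "a = (z, p)" by (cases a)
  have "(\<lambda>w. \<Sum>(z', q)\<leftarrow>us. C w z z' p q) \<in> borel_measurable N"
    by (induction us) (use assms in auto)
  then show ?case using Cons by (simp add: a)
qed simp

text \<open>
  The data \<open>D0\<close> are those for which a posterior law is assumed to exist; conditioning on further
  noise-free data preserves existence.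
\<close>

locale gp_posterior = gp_kernel K for K :: "('z::euclidean_space, 'b::euclidean_space) mkernel" +
  fixes e :: 'b and D0 :: "('z, 'b) obs list"
  assumes nn0: "noise_nonneg D0"
    and cons0: "consistent K (rev D0)"
    and law0: "\<exists>P. is_gp_law e (post_mean K D0) (post_cov K D0) P"
begin

lemma nn: "exact E \<Longrightarrow> noise_nonneg (D0 @ E)"
  using nn0 by (fastforce simp: noise_nonneg_def exact_def)

lemma nn_rev: "exact E \<Longrightarrow> noise_nonneg (rev (D0 @ E))"
  using nn[of E] unfolding noise_nonneg_def set_rev .

text \<open>The recursive moments make sense for consistent and inconsistent exact data alike, so
  each further observation is handled by the pathwise update.\<close>

lemma ex_law: "exact E \<Longrightarrow> \<exists>P. is_gp_law e (rec_mean K (rev (D0 @ E))) (rec_cov K (rev (D0 @ E))) P"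
proof (induction E rule: rev_induct)
  case Nil
  then show ?case
    using law0 post_mean_eq_rec_mean[OF nn0 cons0] post_cov_eq_rec_cov[OF nn0] by simp
next
  case (snoc d E)
  obtain z p y v where d: "d = (z, p, y, v)" by (cases d)
  have E: "exact E" "v = 0" using snoc.prems by (simp_all add: d)
  interpret C: gp_kernel "rec_cov K (rev (D0 @ E))"
    using nn_rev[OF E(1)] by (rule gp_kernel_rec_cov)
  obtain P where "is_gp_law e (rec_mean K (rev (D0 @ E))) (rec_cov K (rev (D0 @ E))) P"
    using snoc.IH E by blast
  from C.is_gp_law_cond_path[OF this linear_rec_mean[OF nn_rev[OF E(1)]], of z p y]
  show ?case by (auto simp: d E(2))
qed

lemma is_gp_law_exact:
  assumes "exact E" "consistent K (rev (D0 @ E))"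
  shows "is_gp_law e (rec_mean K (rev (D0 @ E))) (rec_cov K (rev (D0 @ E))) (gp_law e K (D0 @ E))"
  using is_gp_law_gp_law[of e K "D0 @ E"] ex_law[OF assms(1)]
    post_mean_eq_rec_mean[OF nn[OF assms(1)] assms(2)] post_cov_eq_rec_cov[OF nn[OF assms(1)]]
  by metis

lemma prob_space_gp_law:
  "exact E \<Longrightarrow> consistent K (rev (D0 @ E)) \<Longrightarrow> prob_space (gp_law e K (D0 @ E))"
  using is_gp_lawD(1) is_gp_law_exact by blast

lemma subprob_space_cond_gp_law: "exact E \<Longrightarrow> subprob_space (cond_gp_law e K (D0 @ E))"
  using space_paths_nonempty[of e] prob_space_gp_law[of E]
  unfolding cond_gp_law_def by (cases "consistent K (rev (D0 @ E))")
    (auto intro: prob_space_imp_subprob_space intro!: subprob_spaceI[of "null_measure _"])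

text \<open>An exact observation has posterior variance zero and its value as posterior mean, so its
  law is a point mass. For inconsistent data every property holds almost everywhere, the measure
  being null.\<close>

lemma AE_exact:
  assumes E: "exact E" and d: "(z, p, y, 0) \<in> set E"
  shows "AE g in cond_gp_law e K (D0 @ E). p \<bullet> g z = y"
proof (cases "consistent K (rev (D0 @ E))")
  case True
  let ?P = "gp_law e K (D0 @ E)"
  note law = is_gp_law_exact[OF E True]
  interpret C: gp_kernel "rec_cov K (rev (D0 @ E))"
    using nn_rev[OF E] by (rule gp_kernel_rec_cov)
  have eq: "distr ?P borel (\<lambda>g. p \<bullet> g z) = return borel y"
    using C.distr_observation[OF law, of p z] rec_exact[OF nn[OF E], of z p y] d True
    by (simp add: gauss_def)
  have "AE x in distr ?P borel (\<lambda>g. p \<bullet> g z). x = y"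
    unfolding eq by (subst AE_return) auto
  then show ?thesis
    unfolding cond_gp_law_def if_P[OF True]
    using C.measurable_observation[OF law] by (subst (asm) AE_distr_iff) auto
next
  case False
  then show ?thesis
    by (auto simp: cond_gp_law_def eventually_ae_filter null_sets_def intro!: bexI[of _ "space (paths e)"])
qed

lemma AE_data_at:
  assumes E: "exact E"
  shows "AE g' in cond_gp_law e K (D0 @ E @ data_at ts g). data_at ts g' = data_at ts g"
proof -
  have "AE g' in cond_gp_law e K (D0 @ (E @ data_at ts g)). \<forall>t\<in>set ts. snd t \<bullet> g' (fst t) = snd t \<bullet> g (fst t)"
  proof (rule AE_ball_countable[THEN iffD2], simp add: countable_finite, rule ballI)
    fix t assume "t \<in> set ts"
    then show "AE g' in cond_gp_law e K (D0 @ (E @ data_at ts g)). snd t \<bullet> g' (fst t) = snd t \<bullet> g (fst t)"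
      using E by (intro AE_exact) (simp, force simp: data_at_def split_beta)
  qed
  then show ?thesis
    by (rule AE_mp) (auto simp: data_at_def intro!: AE_I2)
qed

text \<open>The cosine integrals are explicit functions of the recursive moments on the measurable
  event of consistency, and zero off it.\<close>

lemma measurable_cond_gp_law:
  fixes N :: "'w measure"
  assumes R: "measurable_obs N R" and ex: "\<And>w. exact (map (inst_obs w) R)"
  shows "(\<lambda>w. cond_gp_law e K (D0 @ map (inst_obs w) R)) \<in> N \<rightarrow>\<^sub>M subprob_algebra (paths e)"
proof (rule measurable_kernel_pathsI)
  define R0 where "R0 = map (\<lambda>d. (\<lambda>w::'w. fst d, fst (snd d), \<lambda>w::'w. fst (snd (snd d)), snd (snd (snd d)))) D0"
  have R0: "measurable_obs N (rev (R0 @ R))"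
    using R by (auto simp: R0_def measurable_obs_def)
  have "D0 = map (inst_obs w) R0" for w
    by (simp add: R0_def comp_def)
  then have D: "rev (D0 @ map (inst_obs w) R) = map (inst_obs w) (rev (R0 @ R))" for w
    by (metis map_append rev_map)
  show "subprob_space (cond_gp_law e K (D0 @ map (inst_obs w) R))" for w
    using ex by (rule subprob_space_cond_gp_law)
  fix ts :: "('z \<times> 'b) list" and \<phi> :: real
  have "(\<integral>g. cos (lin_val ts g + \<phi>) \<partial>cond_gp_law e K (D0 @ map (inst_obs w) R)) =
      (if consistent K (map (inst_obs w) (rev (R0 @ R))) then
        exp (- lin_cov (rec_cov K (map (inst_obs w) (rev (R0 @ R)))) ts ts / 2) *
        cos (lin_mean (rec_mean K (map (inst_obs w) (rev (R0 @ R)))) ts + \<phi>) else 0)" for w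
  proof (cases "consistent K (rev (D0 @ map (inst_obs w) R))")
    case True
    interpret C: gp_kernel "rec_cov K (rev (D0 @ map (inst_obs w) R))"
      using nn_rev[OF ex] by (rule gp_kernel_rec_cov)
    show ?thesis
      using C.integral_cos_gp_law[OF is_gp_law_exact[OF ex True], of ts \<phi>] True
      unfolding cond_gp_law_def D by simp
  next
    case False
    then show ?thesis unfolding cond_gp_law_def D by simp
  qed
  moreover have "(\<lambda>w. if consistent K (map (inst_obs w) (rev (R0 @ R))) then
        exp (- lin_cov (rec_cov K (map (inst_obs w) (rev (R0 @ R)))) ts ts / 2) *
        cos (lin_mean (rec_mean K (map (inst_obs w) (rev (R0 @ R)))) ts + \<phi>) else 0) \<in> borel_measurable N"
  proof -
    note [measurable] = measurable_consistent[OF R0]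
      measurable_lin_cov[OF measurable_rec_cov[OF R0 measurable_const measurable_const]]
      measurable_lin_mean[OF measurable_rec_mean[OF R0 measurable_const]]
    show ?thesis by measurable
  qed
  ultimately show "(\<lambda>w. \<integral>g. cos (lin_val ts g + \<phi>) \<partial>cond_gp_law e K (D0 @ map (inst_obs w) R)) \<in> borel_measurable N"
    by simp
qed simp

lemma measurable_cond_gp_law_data_at:
  assumes "exact E"
  shows "(\<lambda>g. cond_gp_law e K (D0 @ E @ data_at ts g)) \<in> paths e \<rightarrow>\<^sub>M subprob_algebra (paths e)"
proof -
  define R :: "((('z \<Rightarrow> 'b) \<Rightarrow> 'z) \<times> 'b \<times> (('z \<Rightarrow> 'b) \<Rightarrow> real) \<times> real) list" where
    "R = map (\<lambda>d. (\<lambda>w. fst d, fst (snd d), \<lambda>w. fst (snd (snd d)), snd (snd (snd d)))) E @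
      map (\<lambda>(z, p). (\<lambda>w. z, p, \<lambda>g. p \<bullet> g z, 0)) ts"
  have eq: "E @ data_at ts g = map (inst_obs g) R" for g
    by (simp add: R_def data_at_def comp_def split_beta)
  have "measurable_obs (paths e) R"
    by (auto simp: R_def measurable_obs_def intro!: borel_measurable_inner measurable_paths_component)
  then show ?thesis
    using measurable_cond_gp_law[of "paths e" R] assms unfolding eq[symmetric] by simp
qed

text \<open>For almost every \<open>g\<close> the enlarged data are consistent and the conditional
  law is the image under the pathwise update towards the observation of \<open>g\<close>; the claim
  is then \<open>gp_law_mixture\<close>.\<close>

lemma disintegration_step:
  assumes E: "exact E" and f: "f \<in> borel_measurable (paths e)"
  shows "(\<integral>\<^sup>+g. f g \<partial>cond_gp_law e K (D0 @ E)) =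
    (\<integral>\<^sup>+g. \<integral>\<^sup>+g'. f g' \<partial>cond_gp_law e K (D0 @ E @ data_at [t] g) \<partial>cond_gp_law e K (D0 @ E))"
proof (cases "consistent K (rev (D0 @ E))")
  case True
  obtain z p where t: "t = (z, p)" by (cases t)
  let ?P = "gp_law e K (D0 @ E)" and ?C = "rec_cov K (rev (D0 @ E))" and ?m = "rec_mean K (rev (D0 @ E))"
  note law = is_gp_law_exact[OF E True]
  interpret C: gp_kernel ?C
    using nn_rev[OF E] by (rule gp_kernel_rec_cov)
  have m: "linear (?m z)" for z
    using nn_rev[OF E] by (rule linear_rec_mean)
  \<comment> \<open>A degenerate observation almost surely equals its mean, which is precisely the
    consistency condition for the new datum.\<close>
  have "AE g in ?P. ?C z z p p = 0 \<longrightarrow> p \<bullet> g z = ?m z p"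
  proof (cases "?C z z p p = 0")
    case True
    then have "AE x in distr ?P borel (\<lambda>g. p \<bullet> g z). x = ?m z p"
      unfolding C.distr_observation[OF law] gauss_def if_P[OF True] by (subst AE_return) auto
    then show ?thesis
      using C.measurable_observation[OF law] by (subst (asm) AE_distr_iff) auto
  qed simp
  then have "AE g in ?P. cond_gp_law e K (D0 @ E @ data_at [t] g) =
      distr ?P (paths e) (cond_path ?C z p (p \<bullet> g z))"
  proof (rule AE_mp, intro AE_I2 impI)
    fix g assume "?C z z p p = 0 \<longrightarrow> p \<bullet> g z = ?m z p"
    then have c: "consistent K (rev (D0 @ (E @ data_at [t] g)))"
      using True by (simp add: data_at_def t)
    have "is_gp_law e (rec_mean K (rev (D0 @ (E @ data_at [t] g)))) (rec_cov K (rev (D0 @ (E @ data_at [t] g))))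
        (distr ?P (paths e) (cond_path ?C z p (p \<bullet> g z)))"
      using C.is_gp_law_cond_path[OF law m, of z p "p \<bullet> g z"] by (simp add: data_at_def t)
    moreover have "is_gp_law e (rec_mean K (rev (D0 @ (E @ data_at [t] g)))) (rec_cov K (rev (D0 @ (E @ data_at [t] g))))
        (gp_law e K (D0 @ (E @ data_at [t] g)))"
      using c E by (intro is_gp_law_exact) auto
    ultimately show "cond_gp_law e K (D0 @ E @ data_at [t] g) =
        distr ?P (paths e) (cond_path ?C z p (p \<bullet> g z))"
      using c is_gp_law_unique by (auto simp: cond_gp_law_def)
  qed
  then have "(\<integral>\<^sup>+g. \<integral>\<^sup>+g'. f g' \<partial>cond_gp_law e K (D0 @ E @ data_at [t] g) \<partial>?P) =
      (\<integral>\<^sup>+g. \<integral>\<^sup>+g'. f g' \<partial>distr ?P (paths e) (cond_path ?C z p (p \<bullet> g z)) \<partial>?P)"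
    by (intro nn_integral_cong_AE) (rule AE_mp, auto)
  also have "\<dots> = (\<integral>\<^sup>+g. f g \<partial>?P)"
    using C.gp_law_mixture[OF law m f] by simp
  finally show ?thesis using True by (simp add: cond_gp_law_def)
qed (simp add: cond_gp_law_def)

text \<open>The last observation is split off inside the conditional law given the others. The
  resulting inner integral is a function \<open>h\<close> of the path, and the induction hypothesis,
  used a second time and backwards for \<open>h\<close>, removes the outer layer. This is why
  \<open>f\<close> is arbitrary in the induction.\<close>

lemma disintegration:
  assumes E: "exact E" and c: "consistent K (rev (D0 @ E))" and f: "f \<in> borel_measurable (paths e)"
  shows "(\<integral>\<^sup>+g. f g \<partial>gp_law e K (D0 @ E)) =
    (\<integral>\<^sup>+g. \<integral>\<^sup>+g'. f g' \<partial>cond_gp_law e K (D0 @ E @ data_at ts g) \<partial>gp_law e K (D0 @ E))"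
  using f
proof (induction ts arbitrary: f rule: rev_induct)
  case Nil
  interpret prob_space "gp_law e K (D0 @ E)" using E c by (rule prob_space_gp_law)
  show ?case using c emeasure_space_1 by (simp add: data_at_def cond_gp_law_def)
next
  case (snoc t ts)
  define h where "h g = (\<integral>\<^sup>+g'. f g' \<partial>cond_gp_law e K (D0 @ E @ data_at (ts @ [t]) g))" for g
  have h: "h \<in> borel_measurable (paths e)"
    unfolding h_def using measurable_cond_gp_law_data_at[OF E] snoc.prems
    by (rule measurable_compose[OF _ nn_integral_measurable_subprob_algebra])
  have "(\<integral>\<^sup>+g. f g \<partial>gp_law e K (D0 @ E)) =
      (\<integral>\<^sup>+g. \<integral>\<^sup>+g'. f g' \<partial>cond_gp_law e K (D0 @ E @ data_at ts g) \<partial>gp_law e K (D0 @ E))"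
    using snoc.prems by (rule snoc.IH)
  also have "\<dots> = (\<integral>\<^sup>+g. \<integral>\<^sup>+g'. h g' \<partial>cond_gp_law e K (D0 @ E @ data_at ts g) \<partial>gp_law e K (D0 @ E))"
  proof (rule nn_integral_cong)
    fix g
    have "(\<integral>\<^sup>+g'. f g' \<partial>cond_gp_law e K (D0 @ E @ data_at ts g)) =
        (\<integral>\<^sup>+g'. \<integral>\<^sup>+g''. f g'' \<partial>cond_gp_law e K (D0 @ (E @ data_at ts g) @ data_at [t] g')
          \<partial>cond_gp_law e K (D0 @ E @ data_at ts g))"
      using disintegration_step[of "E @ data_at ts g" f t] E snoc.prems by simp
    also have "\<dots> = (\<integral>\<^sup>+g'. h g' \<partial>cond_gp_law e K (D0 @ E @ data_at ts g))"
    \<comment> \<open>Under the inner law \<open>g'\<close> almost surely reproduces the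
      observations of \<open>g\<close>, so data taken partly from \<open>g\<close> and partly from
      \<open>g'\<close> are data of \<open>g'\<close> alone.\<close>
    proof (rule nn_integral_cong_AE, rule AE_mp[OF AE_data_at[OF E, of ts g]], intro AE_I2 impI)
      fix g' assume "data_at ts g' = data_at ts g"
      then show "(\<integral>\<^sup>+g''. f g'' \<partial>cond_gp_law e K (D0 @ (E @ data_at ts g) @ data_at [t] g')) = h g'"
        by (simp add: h_def data_at_append)
    qed
    finally show "(\<integral>\<^sup>+g'. f g' \<partial>cond_gp_law e K (D0 @ E @ data_at ts g)) =
        (\<integral>\<^sup>+g'. h g' \<partial>cond_gp_law e K (D0 @ E @ data_at ts g))" .
  qed
  also have "\<dots> = (\<integral>\<^sup>+g. h g \<partial>gp_law e K (D0 @ E))"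
    using h by (rule snoc.IH[symmetric])
  finally show ?case unfolding h_def .
qed

end

section \<open>The joint kernel of values and gradients\<close>

lemma tendsto_lin_cov:
  assumes "\<And>z z' p q. (\<lambda>n. C n z z' p q) \<longlonglongrightarrow> C' z z' p q"
  shows "(\<lambda>n. lin_cov (C n) ts us) \<longlonglongrightarrow> lin_cov C' ts us"
proof (induction ts)
  case (Cons a ts)
  obtain z p where a: "a = (z, p)" by (cases a)
  have "(\<lambda>n. \<Sum>(z', q)\<leftarrow>us. C n z z' p q) \<longlonglongrightarrow> (\<Sum>(z', q)\<leftarrow>us. C' z z' p q)"
    by (induction us) (auto intro!: tendsto_add assms)
  then show ?case using Cons by (simp add: a tendsto_add)
qed simp

text \<open>A list may visit a point repeatedly, whereas \<open>psd_kernel\<close> speaks of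
  coefficient functions on finite sets; \<open>c\<close> collects the coefficients of each
  point.\<close>

lemma lin_cov_scalar_kernel_nonneg:
  assumes "psd_kernel k"
  shows "0 \<le> lin_cov (scalar_kernel k) us us"
proof -
  define S where "S = fst ` set us"
  define c where "c ts z = (\<Sum>(z', d)\<leftarrow>ts. if z' = z then d else 0)" for ts :: "('a \<times> real) list" and z
  have *: "(\<Sum>(z, d)\<leftarrow>ts. d * f z) = (\<Sum>z\<in>S. c ts z * f z)" if "fst ` set ts \<subseteq> S" for ts f
    using that
  proof (induction ts)
    case (Cons a ts)
    obtain z d where a: "a = (z, d)" by (cases a)
    have "z \<in> S" "finite S" using Cons.prems by (auto simp: a S_def)
    then have "(\<Sum>z'\<in>S. (if z = z' then d else 0) * f z') = d * f z"
      by (simp add: if_distrib[of "\<lambda>x. x * _"] cong: if_cong)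
    with Cons show ?case by (simp add: a c_def distrib_right sum.distrib)
  qed (simp add: c_def)
  have "lin_cov (scalar_kernel k) us us = (\<Sum>(z, d)\<leftarrow>us. d * (\<Sum>(z', d')\<leftarrow>us. d' * k z z'))"
    by (simp add: lin_cov_def scalar_kernel_def sum_list_const_mult[symmetric] case_prod_beta' mult_ac)
  also have "\<dots> = (\<Sum>z\<in>S. c us z * (\<Sum>z'\<in>S. c us z' * k z z'))"
    by (simp add: *[of us] S_def[symmetric])
  also have "\<dots> = (\<Sum>z\<in>S. \<Sum>z'\<in>S. c us z * c us z' * k z z')"
    by (simp add: sum_distrib_left mult.assoc)
  also have "\<dots> \<ge> 0"
    using assms by (auto simp: psd_kernel_def S_def)
  finally show ?thesis .
qed

locale smooth_kernel =
  fixes k :: "'z::euclidean_space \<Rightarrow> 'z \<Rightarrow> real"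
    and F' :: "'z \<times> 'z \<Rightarrow> ('z \<times> 'z) \<Rightarrow>\<^sub>L real"
    and F'' :: "'z \<times> 'z \<Rightarrow> ('z \<times> 'z) \<Rightarrow>\<^sub>L ('z \<times> 'z) \<Rightarrow>\<^sub>L real"
  assumes F': "((\<lambda>(z, z'). k z z') has_derivative blinfun_apply (F' x)) (at x)"
    and F'': "(F' has_derivative blinfun_apply (F'' x)) (at x)"
    and cont_F'': "continuous_on UNIV F''"
    and psd_k: "psd_kernel k"
begin

lemma deriv_fst: "((\<lambda>z. k z zb) has_derivative (\<lambda>v. F' (za, zb) (v, 0))) (at za)"
proof -
  have "((\<lambda>z. (z, zb)) has_derivative (\<lambda>v. (v, 0))) (at za)"
    by (auto intro!: derivative_eq_intros)
  from has_derivative_compose[OF this F'] show ?thesis by simp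
qed

lemma deriv_snd: "((\<lambda>z. k za z) has_derivative (\<lambda>v. F' (za, zb) (0, v))) (at zb)"
proof -
  have "((\<lambda>z. (za, z)) has_derivative (\<lambda>v. (0, v))) (at zb)"
    by (auto intro!: derivative_eq_intros)
  from has_derivative_compose[OF this F'] show ?thesis by simp
qed

lemma deriv_fst_snd:
  "((\<lambda>z. F' (z, zb) u) has_derivative (\<lambda>v. F'' (za, zb) (v, 0) u)) (at za)"
proof -
  have "((\<lambda>z. (z, zb)) has_derivative (\<lambda>v. (v, 0))) (at za)"
    by (auto intro!: derivative_eq_intros)
  from has_derivative_compose[OF this F''] have
    "((\<lambda>z. F' (z, zb)) has_derivative (\<lambda>v. F'' (za, zb) (v, 0))) (at za)" .
  then show ?thesis
    by (rule bounded_linear.has_derivative[OF blinfun.bounded_linear_left])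
qed

lemma deriv_kernel_eq:
  "deriv_kernel k za zb p q =
    fst p * fst q * k za zb + fst q * F' (za, zb) (snd p, 0) + fst p * F' (za, zb) (0, snd q) +
    F'' (za, zb) (snd p, 0) (0, snd q)"
proof -
  have 1: "frechet_derivative (\<lambda>z. k z zb) (at za) = (\<lambda>v. F' (za, zb) (v, 0))"
    for za zb by (rule frechet_derivative_at[OF deriv_fst, symmetric])
  have 2: "frechet_derivative (\<lambda>z. k za z) (at zb) = (\<lambda>v. F' (za, zb) (0, v))"
    for za zb by (rule frechet_derivative_at[OF deriv_snd, symmetric])
  have 3: "frechet_derivative (\<lambda>z. F' (z, zb) u) (at za) = (\<lambda>v. F'' (za, zb) (v, 0) u)"
    for u by (rule frechet_derivative_at[OF deriv_fst_snd, symmetric])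
  show ?thesis unfolding deriv_kernel_def 1 2 3 ..
qed

lemma k_sym: "k z z' = k z' z"
  using psd_k by (simp add: psd_kernel_def)

abbreviation diff2 :: "'z \<Rightarrow> 'z \<Rightarrow> 'z \<Rightarrow> 'z \<Rightarrow> real \<Rightarrow> real" where
  "diff2 za zb v w h \<equiv>
    k (za + h *\<^sub>R v) (zb + h *\<^sub>R w) - k (za + h *\<^sub>R v) zb - k za (zb + h *\<^sub>R w) + k za zb"

text \<open>Two mean value steps: one in the second argument, applied to the difference of two
  sections of \<open>k\<close>, and one in the first argument, applied to the partial derivative
  thus obtained.\<close>

lemma diff2_mean_value:
  assumes "h > 0"
  shows "\<exists>\<xi> \<eta>. 0 < \<xi> \<and> \<xi> < h \<and> 0 < \<eta> \<and> \<eta> < h \<and>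
    diff2 za zb v w h / h\<^sup>2 = F'' (za + \<xi> *\<^sub>R v, zb + \<eta> *\<^sub>R w) (v, 0) (0, w)"
proof -
  have 1: "((\<lambda>t. k z (zb + t *\<^sub>R w)) has_real_derivative F' (z, zb + t *\<^sub>R w) (0, w)) (at t)" for z t
  proof -
    have "((\<lambda>t. zb + t *\<^sub>R w) has_derivative (\<lambda>s. s *\<^sub>R w)) (at t)"
      by (auto intro!: derivative_eq_intros)
    from has_derivative_compose[OF this deriv_snd]
    have "((\<lambda>t. k z (zb + t *\<^sub>R w)) has_derivative (\<lambda>s. F' (z, zb + t *\<^sub>R w) (0, s *\<^sub>R w))) (at t)" .
    moreover have "F' (z, zb + t *\<^sub>R w) (0, s *\<^sub>R w) = F' (z, zb + t *\<^sub>R w) (0, w) * s" for s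
      using blinfun.scaleR_right[of "F' (z, zb + t *\<^sub>R w)" s "(0, w)"] by simp
    ultimately show ?thesis by (simp add: has_field_derivative_def)
  qed
  obtain \<eta> where \<eta>: "0 < \<eta>" "\<eta> < h"
    "(k (za + h *\<^sub>R v) (zb + h *\<^sub>R w) - k za (zb + h *\<^sub>R w)) - (k (za + h *\<^sub>R v) (zb + 0 *\<^sub>R w) - k za (zb + 0 *\<^sub>R w)) =
      (h - 0) * (F' (za + h *\<^sub>R v, zb + \<eta> *\<^sub>R w) (0, w) - F' (za, zb + \<eta> *\<^sub>R w) (0, w))"
    using MVT2[OF assms DERIV_diff[OF 1 1], of "za + h *\<^sub>R v" za] by blast
  have 2: "((\<lambda>s. F' (za + s *\<^sub>R v, zb + \<eta> *\<^sub>R w) (0, w)) has_real_derivative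
      F'' (za + s *\<^sub>R v, zb + \<eta> *\<^sub>R w) (v, 0) (0, w)) (at s)" for s
  proof -
    have "((\<lambda>t. za + t *\<^sub>R v) has_derivative (\<lambda>s. s *\<^sub>R v)) (at s)"
      by (auto intro!: derivative_eq_intros)
    from has_derivative_compose[OF this deriv_fst_snd]
    have "((\<lambda>s. F' (za + s *\<^sub>R v, zb + \<eta> *\<^sub>R w) (0, w)) has_derivative
        (\<lambda>t. F'' (za + s *\<^sub>R v, zb + \<eta> *\<^sub>R w) (t *\<^sub>R v, 0) (0, w))) (at s)" .
    moreover have "F'' (za + s *\<^sub>R v, zb + \<eta> *\<^sub>R w) (t *\<^sub>R v, 0) (0, w) =
        F'' (za + s *\<^sub>R v, zb + \<eta> *\<^sub>R w) (v, 0) (0, w) * t" for t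
      using blinfun.scaleR_right[of "F'' (za + s *\<^sub>R v, zb + \<eta> *\<^sub>R w)" t "(v, 0)"]
      by (simp add: blinfun.scaleR_left)
    ultimately show ?thesis by (simp add: has_field_derivative_def)
  qed
  obtain \<xi> where \<xi>: "0 < \<xi>" "\<xi> < h"
    "F' (za + h *\<^sub>R v, zb + \<eta> *\<^sub>R w) (0, w) - F' (za + 0 *\<^sub>R v, zb + \<eta> *\<^sub>R w) (0, w) =
      (h - 0) * F'' (za + \<xi> *\<^sub>R v, zb + \<eta> *\<^sub>R w) (v, 0) (0, w)"
    using MVT2[OF assms 2] by blast
  have "diff2 za zb v w h = h\<^sup>2 * F'' (za + \<xi> *\<^sub>R v, zb + \<eta> *\<^sub>R w) (v, 0) (0, w)"
    using \<eta>(3) \<xi>(3) by (simp add: power2_eq_square algebra_simps)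
  then show ?thesis using \<xi> \<eta> assms by (intro exI[of _ \<xi>] exI[of _ \<eta>]) simp
qed

abbreviation step :: "nat \<Rightarrow> real" where "step n \<equiv> inverse (real (Suc n))"

lemma step_pos: "step n > 0" by simp

lemma step_at_0: "filterlim step (at 0) sequentially"
  using LIMSEQ_inverse_real_of_nat by (auto simp: filterlim_at simp del: of_nat_Suc)

lemma diff2_tendsto:
  "(\<lambda>n. diff2 za zb v w (step n) / (step n)\<^sup>2) \<longlonglongrightarrow> F'' (za, zb) (v, 0) (0, w)"
proof -
  define Q where "Q n \<xi> \<eta> \<longleftrightarrow> 0 < \<xi> \<and> \<xi> < step n \<and> 0 < \<eta> \<and> \<eta> < step n \<and>
      diff2 za zb v w (step n) / (step n)\<^sup>2 = F'' (za + \<xi> *\<^sub>R v, zb + \<eta> *\<^sub>R w) (v, 0) (0, w)" for n \<xi> \<eta>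
  have "\<forall>n. \<exists>\<xi> \<eta>. Q n \<xi> \<eta>"
    unfolding Q_def by (intro allI diff2_mean_value step_pos)
  then obtain \<xi> \<eta> where "\<And>n. Q n (\<xi> n) (\<eta> n)" by metis
  note * = this[unfolded Q_def]
  have lim: "\<xi> \<longlonglongrightarrow> 0" "\<eta> \<longlonglongrightarrow> 0"
    by (rule tendsto_sandwich[OF _ _ tendsto_const LIMSEQ_inverse_real_of_nat];
        use * in \<open>auto intro!: always_eventually less_imp_le simp del: of_nat_Suc\<close>)+
  have "(\<lambda>n. (za + \<xi> n *\<^sub>R v, zb + \<eta> n *\<^sub>R w)) \<longlonglongrightarrow> (za + 0 *\<^sub>R v, zb + 0 *\<^sub>R w)"
    by (intro tendsto_intros lim)
  then have "(\<lambda>n. F'' (za + \<xi> n *\<^sub>R v, zb + \<eta> n *\<^sub>R w)) \<longlonglongrightarrow> F'' (za, zb)"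
    using isCont_tendsto_compose[of "(za, zb)" F''] cont_F''
    by (simp add: continuous_on_eq_continuous_at)
  then have "(\<lambda>n. F'' (za + \<xi> n *\<^sub>R v, zb + \<eta> n *\<^sub>R w) (v, 0) (0, w)) \<longlonglongrightarrow> F'' (za, zb) (v, 0) (0, w)"
    by (intro blinfun.tendsto tendsto_const)
  then show ?thesis using * by simp
qed

lemma diff_fst_tendsto:
  "(\<lambda>n. (k (za + step n *\<^sub>R v) zb - k za zb) / step n) \<longlonglongrightarrow> F' (za, zb) (v, 0)"
proof -
  have "((\<lambda>t. za + t *\<^sub>R v) has_derivative (\<lambda>s. s *\<^sub>R v)) (at 0)"
    by (auto intro!: derivative_eq_intros)
  from has_derivative_compose[OF this deriv_fst]
  have "((\<lambda>t. k (za + t *\<^sub>R v) zb) has_derivative (\<lambda>s. F' (za, zb) (s *\<^sub>R v, 0))) (at 0)"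
    by simp
  moreover have "F' (za, zb) (s *\<^sub>R v, 0) = F' (za, zb) (v, 0) * s" for s
    using blinfun.scaleR_right[of "F' (za, zb)" s "(v, 0)"] by simp
  ultimately have "((\<lambda>t. k (za + t *\<^sub>R v) zb) has_real_derivative F' (za, zb) (v, 0)) (at 0)"
    by (simp add: has_field_derivative_def)
  then have "(\<lambda>h. (k (za + h *\<^sub>R v) zb - k za zb) / h) \<midarrow>0\<rightarrow> F' (za, zb) (v, 0)"
    by (simp add: DERIV_def)
  then show ?thesis using step_at_0 by (rule filterlim_compose)
qed

lemma F'_sym: "F' (zb, za) (w, 0) = F' (za, zb) (0, w)"
proof -
  have eq: "(\<lambda>z. k z za) = (\<lambda>z. k za z)" using k_sym by blast
  have "((\<lambda>z. k za z) has_derivative (\<lambda>v. F' (zb, za) (v, 0))) (at zb)"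
    using deriv_fst[of za zb] unfolding eq .
  from fun_cong[OF has_derivative_unique[OF this deriv_snd]] show ?thesis .
qed

text \<open>Symmetry of \<open>k\<close> makes the mixed second difference invariant under exchange
  of the two points together with their directions, and the limit inherits this.\<close>

lemma F''_sym: "F'' (za, zb) (v, 0) (0, w) = F'' (zb, za) (w, 0) (0, v)"
proof (rule LIMSEQ_unique[OF diff2_tendsto])
  have "diff2 zb za w v h = diff2 za zb v w h" for h
    using k_sym[of zb za] k_sym[of "zb + h *\<^sub>R w" za] k_sym[of zb "za + h *\<^sub>R v"]
      k_sym[of "zb + h *\<^sub>R w" "za + h *\<^sub>R v"] by linarith
  then show "(\<lambda>n. diff2 za zb v w (step n) / (step n)\<^sup>2) \<longlonglongrightarrow> F'' (zb, za) (w, 0) (0, v)"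
    using diff2_tendsto[of zb w za v] by simp
qed

text \<open>
  Positive semidefiniteness passes to the limit in the approximation of \<open>a g(z) + \<partial>\<^sub>v g(z)\<close> by
  \<open>(a - 1 / h) g(z) + (1 / h) g(z + h v)\<close>.
\<close>

lemma lin_cov_deriv_kernel_nonneg: "0 \<le> lin_cov (deriv_kernel k) ts ts"
proof -
  define us where "us h ts = concat (map (\<lambda>(z, p). [(z, fst p - 1 / h), (z + h *\<^sub>R snd p, 1 / h)]) ts)"
    for h and ts :: "('z \<times> real \<times> 'z) list"
  define C where "C h z z' p q = lin_cov (scalar_kernel k) (us h [(z, p)]) (us h [(z', q)])" for h z z' p q
  have us_Cons: "us h (t # ts) = us h [t] @ us h ts" for h t ts
    by (simp add: us_def)
  have us_Nil: "us h [] = []" for h by (simp add: us_def)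
  have C: "lin_cov (C h) ts vs = lin_cov (scalar_kernel k) (us h ts) (us h vs)" for h ts vs
  proof (induction ts)
    case Nil
    then show ?case by (simp add: us_Nil)
  next
    case (Cons a ts)
    obtain z p where a: "a = (z, p)" by (cases a)
    have "(\<Sum>(z', q)\<leftarrow>vs. C h z z' p q) = lin_cov (scalar_kernel k) (us h [(z, p)]) (us h vs)"
    proof (induction vs)
      case Nil
      then show ?case unfolding us_Nil by simp
    next
      case (Cons b vs)
      obtain z' q where b: "b = (z', q)" by (cases b)
      show ?case using Cons unfolding us_Cons[of h b vs] lin_cov_simps(5) by (simp add: b C_def)
    qed
    then show ?case using Cons unfolding us_Cons[of h a ts] lin_cov_simps(3) by (simp add: a)
  qed
  have "(\<lambda>n. C (step n) za zb p q) \<longlonglongrightarrow> deriv_kernel k za zb p q" for za zb p q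
  proof -
    obtain a v b w where pq: "p = (a, v)" "q = (b, w)" by (cases p, cases q)
    have "C h za zb p q = a * b * k za zb + b * ((k (za + h *\<^sub>R v) zb - k za zb) / h) +
        a * ((k (zb + h *\<^sub>R w) za - k zb za) / h) + diff2 za zb v w h / h\<^sup>2" if "h > 0" for h
    proof -
      \<comment> \<open>The four products of difference weights, with \<open>r = 1 / h\<close>,
        regrouped into the difference quotients of the four blocks of the kernel.\<close>
      have poly: "(a - r) * x00 * (b - r) + (a - r) * x01 * r + (r * x10 * (b - r) + r * x11 * r) =
          a * b * x00 + b * ((x10 - x00) * r) + a * ((x01 - x00) * r) + (x11 - x10 - x01 + x00) * r\<^sup>2"
        for x00 x01 x10 x11 r :: real
        by (simp add: power2_eq_square algebra_simps)
      have r: "x / h = x * (1 / h)" "x / h\<^sup>2 = x * (1 / h)\<^sup>2" for x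
        by (simp_all add: power_divide)
      have "C h za zb p q = (a - 1 / h) * k za zb * (b - 1 / h) + (a - 1 / h) * k za (zb + h *\<^sub>R w) * (1 / h) +
          (1 / h * k (za + h *\<^sub>R v) zb * (b - 1 / h) + 1 / h * k (za + h *\<^sub>R v) (zb + h *\<^sub>R w) * (1 / h))"
        by (simp only: C_def us_def pq scalar_kernel_def list.map prod.case concat.simps append.simps
            lin_cov_simps sum_list.Cons sum_list.Nil fst_conv snd_conv add_0_right)
      then show ?thesis
        unfolding poly k_sym[of "zb + h *\<^sub>R w" za] k_sym[of zb za]
          r[of "k (za + h *\<^sub>R v) zb - k za zb"] r[of "k za (zb + h *\<^sub>R w) - k za zb"] r(2)[of "diff2 za zb v w h"] .
    qed
    then have eq: "C (step n) za zb p q = a * b * k za zb + b * ((k (za + step n *\<^sub>R v) zb - k za zb) / step n) +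
        a * ((k (zb + step n *\<^sub>R w) za - k zb za) / step n) + diff2 za zb v w (step n) / (step n)\<^sup>2" for n
      using step_pos by blast
    have "(\<lambda>n. C (step n) za zb p q) \<longlonglongrightarrow> a * b * k za zb + b * F' (za, zb) (v, 0) +
        a * F' (zb, za) (w, 0) + F'' (za, zb) (v, 0) (0, w)"
      unfolding eq by (intro tendsto_intros diff_fst_tendsto diff2_tendsto)
    then show ?thesis by (simp add: deriv_kernel_eq pq F'_sym[of zb za] algebra_simps)
  qed
  then have "(\<lambda>n. lin_cov (C (step n)) ts ts) \<longlonglongrightarrow> lin_cov (deriv_kernel k) ts ts"
    by (rule tendsto_lin_cov)
  then show ?thesis
    by (rule LIMSEQ_le_const) (auto simp: C lin_cov_scalar_kernel_nonneg[OF psd_k])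
qed

lemma gp_kernel_deriv_kernel: "gp_kernel (deriv_kernel k)"
proof (rule gp_kernel.intro)
  fix z z' :: 'z and p q :: "real \<times> 'z" and ts :: "('z \<times> real \<times> 'z) list"
  have pair: "(snd (p + p'), 0) = (snd p, 0) + (snd p', 0 :: 'z)" "(snd (c *\<^sub>R p), 0) = c *\<^sub>R (snd p, 0 :: 'z)"
    for p p' :: "real \<times> 'z" and c by simp_all
  show "linear (\<lambda>p. deriv_kernel k z z' p q)"
    by (rule linearI)
      (simp_all only: deriv_kernel_eq pair blinfun.add_right blinfun.scaleR_right blinfun.add_left
        blinfun.scaleR_left fst_add fst_scaleR real_scaleR_def, simp_all add: algebra_simps)
  show "deriv_kernel k z z' p q = deriv_kernel k z' z q p"
    unfolding deriv_kernel_eq F'_sym[of z' z] F'_sym[of z z', symmetric]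
      F''_sym[of z z' "snd p" "snd q"] k_sym[of z z']
    by simp
  show "0 \<le> lin_cov (deriv_kernel k) ts ts"
    by (rule lin_cov_deriv_kernel_nonneg)
  have cF: "continuous_on UNIV (\<lambda>x. k (fst x) (snd x))"
    using has_derivative_continuous[OF F'] by (simp add: continuous_on_eq_continuous_at case_prod_beta')
  have cF': "continuous_on UNIV F'"
    using has_derivative_continuous[OF F''] by (simp add: continuous_on_eq_continuous_at)
  show "continuous_on UNIV (\<lambda>(z, z'). deriv_kernel k z z' p q)"
    unfolding case_prod_beta' deriv_kernel_eq prod.collapse
    by (intro continuous_on_add continuous_on_mult continuous_on_const cF blinfun.continuous_on cF' cont_F'')
qed

lemma deriv_kernel_value: "deriv_kernel k z z' (a, 0) (b, 0) = a * k z z' * b"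
  by (simp add: deriv_kernel_eq zero_prod_def[symmetric] blinfun.zero_right)

end

section \<open>Value data and the value marginal\<close>

lemma smooth_kernelE:
  assumes "psd_kernel k" "twice_cont_diff (\<lambda>(z, z'). k z z')"
  obtains F' F'' where "smooth_kernel k F' F''"
  using assms by (auto simp: twice_cont_diff_def smooth_kernel_def)

lemma noise_nonneg_value_data: "noise_nonneg (value_data c Z Y lam)"
  by (auto simp: noise_nonneg_def value_data_def)

text \<open>Positive noise keeps every predictive variance positive, so the consistency condition is
  never triggered.\<close>

lemma (in gp_kernel) consistent_noisy:
  assumes "\<And>z p y v. (z, p, y, v) \<in> set D \<Longrightarrow> v > 0"
  shows "consistent C D"
  using assms
proof (induction D)
  case (Cons d D)
  obtain z p y v where d: "d = (z, p, y, v)" by (cases d)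
  have "noise_nonneg D" using Cons.prems by (force simp: noise_nonneg_def)
  then interpret D: gp_kernel "rec_cov C D" by (rule gp_kernel_rec_cov)
  have "v > 0" using Cons.prems[of z p y v] by (simp add: d)
  then have "rec_cov C D z z p p + v \<noteq> 0" using D.var_nonneg[of z p] by linarith
  moreover have "consistent C D" using Cons by (meson list.set_intros(2))
  ultimately show ?case by (simp add: d)
qed simp

text \<open>Positive mass rules out the null measure standing in for a missing law, so the existence
  of the posterior process can be read off.\<close>

lemma gp_posterior_value_data:
  assumes "gp_kernel K" "lam > 0" "emeasure (gp_law e K (value_data c Z Y lam)) A > 0"
  shows "gp_posterior K e (value_data c Z Y lam)"
proof -
  interpret gp_kernel K by fact
  show ?thesis
  proof
    show "noise_nonneg (value_data c Z Y lam)" by (rule noise_nonneg_value_data)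
    show "consistent K (rev (value_data c Z Y lam))"
      by (rule consistent_noisy) (use assms(2) in \<open>auto simp: value_data_def\<close>)
    show "\<exists>P. is_gp_law e (post_mean K (value_data c Z Y lam)) (post_cov K (value_data c Z Y lam)) P"
      using assms(3) unfolding gp_law_def by (auto split: if_splits)
  qed
qed

context smooth_kernel
begin

text \<open>In value directions the joint kernel is the scalar one, so both linear systems coincide.
  The two choices are made from the same predicate and hence give identical weights, even without
  uniqueness of the solution.\<close>

lemma post_weights_value_data:
  "post_weights (deriv_kernel k) (value_data (1, 0) Z Y lam) z (p, 0) =
    post_weights (scalar_kernel k) (value_data 1 Z Y lam) z p"
proof -
  have len: "length (value_data (1 :: real, 0 :: 'z) Z Y lam) = length (value_data (1 :: real) Z Y lam)"
    by (simp add: value_data_def)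
  have "gram (deriv_kernel k) (value_data (1, 0) Z Y lam) r s = gram (scalar_kernel k) (value_data 1 Z Y lam) r s"
    if "r < length (value_data (1 :: real) Z Y lam)" "s < length (value_data (1 :: real) Z Y lam)" for r s
    using that by (simp add: gram_def value_data_def case_prod_beta scalar_kernel_def deriv_kernel_value)
  moreover have "cross (deriv_kernel k) (value_data (1, 0) Z Y lam) z (p, 0) r =
      cross (scalar_kernel k) (value_data 1 Z Y lam) z p r"
    if "r < length (value_data (1 :: real) Z Y lam)" for r
    using that by (simp add: cross_def value_data_def case_prod_beta scalar_kernel_def deriv_kernel_value)
  ultimately have "(\<forall>r<length (value_data (1 :: real, 0 :: 'z) Z Y lam).
        (\<Sum>s<length (value_data (1 :: real, 0 :: 'z) Z Y lam).
          gram (deriv_kernel k) (value_data (1, 0) Z Y lam) r s * w s) =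
        cross (deriv_kernel k) (value_data (1, 0) Z Y lam) z (p, 0) r) \<longleftrightarrow>
      (\<forall>r<length (value_data (1 :: real) Z Y lam).
        (\<Sum>s<length (value_data (1 :: real) Z Y lam).
          gram (scalar_kernel k) (value_data 1 Z Y lam) r s * w s) =
        cross (scalar_kernel k) (value_data 1 Z Y lam) z p r)" for w
    unfolding len by (intro all_cong imp_cong arg_cong2[where f = "(=)"] sum.cong) auto
  then show ?thesis unfolding post_weights_def by simp
qed

lemma post_mean_value_data:
  "post_mean (deriv_kernel k) (value_data (1, 0) Z Y lam) z (p, 0) =
    post_mean (scalar_kernel k) (value_data 1 Z Y lam) z p"
  unfolding post_mean_def post_weights_value_data
  by (intro sum.cong) (auto simp: value_data_def case_prod_beta)

lemma post_cov_value_data: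
  "post_cov (deriv_kernel k) (value_data (1, 0) Z Y lam) z z' (p, 0) (q, 0) =
    post_cov (scalar_kernel k) (value_data 1 Z Y lam) z z' p q"
  unfolding post_cov_def post_weights_value_data
  by (intro arg_cong2[where f = "(-)"] sum.cong)
    (auto simp: value_data_def case_prod_beta cross_def scalar_kernel_def deriv_kernel_value)

end

lemma measurable_value_path:
  "(\<lambda>g (z :: 'z::euclidean_space). fst (g z)) \<in>
    paths (1 :: real, 0 :: 'b::euclidean_space) \<rightarrow>\<^sub>M paths (1 :: real)"
proof (rule measurable_pathsI)
  fix z :: 'z
  show "(\<lambda>g. fst (g z)) \<in> borel_measurable (paths (1 :: real, 0 :: 'b))"
    by (rule measurable_compose[OF measurable_paths_component]) (simp add: borel_prod[symmetric])
qed (simp add: space_paths inner_prod_def case_prod_beta')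

lemma (in smooth_kernel) gp_law_value_data:
  fixes Z Y lam
  defines "D \<equiv> value_data (1 :: real, 0 :: 'z) Z Y lam"
  assumes law: "is_gp_law (1, 0) (post_mean (deriv_kernel k) D) (post_cov (deriv_kernel k) D) P"
  shows "gp_law 1 (scalar_kernel k) (value_data 1 Z Y lam) = distr P (paths 1) (\<lambda>g z. fst (g z))"
proof (rule gp_law_eqI, unfold is_gp_law_def, intro conjI allI)
  interpret prob_space P by (rule is_gp_lawD[OF law])
  have sP: "sets P = sets (paths (1, 0))" by (rule is_gp_lawD[OF law])
  have meas: "(\<lambda>g z. fst (g z)) \<in> P \<rightarrow>\<^sub>M paths 1"
    using measurable_value_path sP by (simp cong: measurable_cong_sets)
  show "prob_space (distr P (paths 1) (\<lambda>g z. fst (g z)))"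
    using meas by (rule prob_space_distr)
  show "sets (distr P (paths 1) (\<lambda>g z. fst (g z))) = sets (paths 1)" by simp
  fix ts :: "('z \<times> real) list"
  define us where "us = map (\<lambda>(z, p). (z, (p, 0 :: 'z))) ts"
  have val: "lin_val ts (\<lambda>z. fst (g z)) = lin_val us g" for g
    unfolding us_def by (induction ts) (auto simp: lin_val_def inner_prod_def)
  have "distr (distr P (paths 1) (\<lambda>g z. fst (g z))) borel (lin_val ts) = distr P borel (lin_val us)"
    using meas by (subst distr_distr) (auto simp: comp_def val)
  also have "\<dots> = gauss (lin_mean (post_mean (deriv_kernel k) D) us) (lin_cov (post_cov (deriv_kernel k) D) us us)"
    by (rule is_gp_lawD(3)[OF law])
  also have "lin_mean (post_mean (deriv_kernel k) D) us =
      lin_mean (post_mean (scalar_kernel k) (value_data 1 Z Y lam)) ts"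
    by (simp add: lin_mean_def us_def comp_def case_prod_beta' D_def post_mean_value_data)
  also have "lin_cov (post_cov (deriv_kernel k) D) us us =
      lin_cov (post_cov (scalar_kernel k) (value_data 1 Z Y lam)) ts ts"
    by (simp add: lin_cov_def us_def comp_def case_prod_beta' D_def post_cov_value_data)
  finally show "distr (distr P (paths 1) (\<lambda>g z. fst (g z))) borel (\<lambda>g. \<Sum>(z, p)\<leftarrow>ts. p \<bullet> g z) =
      gauss (\<Sum>(z, p)\<leftarrow>ts. post_mean (scalar_kernel k) (value_data 1 Z Y lam) z p)
        (\<Sum>(z, p)\<leftarrow>ts. \<Sum>(z', q)\<leftarrow>ts. post_cov (scalar_kernel k) (value_data 1 Z Y lam) z z' p q)"
    by (simp add: lin_val_eq lin_mean_def lin_cov_def)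
qed

lemma trunc_gp_law_value_data:
  assumes k: "psd_kernel k" "twice_cont_diff (\<lambda>(z, z'). k z z')"
    and lam: "lam > 0"
    and pos: "emeasure (gp_law (1, 0) (deriv_kernel k) (value_data (1, 0) Z Y lam)) (bounded_paths (1, 0) S lo up) > 0"
  shows "trunc_gp_law 1 S lo up (scalar_kernel k) (value_data 1 Z Y lam) =
    distr (trunc_gp_law (1, 0) S lo up (deriv_kernel k) (value_data (1, 0) Z Y lam)) (paths 1) (\<lambda>\<gamma> z. fst (\<gamma> z))"
proof -
  obtain F' F'' where "smooth_kernel k F' F''" using smooth_kernelE[OF k] .
  then interpret smooth_kernel k F' F'' .
  interpret gp_posterior "deriv_kernel k" "(1, 0)" "value_data (1, 0) Z Y lam"
    by (rule gp_posterior_value_data[OF gp_kernel_deriv_kernel lam pos])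
  let ?P = "gp_law (1, 0) (deriv_kernel k) (value_data (1, 0) Z Y lam)"
  let ?B = "bounded_paths (1 :: real, 0 :: 'a) S lo up" and ?B1 = "bounded_paths (1 :: real) S lo up"
  let ?v = "\<lambda>(\<gamma> :: 'a \<Rightarrow> real \<times> 'a) z. fst (\<gamma> z)"
  have eq: "gp_law 1 (scalar_kernel k) (value_data 1 Z Y lam) = distr ?P (paths 1) ?v"
    by (rule gp_law_value_data[OF is_gp_law_gp_law[OF law0]])
  have meas: "?v \<in> ?P \<rightarrow>\<^sub>M paths 1"
    using measurable_value_path by (simp cong: measurable_cong_sets)
  \<comment> \<open>A set outside the sigma-algebra has \<open>emeasure\<close> 0, so positive mass
    yields measurability.\<close>
  have B: "?B \<in> sets (paths (1, 0))"
    using pos emeasure_notin_sets[of ?B ?P] by fastforce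
  have vB: "?v -` ?B1 \<inter> space ?P = ?B"
    by (auto simp: bounded_paths_def space_paths inner_prod_def case_prod_beta')
  \<comment> \<open>Extending a scalar path by zero gradients pulls \<open>?B\<close> back to
    \<open>?B1\<close>, which transfers measurability to the scalar path space.\<close>
  have "(\<lambda>g (z :: 'a). (g z, 0)) \<in> paths 1 \<rightarrow>\<^sub>M paths (1 :: real, 0 :: 'a)"
  proof (rule measurable_pathsI)
    fix z :: 'a
    show "(\<lambda>g :: 'a \<Rightarrow> real. (g z, 0 :: 'a)) \<in> borel_measurable (paths 1)"
      by (intro borel_measurable_Pair measurable_paths_component measurable_const) auto
  qed (simp add: space_paths inner_prod_def)
  then have "(\<lambda>g z. (g z, 0)) -` ?B \<inter> space (paths (1 :: real)) \<in> sets (paths 1)"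
    using B by (rule measurable_sets)
  also have "(\<lambda>g z. (g z, 0)) -` ?B \<inter> space (paths (1 :: real)) = ?B1"
    by (auto simp: bounded_paths_def space_paths inner_prod_def)
  finally have B1: "?B1 \<in> sets (paths 1)" .
  show ?thesis
    unfolding trunc_gp_law_def eq
  proof (rule measure_eqI)
    fix A assume "A \<in> sets (uniform_measure (distr ?P (paths 1) ?v) ?B1)"
    then have A: "A \<in> sets (paths 1)" by simp
    have vA: "?v -` A \<inter> space ?P \<in> sets ?P"
      using measurable_sets[OF meas A] .
    have "emeasure (uniform_measure (distr ?P (paths 1) ?v) ?B1) A =
        emeasure ?P (?v -` (?B1 \<inter> A) \<inter> space ?P) / emeasure ?P (?v -` ?B1 \<inter> space ?P)"
      using A B1 meas by (simp add: emeasure_distr)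
    also have "?v -` (?B1 \<inter> A) \<inter> space ?P = ?B \<inter> (?v -` A \<inter> space ?P)"
      using vB by blast
    also have "emeasure ?P (?B \<inter> (?v -` A \<inter> space ?P)) / emeasure ?P (?v -` ?B1 \<inter> space ?P) =
        emeasure (uniform_measure ?P ?B) (?v -` A \<inter> space ?P)"
      using B vA unfolding vB by simp
    also have "\<dots> = emeasure (distr (uniform_measure ?P ?B) (paths 1) ?v) A"
      using A meas by (simp add: emeasure_distr)
    finally show "emeasure (uniform_measure (distr ?P (paths 1) ?v) ?B1) A =
        emeasure (distr (uniform_measure ?P ?B) (paths 1) ?v) A" .
  qed simp
qed

section \<open>Conditional laws and truncation\<close>

text \<open>
  \<open>\<nu>\<close> is only measurable up to null sets that depend on the event, hence the detour through \<open>J\<close>.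
\<close>

lemma has_cond_law_nn_integral_version:
  fixes f :: "'w \<times> 's \<Rightarrow> ennreal"
  assumes M: "prob_space M" and sub: "subalgebra M F" and law: "has_cond_law M F S X \<nu>"
    and sets: "\<And>w. sets (\<nu> w) = sets S" and prob: "AE w in M. prob_space (\<nu> w)"
    and f: "f \<in> borel_measurable (F \<Otimes>\<^sub>M S)"
  shows "\<exists>J\<in>borel_measurable F. (AE w in M. J w = (\<integral>\<^sup>+x. f (w, x) \<partial>\<nu> w)) \<and>
    (\<integral>\<^sup>+w. f (w, X w) \<partial>M) = (\<integral>\<^sup>+w. J w \<partial>M)"
proof -
  interpret prob_space M by fact
  interpret finite_measure_subalgebra M F by (rule finite_measure_subalgebra.intro) (unfold_locales, fact sub)
  have sp: "space F = space M" using sub by (simp add: subalgebra_def)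
  have spn: "space (\<nu> w) = space S" for w using sets by (rule sets_eq_imp_space_eq)
  have X: "X \<in> M \<rightarrow>\<^sub>M S" using law by (simp add: has_cond_law_def)
  have pair: "(\<lambda>w. (w, X w)) \<in> M \<rightarrow>\<^sub>M F \<Otimes>\<^sub>M S"
    using X measurable_from_subalg[OF sub measurable_ident] by (auto intro!: measurable_Pair simp: id_def)
  have comp: "g \<in> borel_measurable (F \<Otimes>\<^sub>M S) \<Longrightarrow> (\<lambda>w. g (w, X w)) \<in> borel_measurable M"
    for g :: "'w \<times> 's \<Rightarrow> ennreal"
    using pair by (rule measurable_compose)
  have sect: "g \<in> borel_measurable (F \<Otimes>\<^sub>M S) \<Longrightarrow> w \<in> space M \<Longrightarrow> (\<lambda>x. g (w, x)) \<in> borel_measurable (\<nu> w)"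
    for g :: "'w \<times> 's \<Rightarrow> ennreal" and w
    using measurable_compose[OF measurable_Pair1'[of w F S], of g borel] sp sets
    by (simp cong: measurable_cong_sets)
  have FM: "J \<in> borel_measurable F \<Longrightarrow> J \<in> borel_measurable M" for J :: "'w \<Rightarrow> ennreal"
    by (rule measurable_from_subalg[OF sub])
  let ?Q = "\<lambda>f J. (AE w in M. J w = (\<integral>\<^sup>+x. f (w, x) \<partial>\<nu> w)) \<and>
    (\<integral>\<^sup>+w. f (w, X w) \<partial>M) = (\<integral>\<^sup>+w. J w \<partial>M)"
  let ?P = "\<lambda>f. \<exists>J\<in>borel_measurable F. ?Q f J"
  have ind: "?P (indicator A)" if "A \<in> sets (F \<Otimes>\<^sub>M S)" for A
  proof -
    have gen: "sets (F \<Otimes>\<^sub>M S) = sigma_sets (space F \<times> space S) {a \<times> b |a b. a \<in> sets F \<and> b \<in> sets S}"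
      by (rule sets_pair_measure)
    have "{a \<times> b |a b. a \<in> sets F \<and> b \<in> sets S} \<subseteq> Pow (space F \<times> space S)"
      by (rule pair_measure_closed)
    from Int_stable_pair_measure_generator this that[unfolded gen] show ?thesis
    proof (induction A rule: sigma_sets_induct_disjoint)
      case (basic A)
      then obtain a b where ab: "A = a \<times> b" "a \<in> sets F" "b \<in> sets S" by auto
      define Xb where "Xb = X -` b \<inter> space M"
      have Xb: "Xb \<in> sets M" unfolding Xb_def using X ab(3) by (rule measurable_sets)
      have aM: "a \<in> sets M" using ab(2) sub by (auto simp: subalgebra_def)
      define c where "c = real_cond_exp M F (indicator Xb)"
      have c: "AE w in M. c w = measure (\<nu> w) b"
        using law ab(3) unfolding has_cond_law_def c_def Xb_def by blast
      have int: "integrable M (indicator Xb :: 'w \<Rightarrow> real)"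
        by (rule integrable_real_indicator[OF Xb]) (simp add: less_top[symmetric])
      \<comment> \<open>On a null set \<open>c\<close> may be negative; \<open>ennreal\<close> cuts
        it off at 0 there.\<close>
      define J where "J w = ennreal (indicator a w * c w)" for w
      have "J \<in> borel_measurable F"
        unfolding J_def c_def
        by (intro measurable_compose[OF _ measurable_ennreal] borel_measurable_times
            borel_measurable_indicator ab(2) borel_measurable_cond_exp)
      moreover have "AE w in M. J w = (\<integral>\<^sup>+x. indicator A (w, x) \<partial>\<nu> w)"
        using c prob
      proof eventually_elim
        case (elim w)
        interpret \<nu>: prob_space "\<nu> w" by fact
        have "(\<integral>\<^sup>+x. indicator A (w, x) \<partial>\<nu> w) = (\<integral>\<^sup>+x. indicator a w * indicator b x \<partial>\<nu> w)"
          by (intro nn_integral_cong) (simp add: ab indicator_times)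
        also have "\<dots> = indicator a w * emeasure (\<nu> w) b"
          using ab(3) sets by (simp add: nn_integral_cmult_indicator)
        finally show ?case using elim
          by (simp add: J_def \<nu>.emeasure_eq_measure split: split_indicator)
      qed
      moreover have "(\<integral>\<^sup>+w. indicator A (w, X w) \<partial>M) = (\<integral>\<^sup>+w. J w \<partial>M)"
      proof -
        have ic: "integrable M (\<lambda>w. indicator a w * c w)"
          using integrable_mult_indicator[OF aM real_cond_exp_int(1)[OF int]] by (simp add: c_def)
        have "(\<integral>\<^sup>+w. J w \<partial>M) = ennreal (\<integral>w. indicator a w * c w \<partial>M)"
          unfolding J_def
        proof (rule nn_integral_eq_integral[OF ic])
          show "AE w in M. 0 \<le> indicator a w * c w"
            using c by eventually_elim simp
        qed
        also have "(\<integral>w. indicator a w * c w \<partial>M) = (\<integral>w. indicator a w * indicator Xb w \<partial>M)"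
          using real_cond_exp_intA[OF int ab(2)] by (simp add: c_def set_lebesgue_integral_def)
        also have "\<dots> = (\<integral>w. indicator (a \<inter> Xb) w \<partial>M)"
          by (simp add: indicator_inter_arith)
        also have "ennreal \<dots> = emeasure M (a \<inter> Xb)"
          using aM Xb by (simp add: emeasure_eq_measure)
        also have "\<dots> = (\<integral>\<^sup>+w. indicator (a \<inter> Xb) w \<partial>M)"
          using aM Xb by simp
        also have "\<dots> = (\<integral>\<^sup>+w. indicator A (w, X w) \<partial>M)"
          by (intro nn_integral_cong) (auto simp: ab Xb_def split: split_indicator)
        finally show ?thesis by simp
      qed
      ultimately show ?case by (intro bexI[of _ J] conjI)
    next
      case empty
      then show ?case by (intro bexI[of _ "\<lambda>_. 0"]) auto
    next
      case (compl A)
      then obtain J where J: "J \<in> borel_measurable F" "?Q (indicator A) J" by blast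
      have A: "A \<in> sets (F \<Otimes>\<^sub>M S)" using compl by (simp add: gen)
      \<comment> \<open>The bound is what makes the truncated subtraction of \<open>ennreal\<close>
        behave as a complement under the integral.\<close>
      have le: "AE w in M. J w \<le> 1"
        using J(2)[THEN conjunct1] prob AE_space
      proof eventually_elim
        case (elim w)
        interpret \<nu>: prob_space "\<nu> w" by fact
        have "J w \<le> (\<integral>\<^sup>+x. 1 \<partial>\<nu> w)"
          unfolding elim(1) by (intro nn_integral_mono) (simp split: split_indicator)
        then show ?case by (simp add: \<nu>.emeasure_space_1)
      qed
      have "(\<lambda>w. 1 - J w) \<in> borel_measurable F" using J(1) by measurable
      moreover have "AE w in M. 1 - J w = (\<integral>\<^sup>+x. indicator (space F \<times> space S - A) (w, x) \<partial>\<nu> w)"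
        using J(2)[THEN conjunct1] prob le AE_space
      proof eventually_elim
        case (elim w)
        interpret \<nu>: prob_space "\<nu> w" by fact
        have "(\<integral>\<^sup>+x. indicator (space F \<times> space S - A) (w, x) \<partial>\<nu> w) =
            (\<integral>\<^sup>+x. 1 - indicator A (w, x) \<partial>\<nu> w)"
          using elim(4) by (intro nn_integral_cong) (auto simp: sp spn split: split_indicator)
        also have "\<dots> = (\<integral>\<^sup>+x. 1 \<partial>\<nu> w) - (\<integral>\<^sup>+x. indicator A (w, x) \<partial>\<nu> w)"
        proof (rule nn_integral_diff)
          show "(\<lambda>x. indicator A (w, x) :: ennreal) \<in> borel_measurable (\<nu> w)"
            by (rule sect[OF borel_measurable_indicator[OF A] elim(4)])
          show "(\<integral>\<^sup>+x. indicator A (w, x) \<partial>\<nu> w) \<noteq> \<infinity>"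
            using elim(1,3) by (auto simp: top_unique)
        qed (auto split: split_indicator)
        finally show ?case using elim(1) by (simp add: \<nu>.emeasure_space_1)
      qed
      moreover have "(\<integral>\<^sup>+w. indicator (space F \<times> space S - A) (w, X w) \<partial>M) = (\<integral>\<^sup>+w. 1 - J w \<partial>M)"
      proof -
        have "(\<integral>\<^sup>+w. indicator (space F \<times> space S - A) (w, X w) \<partial>M) = (\<integral>\<^sup>+w. 1 - indicator A (w, X w) \<partial>M)"
          using measurable_space[OF X] by (intro nn_integral_cong) (auto simp: sp split: split_indicator)
        also have "\<dots> = (\<integral>\<^sup>+w. 1 \<partial>M) - (\<integral>\<^sup>+w. indicator A (w, X w) \<partial>M)"
        proof (rule nn_integral_diff)
          show "(\<lambda>w. indicator A (w, X w) :: ennreal) \<in> borel_measurable M" by (rule comp[OF borel_measurable_indicator[OF A]])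
          have "(\<integral>\<^sup>+w. indicator A (w, X w) \<partial>M) \<le> (\<integral>\<^sup>+w. 1 \<partial>M)"
            by (intro nn_integral_mono) (simp split: split_indicator)
          then show "(\<integral>\<^sup>+w. indicator A (w, X w) \<partial>M) \<noteq> \<infinity>"
            by (auto simp: emeasure_space_1 top_unique)
        qed (auto split: split_indicator)
        also have "\<dots> = (\<integral>\<^sup>+w. 1 \<partial>M) - (\<integral>\<^sup>+w. J w \<partial>M)"
          using J(2) by simp
        also have "\<dots> = (\<integral>\<^sup>+w. 1 - J w \<partial>M)"
        proof (rule nn_integral_diff[symmetric])
          have "(\<integral>\<^sup>+w. J w \<partial>M) \<le> (\<integral>\<^sup>+w. 1 \<partial>M)"
            using le by (rule nn_integral_mono_AE)
          then show "(\<integral>\<^sup>+w. J w \<partial>M) \<noteq> \<infinity>"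
            by (auto simp: emeasure_space_1 top_unique)
        qed (use FM[OF J(1)] le in auto)
        finally show ?thesis .
      qed
      ultimately show ?case by (intro bexI[of _ "\<lambda>w. 1 - J w"] conjI)
    next
      case (union A)
      then have "\<forall>i. \<exists>J. J \<in> borel_measurable F \<and> ?Q (indicator (A i)) J" by blast
      from choice[OF this] obtain J where
        "\<forall>i. J i \<in> borel_measurable F \<and> ?Q (indicator (A i)) (J i)" ..
      then have J: "\<And>i. J i \<in> borel_measurable F" "\<And>i. ?Q (indicator (A i)) (J i)"
        by blast+
      have A: "A i \<in> sets (F \<Otimes>\<^sub>M S)" for i using union by (auto simp: gen)
      have iA: "indicator (\<Union>i. A i) x = (\<Sum>i. indicator (A i) x :: ennreal)" for x
        by (rule suminf_indicator[OF union.hyps(1), symmetric])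
      have "(\<lambda>w. \<Sum>i. J i w) \<in> borel_measurable F" using J(1) by measurable
      moreover have "AE w in M. (\<Sum>i. J i w) = (\<integral>\<^sup>+x. indicator (\<Union>i. A i) (w, x) \<partial>\<nu> w)"
      proof -
        have "AE w in M. \<forall>i. J i w = (\<integral>\<^sup>+x. indicator (A i) (w, x) \<partial>\<nu> w)"
          using J(2) by (simp add: AE_all_countable)
        then show ?thesis
          using AE_space
        proof eventually_elim
          case (elim w)
          have "(\<integral>\<^sup>+x. indicator (\<Union>i. A i) (w, x) \<partial>\<nu> w) = (\<Sum>i. \<integral>\<^sup>+x. indicator (A i) (w, x) \<partial>\<nu> w)"
            unfolding iA by (rule nn_integral_suminf[OF sect[OF borel_measurable_indicator[OF A] elim(2)]])
          then show ?case using elim(1) by simp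
        qed
      qed
      moreover have "(\<integral>\<^sup>+w. indicator (\<Union>i. A i) (w, X w) \<partial>M) = (\<integral>\<^sup>+w. (\<Sum>i. J i w) \<partial>M)"
      proof -
        have "(\<integral>\<^sup>+w. indicator (\<Union>i. A i) (w, X w) \<partial>M) = (\<Sum>i. \<integral>\<^sup>+w. indicator (A i) (w, X w) \<partial>M)"
          unfolding iA by (rule nn_integral_suminf[OF comp[OF borel_measurable_indicator[OF A]]])
        also have "\<dots> = (\<Sum>i. \<integral>\<^sup>+w. J i w \<partial>M)" using J(2) by simp
        also have "\<dots> = (\<integral>\<^sup>+w. (\<Sum>i. J i w) \<partial>M)"
          by (rule nn_integral_suminf[OF FM[OF J(1)], symmetric])
        finally show ?thesis .
      qed
      ultimately show ?case by (intro bexI[of _ "\<lambda>w. \<Sum>i. J i w"] conjI)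
    qed
  qed
  show ?thesis
    using f
  proof (induction rule: borel_measurable_induct)
    case (cong f g)
    then obtain J where J: "J \<in> borel_measurable F" "?Q g J" by blast
    have fg: "f (w, x) = g (w, x)" if "w \<in> space M" "x \<in> space S" for w x
      using that cong(3)[of "(w, x)"] by (simp add: space_pair_measure sp)
    have eq: "(\<integral>\<^sup>+x. f (w, x) \<partial>\<nu> w) = (\<integral>\<^sup>+x. g (w, x) \<partial>\<nu> w)" if "w \<in> space M" for w
      using fg[OF that] by (intro nn_integral_cong) (simp add: spn)
    have "AE w in M. J w = (\<integral>\<^sup>+x. f (w, x) \<partial>\<nu> w)"
      using J(2)[THEN conjunct1] AE_space by eventually_elim (simp add: eq)
    moreover have "(\<integral>\<^sup>+w. f (w, X w) \<partial>M) = (\<integral>\<^sup>+w. g (w, X w) \<partial>M)"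
      using fg measurable_space[OF X] by (intro nn_integral_cong) auto
    ultimately show ?case using J by auto
  next
    case (set A)
    then show ?case by (rule ind)
  next
    case (mult g c)
    then obtain J where J: "J \<in> borel_measurable F" "?Q g J" by blast
    have "AE w in M. c * J w = (\<integral>\<^sup>+x. c * g (w, x) \<partial>\<nu> w)"
      using J(2)[THEN conjunct1] AE_space
      by eventually_elim (simp add: nn_integral_cmult sect[OF mult(2)])
    moreover have "(\<integral>\<^sup>+w. c * g (w, X w) \<partial>M) = (\<integral>\<^sup>+w. c * J w \<partial>M)"
      using J FM[OF J(1)] comp[OF mult(2)] by (simp add: nn_integral_cmult)
    ultimately show ?case using J(1) by (intro bexI[of _ "\<lambda>w. c * J w"]) auto
  next
    case (add g h)
    then obtain J I where J: "J \<in> borel_measurable F" "?Q g J" and I: "I \<in> borel_measurable F" "?Q h I"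
      by blast
    have "AE w in M. I w + J w = (\<integral>\<^sup>+x. h (w, x) + g (w, x) \<partial>\<nu> w)"
      using J(2)[THEN conjunct1] I(2)[THEN conjunct1] AE_space
      by eventually_elim (simp add: nn_integral_add sect[OF add(1)] sect[OF add(3)])
    moreover have "(\<integral>\<^sup>+w. h (w, X w) + g (w, X w) \<partial>M) = (\<integral>\<^sup>+w. I w + J w \<partial>M)"
      using J I FM[OF J(1)] FM[OF I(1)] comp[OF add(1)] comp[OF add(3)] by (simp add: nn_integral_add)
    ultimately show ?case using J(1) I(1) by (intro bexI[of _ "\<lambda>w. I w + J w"]) auto
  next
    case (seq U)
    then have "\<forall>i. \<exists>J. J \<in> borel_measurable F \<and> ?Q (U i) J" by blast
    from choice[OF this] obtain J where "\<forall>i. J i \<in> borel_measurable F \<and> ?Q (U i) (J i)" ..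
    then have J: "\<And>i. J i \<in> borel_measurable F" "\<And>i. ?Q (U i) (J i)" by blast+
    have all: "AE w in M. \<forall>i. J i w = (\<integral>\<^sup>+x. U i (w, x) \<partial>\<nu> w)"
      using J(2) by (simp add: AE_all_countable)
    have "AE w in M. (SUP i. J i w) = (\<integral>\<^sup>+x. (SUP i. U i) (w, x) \<partial>\<nu> w)"
      using all AE_space
    proof eventually_elim
      case (elim w)
      have "(\<integral>\<^sup>+x. (SUP i. U i (w, x)) \<partial>\<nu> w) = (SUP i. \<integral>\<^sup>+x. U i (w, x) \<partial>\<nu> w)"
        using \<open>incseq U\<close>
        by (intro nn_integral_monotone_convergence_SUP[OF _ sect[OF seq(1) elim(2)]])
          (simp add: incseq_def le_fun_def)
      then show ?case using elim(1) by (simp add: SUP_apply image_comp)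
    qed
    moreover have "(\<integral>\<^sup>+w. (SUP i. U i) (w, X w) \<partial>M) = (\<integral>\<^sup>+w. (SUP i. J i w) \<partial>M)"
    proof -
      have "(\<integral>\<^sup>+w. (SUP i. U i (w, X w)) \<partial>M) = (SUP i. \<integral>\<^sup>+w. U i (w, X w) \<partial>M)"
        using \<open>incseq U\<close>
        by (intro nn_integral_monotone_convergence_SUP[OF _ comp[OF seq(1)]])
          (simp add: incseq_def le_fun_def)
      also have "\<dots> = (SUP i. \<integral>\<^sup>+w. J i w \<partial>M)" using J(2) by simp
      also have "\<dots> = (\<integral>\<^sup>+w. (SUP i. J i w) \<partial>M)"
      proof (rule nn_integral_monotone_convergence_SUP_AE[symmetric])
        show "AE w in M. J i w \<le> J (Suc i) w" for i
          using all
        proof eventually_elim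
          case (elim w)
          have "U i (w, x) \<le> U (Suc i) (w, x)" for x
            using \<open>incseq U\<close> by (simp add: incseq_def le_fun_def)
          then show ?case using elim by (simp add: nn_integral_mono)
        qed
      qed (use FM[OF J(1)] in auto)
      finally show ?thesis by (simp add: SUP_apply image_comp)
    qed
    ultimately show ?case using J(1) by (intro bexI[of _ "\<lambda>w. SUP i. J i w"]) auto
  qed
qed

lemma has_cond_law_nn_integral:
  fixes f :: "'w \<times> 's \<Rightarrow> ennreal"
  assumes "prob_space M" "subalgebra M F" "has_cond_law M F S X \<nu>"
    and "\<And>w. sets (\<nu> w) = sets S" "AE w in M. prob_space (\<nu> w)"
    and "f \<in> borel_measurable (F \<Otimes>\<^sub>M S)"
    and g: "AE w in M. (\<integral>\<^sup>+x. f (w, x) \<partial>\<nu> w) = g w"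
  shows "(\<integral>\<^sup>+w. f (w, X w) \<partial>M) = (\<integral>\<^sup>+w. g w \<partial>M)"
proof -
  obtain J where J: "AE w in M. J w = (\<integral>\<^sup>+x. f (w, x) \<partial>\<nu> w)"
    "(\<integral>\<^sup>+w. f (w, X w) \<partial>M) = (\<integral>\<^sup>+w. J w \<partial>M)"
    using has_cond_law_nn_integral_version[OF assms(1-6)] by blast
  have "AE w in M. J w = g w"
    using J(1) g by eventually_elim simp
  then show ?thesis unfolding J(2) by (rule nn_integral_cong_AE)
qed

text \<open>Evaluation of a random path at a random input is a Caratheodory function: the input is
  approximated by simple functions, for which measurability is a finite case distinction, and
  continuity of the path gives the limit.\<close>

lemma borel_measurable_eval:
  fixes \<zeta> :: "'w \<Rightarrow> 'z::euclidean_space"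
  assumes \<zeta>: "\<zeta> \<in> borel_measurable M"
  shows "(\<lambda>(w, g). g (\<zeta> w)) \<in> borel_measurable (M \<Otimes>\<^sub>M paths (1 :: real))"
proof -
  obtain s where s: "\<And>i. simple_function M (s i)" "\<And>w. w \<in> space M \<Longrightarrow> (\<lambda>i. s i w) \<longlonglongrightarrow> \<zeta> w"
    using borel_measurable_implies_sequence_metric[OF \<zeta>, of 0] by blast
  show ?thesis
  proof (rule borel_measurable_LIMSEQ_real)
    fix i
    have "(\<lambda>x. s i (fst x)) \<in> M \<Otimes>\<^sub>M paths (1 :: real) \<rightarrow>\<^sub>M count_space (s i ` space M)"
    proof (rule measurable_compose[OF measurable_fst])
      show "s i \<in> M \<rightarrow>\<^sub>M count_space (s i ` space M)"
        using measurable_simple_function[OF s(1)[of i]]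
        by (auto simp: measurable_def)
    qed
    moreover have "countable (s i ` space M)"
      using simple_functionD(1)[OF s(1)] by (rule countable_finite)
    moreover have "(\<lambda>x. snd x z) \<in> borel_measurable (M \<Otimes>\<^sub>M paths (1 :: real))" for z :: 'z
      by (rule measurable_compose[OF measurable_snd measurable_paths_component])
    ultimately show "(\<lambda>x. snd x (s i (fst x))) \<in> borel_measurable (M \<Otimes>\<^sub>M paths (1 :: real))"
      by (rule measurable_compose_countable'[where f = "\<lambda>z x. snd x z", rotated 1])
  next
    fix x :: "'w \<times> ('z \<Rightarrow> real)"
    assume "x \<in> space (M \<Otimes>\<^sub>M paths 1)"
    then have "fst x \<in> space M" "continuous_on UNIV (snd x)"
      by (auto simp: space_pair_measure space_paths)
    then show "(\<lambda>i. snd x (s i (fst x))) \<longlonglongrightarrow> (case x of (w, g) \<Rightarrow> g (\<zeta> w))"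
      using isCont_tendsto_compose[OF _ s(2), of "fst x" "snd x"]
      by (simp add: case_prod_beta' continuous_on_eq_continuous_at)
  qed
qed

lemma set_basis_list: "set basis_list = (Basis :: 'b::euclidean_space set)"
proof -
  have "\<exists>bs. distinct bs \<and> set bs = (Basis :: 'b set)"
    using finite_distinct_list[OF finite_Basis] by blast
  then show ?thesis unfolding basis_list_def by (rule someI2_ex) blast
qed

definition locations :: "nat \<Rightarrow> (nat \<Rightarrow> 'z) \<Rightarrow> ('z \<times> 'b::euclidean_space) list" where
  "locations n zs = concat (map (\<lambda>i. map (Pair (zs i)) basis_list) [0..<n])"

lemma exact_data_eq_data_at:
  "concat (map (\<lambda>i. exact_data (zs i) (g (zs i))) [0..<n]) = data_at (locations n zs) g"
  by (simp add: data_at_def locations_def exact_data_def map_concat comp_def)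

lemma exact_exact_data: "exact (concat (map (\<lambda>i. exact_data (zs i) (x i)) is))"
  by (induction "is") (auto simp: exact_data_def exact_def)

section \<open>Truncated posteriors and sampled data\<close>

context gp_posterior
begin

text \<open>The probability of \<open>A\<close> under the truncated posterior, as a function of the
  extra data \<open>E\<close>. Where \<open>B\<close> has no mass the quotient is 0 / 0, which is 0
  in \<open>ennreal\<close>.\<close>

definition trunc_prob :: "('z \<Rightarrow> 'b) set \<Rightarrow> ('z, 'b) obs list \<Rightarrow> ('z \<Rightarrow> 'b) set \<Rightarrow> ennreal" where
  "trunc_prob B E A = emeasure (cond_gp_law e K (D0 @ E)) (A \<inter> B) / emeasure (cond_gp_law e K (D0 @ E)) B"

lemma measurable_trunc_prob:
  assumes "measurable_obs N R" "\<And>w. exact (map (inst_obs w) R)" "A \<in> sets (paths e)" "B \<in> sets (paths e)"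
  shows "(\<lambda>w. trunc_prob B (map (inst_obs w) R) A) \<in> borel_measurable N"
proof -
  note k = measurable_emeasure_kernel[OF measurable_cond_gp_law[OF assms(1,2)]]
  note [measurable] = k[OF assms(4)] k[OF sets.Int[OF assms(3,4)]]
  show ?thesis unfolding trunc_prob_def by measurable
qed

text \<open>The integrand \<open>h\<close> depends on a path only through its observations and is
  therefore almost surely constant under the conditional law. Integrating it over \<open>B\<close>
  there multiplies it by the conditional mass of \<open>B\<close>, which cancels its denominator;
  disintegration then reassembles the mass of \<open>A \<inter> B\<close>.\<close>

lemma trunc_prob_tower:
  assumes E: "exact E" and c: "consistent K (rev (D0 @ E))"
    and A: "A \<in> sets (paths e)" and B: "B \<in> sets (paths e)"
    and pos: "emeasure (gp_law e K (D0 @ E)) B \<noteq> 0"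
  shows "(\<integral>\<^sup>+g. trunc_prob B (E @ data_at ts g) A \<partial>uniform_measure (gp_law e K (D0 @ E)) B) = trunc_prob B E A"
proof -
  let ?P = "gp_law e K (D0 @ E)" and ?c = "\<lambda>g. cond_gp_law e K (D0 @ E @ data_at ts g)"
  define h where "h g = trunc_prob B (E @ data_at ts g) A" for g
  note k = measurable_emeasure_kernel[OF measurable_cond_gp_law_data_at[OF E, of ts]]
  note [measurable] = k[OF B] k[OF sets.Int[OF A B]]
  have h: "h \<in> borel_measurable (paths e)"
    unfolding h_def trunc_prob_def by measurable
  have hP: "h \<in> borel_measurable ?P" using h by (simp cong: measurable_cong_sets)
  have hB: "(\<lambda>g. h g * indicator B g) \<in> borel_measurable (paths e)"
    using h B by measurable
  have "(\<integral>\<^sup>+g. h g * indicator B g \<partial>?P) = (\<integral>\<^sup>+g. \<integral>\<^sup>+g'. h g' * indicator B g' \<partial>?c g \<partial>?P)"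
    by (rule disintegration[OF E c hB])
  also have "\<dots> = (\<integral>\<^sup>+g. emeasure (?c g) (A \<inter> B) \<partial>?P)"
  proof (rule nn_integral_cong)
    fix g
    interpret c: subprob_space "?c g"
      using E by (intro subprob_space_cond_gp_law) simp
    have "(\<integral>\<^sup>+g'. h g' * indicator B g' \<partial>?c g) = (\<integral>\<^sup>+g'. h g * indicator B g' \<partial>?c g)"
    proof (rule nn_integral_cong_AE, rule AE_mp[OF AE_data_at[OF E, of ts g]], intro AE_I2 impI)
      fix g' assume "data_at ts g' = data_at ts g"
      then show "h g' * indicator B g' = h g * indicator B g'" by (simp add: h_def)
    qed
    also have "\<dots> = h g * emeasure (?c g) B"
      using B by (simp add: nn_integral_cmult_indicator)
    also have "\<dots> = emeasure (?c g) (A \<inter> B)"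
    proof (cases "emeasure (?c g) B = 0")
      case True
      moreover have "emeasure (?c g) (A \<inter> B) \<le> emeasure (?c g) B"
        using B by (intro emeasure_mono) auto
      ultimately show ?thesis by simp
    next
      case False
      then show ?thesis
        unfolding h_def trunc_prob_def by (simp add: ennreal_divide_times less_top[symmetric])
    qed
    finally show "(\<integral>\<^sup>+g'. h g' * indicator B g' \<partial>?c g) = emeasure (?c g) (A \<inter> B)" .
  qed
  also have "\<dots> = (\<integral>\<^sup>+g. \<integral>\<^sup>+g'. indicator (A \<inter> B) g' \<partial>?c g \<partial>?P)"
    using A B by simp
  also have "\<dots> = (\<integral>\<^sup>+g. indicator (A \<inter> B) g \<partial>?P)"
    using A B by (intro disintegration[OF E c, symmetric]) auto
  also have "\<dots> = emeasure ?P (A \<inter> B)"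
    using A B by simp
  finally have "(\<integral>\<^sup>+g. h g * indicator B g \<partial>?P) / emeasure ?P B = trunc_prob B E A"
    using c by (simp add: trunc_prob_def cond_gp_law_def)
  then show ?thesis
    using nn_integral_uniform_measure[OF hP, of B] B unfolding h_def by simp
qed

text \<open>The conditional law of the outputs of one round is the image of the truncated posterior
  under evaluation at the inputs of that round. Integrating over the sampled outputs is therefore
  integrating over paths of the truncated posterior, where \<open>trunc_prob_tower\<close>
  applies.\<close>

lemma trunc_prob_round:
  fixes M F :: "'w measure" and lo up
  assumes M: "prob_space M" "subalgebra M F"
    and R: "measurable_obs F R" "\<And>w. exact (map (inst_obs w) R)"
    and zs: "\<And>i. i < n \<Longrightarrow> zs i \<in> borel_measurable F"
    and A: "A \<in> sets (paths e)" and B: "bounded_paths e S lo up \<in> sets (paths e)"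
    and good: "AE w in M. emeasure (cond_gp_law e K (D0 @ map (inst_obs w) R)) (bounded_paths e S lo up) \<noteq> 0"
    and law: "has_cond_law M F (PiM {..<n} (\<lambda>_. borel)) X
      (\<lambda>w. trunc_gp_at e S lo up K (D0 @ map (inst_obs w) R) n (\<lambda>i. zs i w))"
  shows "(\<integral>\<^sup>+w. trunc_prob (bounded_paths e S lo up)
      (map (inst_obs w) R @ concat (map (\<lambda>i. exact_data (zs i w) (X w i)) [0..<n])) A \<partial>M) =
    (\<integral>\<^sup>+w. trunc_prob (bounded_paths e S lo up) (map (inst_obs w) R) A \<partial>M)"
proof -
  let ?B = "bounded_paths e S lo up" and ?S = "PiM {..<n} (\<lambda>_. borel :: 'b measure)"
  let ?c = "\<lambda>w. cond_gp_law e K (D0 @ map (inst_obs w) R)"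
  define \<nu> where "\<nu> w = trunc_gp_at e S lo up K (D0 @ map (inst_obs w) R) n (\<lambda>i. zs i w)" for w
  define f where "f = (\<lambda>(w, x). trunc_prob ?B
      (map (inst_obs w) R @ concat (map (\<lambda>i. exact_data (zs i w) (x i)) [0..<n])) A)"
  have ev: "(\<lambda>g. \<lambda>i\<in>{..<n}. g (ys i)) \<in> uniform_measure P ?B \<rightarrow>\<^sub>M ?S"
    if "sets P = sets (paths e)" for ys and P
    by (rule measurable_restrict) (use that in \<open>simp cong: measurable_cong_sets\<close>)
  have cB: "consistent K (rev (D0 @ map (inst_obs w) R)) \<and> ?c w = gp_law e K (D0 @ map (inst_obs w) R)"
    if "emeasure (?c w) ?B \<noteq> 0" for w
    using that by (auto simp: cond_gp_law_def split: if_splits)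
  have prob: "prob_space (uniform_measure (?c w) ?B)" if "emeasure (?c w) ?B \<noteq> 0" for w
  proof (rule prob_space_uniform_measure)
    interpret subprob_space "?c w" by (rule subprob_space_cond_gp_law[OF R(2)])
    show "emeasure (?c w) ?B \<noteq> \<infinity>" by simp
  qed fact
  show ?thesis
  proof (rule has_cond_law_nn_integral[OF M law, of f, folded \<nu>_def, unfolded f_def prod.case])
    show "sets (\<nu> w) = sets ?S" for w by (simp add: \<nu>_def trunc_gp_at_def)
    show "AE w in M. prob_space (\<nu> w)"
      using good
    proof eventually_elim
      case (elim w)
      show ?case
        unfolding \<nu>_def trunc_gp_at_def trunc_gp_law_def cB[OF elim, THEN conjunct2, symmetric]
        by (rule prob_space.prob_space_distr[OF prob[OF elim] ev]) simp
    qed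
    \<comment> \<open>The old and the new observations as one symbolic list over the product space,
      the new values being coordinates of the second component; joint measurability then follows
      from \<open>measurable_trunc_prob\<close>.\<close>
    define R' :: "(('w \<times> (nat \<Rightarrow> 'b) \<Rightarrow> 'z) \<times> 'b \<times> ('w \<times> (nat \<Rightarrow> 'b) \<Rightarrow> real) \<times> real) list" where
      "R' = map (\<lambda>d. (\<lambda>x. fst d (fst x), fst (snd d), \<lambda>x. fst (snd (snd d)) (fst x), snd (snd (snd d)))) R @
        concat (map (\<lambda>i. map (\<lambda>b. (\<lambda>x. zs i (fst x), b, \<lambda>x. b \<bullet> snd x i, 0)) basis_list) [0..<n])"
    have eq: "map (inst_obs w) R @ concat (map (\<lambda>i. exact_data (zs i w) (x i)) [0..<n]) = map (inst_obs (w, x)) R'"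
      for w x
      by (simp add: R'_def exact_data_def map_concat comp_def) (simp add: inst_obs_def case_prod_beta')
    have R': "measurable_obs (F \<Otimes>\<^sub>M ?S) R'"
    proof -
      have comp: "(\<lambda>x. snd x i) \<in> borel_measurable (F \<Otimes>\<^sub>M ?S)" if "i < n" for i
        using that by (intro measurable_compose[OF measurable_snd measurable_component_singleton]) auto
      have "measurable_obs (F \<Otimes>\<^sub>M ?S)
          (map (\<lambda>d. (\<lambda>x. fst d (fst x), fst (snd d), \<lambda>x. fst (snd (snd d)) (fst x), snd (snd (snd d)))) R)"
        using R(1) by (auto simp: measurable_obs_def split_beta intro: measurable_compose[OF measurable_fst])
      moreover have "measurable_obs (F \<Otimes>\<^sub>M ?S)
          (concat (map (\<lambda>i. map (\<lambda>b. (\<lambda>x. zs i (fst x), b, \<lambda>x. b \<bullet> snd x i, 0)) basis_list) [0..<n]))"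
        by (auto simp: measurable_obs_def intro!: measurable_compose[OF measurable_fst zs]
            borel_measurable_inner comp)
      ultimately show ?thesis by (simp add: R'_def)
    qed
    have ex: "exact (map (inst_obs x) R')" for x
      using R(2) exact_exact_data unfolding eq[of "fst x" "snd x", unfolded prod.collapse, symmetric] by simp
    show "(\<lambda>(w, x). trunc_prob ?B (map (inst_obs w) R @ concat (map (\<lambda>i. exact_data (zs i w) (x i)) [0..<n])) A)
        \<in> borel_measurable (F \<Otimes>\<^sub>M ?S)"
      unfolding eq using measurable_trunc_prob[OF R' ex A B] by (simp add: case_prod_beta')
    then have f: "f \<in> borel_measurable (F \<Otimes>\<^sub>M ?S)" by (simp add: f_def)
    show "AE w in M. (\<integral>\<^sup>+x. trunc_prob ?B
        (map (inst_obs w) R @ concat (map (\<lambda>i. exact_data (zs i w) (x i)) [0..<n])) A \<partial>\<nu> w) =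
        trunc_prob ?B (map (inst_obs w) R) A"
      using good AE_space
    proof eventually_elim
      case (elim w)
      let ?E = "map (inst_obs w) R" and ?zs = "\<lambda>i. zs i w"
      let ?P = "gp_law e K (D0 @ ?E)"
      have c: "consistent K (rev (D0 @ ?E))" "?c w = ?P" using cB[OF elim(1)] by simp_all
      have w: "w \<in> space F" using elim(2) M(2) by (simp add: subalgebra_def)
      have fm: "(\<lambda>x. f (w, x)) \<in> borel_measurable ?S"
        by (rule measurable_compose[OF measurable_Pair1'[OF w] f])
      have "(\<integral>\<^sup>+x. f (w, x) \<partial>\<nu> w) =
          (\<integral>\<^sup>+g. f (w, \<lambda>i\<in>{..<n}. g (?zs i)) \<partial>uniform_measure ?P ?B)"
        unfolding \<nu>_def trunc_gp_at_def trunc_gp_law_def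
        using fm by (intro nn_integral_distr[OF ev]) auto
      also have "\<dots> = (\<integral>\<^sup>+g. trunc_prob ?B (?E @ data_at (locations n ?zs) g) A \<partial>uniform_measure ?P ?B)"
      proof (rule nn_integral_cong)
        fix g :: "'z \<Rightarrow> 'b"
        have "concat (map (\<lambda>i. exact_data (?zs i) ((\<lambda>i\<in>{..<n}. g (?zs i)) i)) [0..<n]) =
            concat (map (\<lambda>i. exact_data (?zs i) (g (?zs i))) [0..<n])"
          by (intro arg_cong[where f = concat] map_cong) auto
        also have "\<dots> = data_at (locations n ?zs) g"
          by (rule exact_data_eq_data_at)
        finally show "f (w, \<lambda>i\<in>{..<n}. g (?zs i)) = trunc_prob ?B (?E @ data_at (locations n ?zs) g) A"
          unfolding f_def prod.case by (rule arg_cong)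
      qed
      also have "\<dots> = trunc_prob ?B ?E A"
        using elim(1) unfolding c(2) by (rule trunc_prob_tower[OF R(2) c(1) A B])
      finally show ?case by (simp add: f_def)
    qed
  qed
qed

end

section \<open>Sampling rounds\<close>

definition random_data ::
  "(nat \<Rightarrow> nat) \<Rightarrow> (nat \<Rightarrow> nat \<Rightarrow> 'w \<Rightarrow> 'z) \<Rightarrow> (nat \<Rightarrow> nat \<Rightarrow> 'w \<Rightarrow> 'b::euclidean_space) \<Rightarrow> nat \<Rightarrow>
   (('w \<Rightarrow> 'z) \<times> 'b \<times> ('w \<Rightarrow> real) \<times> real) list" where
  "random_data m \<zeta> G r = concat (map (\<lambda>t. concat (map (\<lambda>i.
    map (\<lambda>b. (\<zeta> t i, b, \<lambda>w. b \<bullet> G t i w, 0)) basis_list) [0..<m t])) [1..<r])"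

lemma sampled_data_eq:
  "sampled_data m (\<lambda>t i. \<zeta> t i w) (\<lambda>t i. G t i w) r = map (inst_obs w) (random_data m \<zeta> G r)"
  by (simp add: sampled_data_def random_data_def exact_data_def map_concat comp_def)

lemma sampled_data_Suc:
  "r \<ge> 1 \<Longrightarrow> sampled_data m zs gs (Suc r) =
    sampled_data m zs gs r @ concat (map (\<lambda>i. exact_data (zs r i) (gs r i)) [0..<m r])"
  by (simp add: sampled_data_def)

lemma exact_sampled_data: "exact (sampled_data m zs gs r)"
  by (auto simp: exact_def sampled_data_def exact_data_def)

text \<open>Describes a single dynamics sample. The other samples, which influence its inputs
  through the common control sequence, enter through the filtration \<open>F\<close> alone.\<close>

locale sampling_rounds = gp_posterior K e D0
  for K :: "('z::euclidean_space, 'b::euclidean_space) mkernel" and e D0 +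
  fixes S :: "'z set" and lo up :: "'z \<Rightarrow> real"
    and M :: "'w measure" and F :: "nat \<Rightarrow> 'w measure"
    and m :: "nat \<Rightarrow> nat" and T :: nat
    and \<zeta> :: "nat \<Rightarrow> nat \<Rightarrow> 'w \<Rightarrow> 'z" and G :: "nat \<Rightarrow> nat \<Rightarrow> 'w \<Rightarrow> 'b"
  assumes pos: "emeasure (gp_law e K D0) (bounded_paths e S lo up) > 0"
    and M: "prob_space M"
    and F: "\<And>r. subalgebra M (F r)" "\<And>r. sets (F r) \<subseteq> sets (F (Suc r))"
    and meas: "\<And>r i. r \<in> {1..T} \<Longrightarrow> i < m r \<Longrightarrow>
      \<zeta> r i \<in> borel_measurable (F r) \<and> G r i \<in> borel_measurable (F (Suc r))"
    and law: "\<And>r. r \<in> {1..T} \<Longrightarrow> has_cond_law M (F r) (PiM {..<m r} (\<lambda>_. borel))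
      (\<lambda>w. \<lambda>i\<in>{..<m r}. G r i w)
      (\<lambda>w. trunc_gp_at e S lo up K
        (D0 @ sampled_data m (\<lambda>t i. \<zeta> t i w) (\<lambda>t i. G t i w) r) (m r) (\<lambda>i. \<zeta> r i w))"
begin

abbreviation B where "B \<equiv> bounded_paths e S lo up"

abbreviation data :: "nat \<Rightarrow> 'w \<Rightarrow> ('z, 'b) obs list" where
  "data r w \<equiv> sampled_data m (\<lambda>t i. \<zeta> t i w) (\<lambda>t i. G t i w) r"

lemma B_sets: "B \<in> sets (paths e)"
  \<comment> \<open>As before, positive mass forces membership in the sigma-algebra.\<close>
  using pos emeasure_notin_sets[of B "gp_law e K D0"] by fastforce

lemma F_mono: "r \<le> s \<Longrightarrow> f \<in> F r \<rightarrow>\<^sub>M N \<Longrightarrow> f \<in> F s \<rightarrow>\<^sub>M N"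
proof (rule measurable_from_subalg[of "F s" "F r"])
  assume "r \<le> s"
  then have "sets (F r) \<subseteq> sets (F s)" by (rule lift_Suc_mono_le[of "\<lambda>r. sets (F r)", OF F(2)])
  then show "subalgebra (F s) (F r)" using F(1) by (simp add: subalgebra_def)
qed

lemma M_measurable: "f \<in> F r \<rightarrow>\<^sub>M N \<Longrightarrow> f \<in> M \<rightarrow>\<^sub>M N"
  by (rule measurable_from_subalg[OF F(1)])

lemma measurable_random_data:
  assumes "r \<le> Suc T"
  shows "measurable_obs (F r) (random_data m \<zeta> G r)"
proof -
  have "\<zeta> t i \<in> borel_measurable (F r)" "G t i \<in> borel_measurable (F r)"
    if "t \<in> {1..<r}" "i < m t" for t i
    using meas[of t i] that assms F_mono[of t r] F_mono[of "Suc t" r] by auto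
  then show ?thesis
    by (auto simp: measurable_obs_def random_data_def intro!: borel_measurable_inner)
qed

lemma exact_random_data: "exact (map (inst_obs w) (random_data m \<zeta> G r))"
  using exact_sampled_data by (simp add: sampled_data_eq[symmetric])

lemma measurable_trunc_prob_data:
  assumes "r \<le> Suc T" "A \<in> sets (paths e)"
  shows "(\<lambda>w. trunc_prob B (data r w) A) \<in> borel_measurable M"
  unfolding sampled_data_eq
  by (rule M_measurable[OF measurable_trunc_prob[OF measurable_random_data[OF assms(1)] exact_random_data assms(2) B_sets]])

lemma trunc_prob_space:
  assumes "exact E"
  shows "trunc_prob B E (space (paths e)) =
    (if emeasure (cond_gp_law e K (D0 @ E)) B = 0 then 0 else 1)"
proof -
  interpret subprob_space "cond_gp_law e K (D0 @ E)"
    using assms by (rule subprob_space_cond_gp_law)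
  have "space (paths e) \<inter> B = B" by (auto simp: bounded_paths_def)
  then show ?thesis
    by (simp add: trunc_prob_def less_top[symmetric] ennreal_divide_self)
qed

lemma cond_gp_law_D0: "cond_gp_law e K D0 = gp_law e K D0"
  using cons0 by (simp add: cond_gp_law_def)

text \<open>On the whole space \<open>trunc_prob\<close> takes only the values 0 and 1, depending on
  whether the bounded paths have mass; expectation one excludes the value 0 almost surely.\<close>

lemma AE_good:
  assumes r: "r \<le> Suc T"
    and one: "(\<integral>\<^sup>+w. trunc_prob B (data r w) (space (paths e)) \<partial>M) = 1"
  shows "AE w in M. emeasure (cond_gp_law e K (D0 @ data r w)) B \<noteq> 0"
proof -
  interpret prob_space M by (rule M)
  let ?g = "\<lambda>w. trunc_prob B (data r w) (space (paths e))"
  have g: "?g \<in> borel_measurable M"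
    using r by (rule measurable_trunc_prob_data) simp
  have le: "?g w \<le> 1" for w
    by (simp add: trunc_prob_space[OF exact_sampled_data])
  have "(\<integral>\<^sup>+w. 1 - ?g w \<partial>M) = (\<integral>\<^sup>+w. 1 \<partial>M) - (\<integral>\<^sup>+w. ?g w \<partial>M)"
    using g le one by (intro nn_integral_diff) auto
  also have "\<dots> = 0" using one by (simp add: emeasure_space_1)
  finally have "AE w in M. 1 - ?g w = 0"
    using g by (subst (asm) nn_integral_0_iff_AE) auto
  then show ?thesis
    by eventually_elim (auto simp: trunc_prob_space[OF exact_sampled_data] split: if_splits)
qed

text \<open>The truncated posterior probability of a fixed event keeps its expectation from round to
  round, as a martingale does. The start \<open>r = 1\<close> is the empty list of samples.\<close>

lemma trunc_prob_data:
  assumes "1 \<le> r" "r \<le> Suc T" "A \<in> sets (paths e)"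
  shows "(\<integral>\<^sup>+w. trunc_prob B (data r w) A \<partial>M) = trunc_prob B [] A"
  using assms
proof (induction r arbitrary: A rule: dec_induct)
  case base
  interpret prob_space M by (rule M)
  show ?case by (simp add: sampled_data_def emeasure_space_1)
next
  case (step r)
  have r: "r \<in> {1..T}" "r \<le> Suc T" using step by auto
  \<comment> \<open>For the whole space the hypothesis says that the truncated posterior is almost
    surely well defined at this stage, as the next round requires; hence \<open>A\<close> is
    arbitrary in the induction.\<close>
  have "(\<integral>\<^sup>+w. trunc_prob B (data r w) (space (paths e)) \<partial>M) = 1"
    using step.IH[OF r(2) sets.top] pos trunc_prob_space[of "[]"] by (simp add: cond_gp_law_D0)
  then have good: "AE w in M. emeasure (cond_gp_law e K (D0 @ data r w)) B \<noteq> 0"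
    by (rule AE_good[OF r(2)])
  have "(\<integral>\<^sup>+w. trunc_prob B (data (Suc r) w) A \<partial>M) =
      (\<integral>\<^sup>+w. trunc_prob B (data r w @ concat (map (\<lambda>i. exact_data (\<zeta> r i w)
        ((\<lambda>i\<in>{..<m r}. G r i w) i)) [0..<m r])) A \<partial>M)"
  proof (rule nn_integral_cong)
    fix w
    have "concat (map (\<lambda>i. exact_data (\<zeta> r i w) (G r i w)) [0..<m r]) =
        concat (map (\<lambda>i. exact_data (\<zeta> r i w) ((\<lambda>i\<in>{..<m r}. G r i w) i)) [0..<m r])"
      by (intro arg_cong[where f = concat] map_cong) auto
    then show "trunc_prob B (data (Suc r) w) A = trunc_prob B (data r w @ concat (map (\<lambda>i.
        exact_data (\<zeta> r i w) ((\<lambda>i\<in>{..<m r}. G r i w) i)) [0..<m r])) A"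
      unfolding sampled_data_Suc[OF step(1)] by simp
  qed
  also have "\<dots> = (\<integral>\<^sup>+w. trunc_prob B (data r w) A \<partial>M)"
    unfolding sampled_data_eq
    by (rule trunc_prob_round[OF M F(1) measurable_random_data[OF r(2)] exact_random_data
        meas[OF r(1), THEN conjunct1] step.prems(2) B_sets good[unfolded sampled_data_eq]
        law[OF r(1), unfolded sampled_data_eq]])
  also have "\<dots> = trunc_prob B [] A"
    using step.IH[OF r(2) step.prems(2)] .
  finally show ?case .
qed

lemma data_mem:
  assumes "t \<in> {1..<r}" "i < m t" "b \<in> Basis"
  shows "(\<zeta> t i w, b, b \<bullet> G t i w, 0) \<in> set (data r w)"
proof -
  have concat: "x \<in> set (h a) \<Longrightarrow> a \<in> set as \<Longrightarrow> x \<in> set (concat (map h as))"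
    for x and h :: "nat \<Rightarrow> ('z, 'b) obs list" and a as by auto
  have "(\<zeta> t i w, b, b \<bullet> G t i w, 0) \<in> set (exact_data (\<zeta> t i w) (G t i w))"
    using assms(3) by (simp add: exact_data_def set_basis_list)
  then show ?thesis
    unfolding sampled_data_def by (rule concat[OF concat]) (use assms in auto)
qed

lemma AE_cond_gp_law_data:
  "AE g in cond_gp_law e K (D0 @ data r w). \<forall>t\<in>{1..<r}. \<forall>i<m t. g (\<zeta> t i w) = G t i w"
proof -
  have "AE g in cond_gp_law e K (D0 @ data r w). \<forall>d\<in>set (data r w).
      snd (snd (snd d)) = 0 \<longrightarrow> fst (snd d) \<bullet> g (fst d) = fst (snd (snd d))"
  proof (rule AE_finite_allI[OF finite_set])
    fix d assume d: "d \<in> set (data r w)"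
    obtain z p y c where "d = (z, p, y, c)" by (cases d)
    with d show "AE g in cond_gp_law e K (D0 @ data r w).
        snd (snd (snd d)) = 0 \<longrightarrow> fst (snd d) \<bullet> g (fst d) = fst (snd (snd d))"
      using AE_exact[OF exact_sampled_data, of z p y] by (cases "c = 0") auto
  qed
  then show ?thesis
  proof eventually_elim
    case (elim g)
    show ?case
    proof (intro ballI allI impI, rule euclidean_eqI)
      fix t i and b :: 'b
      assume "t \<in> {1..<r}" "i < m t" "b \<in> Basis"
      from bspec[OF elim data_mem[OF this]] have "b \<bullet> g (\<zeta> t i w) = b \<bullet> G t i w"
        by simp
      then show "g (\<zeta> t i w) \<bullet> b = G t i w \<bullet> b" by (simp only: inner_commute)
    qed
  qed
qed

text \<open>
  After the last round, a whole path is drawn from the truncated law given all the data. Its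
  marginal law is that of the truncated process given \<open>D0\<close> only, by \<open>trunc_prob_data\<close>.
\<close>

lemma coupling:
  assumes v: "v \<in> paths e \<rightarrow>\<^sub>M N"
  obtains M' where "prob_space M'" "sets M' = sets (M \<Otimes>\<^sub>M N)" "distr M' M fst = M"
    "distr M' N snd = distr (trunc_gp_law e S lo up K D0) N v"
    "\<forall>P. Measurable.pred (M \<Otimes>\<^sub>M N) P \<longrightarrow>
      (\<forall>w g. w \<in> space M \<longrightarrow> (\<forall>r\<in>{1..T}. \<forall>i<m r. g (\<zeta> r i w) = G r i w) \<longrightarrow> P (w, v g)) \<longrightarrow>
      (AE x in M'. P x)"
proof -
  interpret prob_space M by (rule M)
  let ?c = "\<lambda>w. cond_gp_law e K (D0 @ data (Suc T) w)"
  \<comment> \<open>The original law serves as a default on the null set where the conditional one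
    gives \<open>B\<close> no mass, so that the kernel consists of probability measures
    everywhere.\<close>
  define \<kappa> where "\<kappa> w = uniform_measure (if emeasure (?c w) B \<noteq> 0 then ?c w else gp_law e K D0) B" for w
  have one: "trunc_prob B [] (space (paths e)) = 1"
    using pos trunc_prob_space[of "[]"] by (simp add: cond_gp_law_D0)
  have good: "AE w in M. emeasure (?c w) B \<noteq> 0"
    using trunc_prob_data[of "Suc T", OF _ _ sets.top] one by (intro AE_good) auto
  have sub: "subprob_space (?c w)" for w
    using exact_sampled_data by (rule subprob_space_cond_gp_law)
  have sub0: "subprob_space (gp_law e K D0)"
    using subprob_space_cond_gp_law[of "[]"] by (simp add: cond_gp_law_D0)
  have prob: "prob_space (\<kappa> w)" for w
    unfolding \<kappa>_def
  proof (rule prob_space_uniform_measure)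
    interpret c: subprob_space "?c w" by (rule sub)
    interpret d: subprob_space "gp_law e K D0" by (rule sub0)
    show "emeasure (if emeasure (?c w) B \<noteq> 0 then ?c w else gp_law e K D0) B \<noteq> 0"
      "emeasure (if emeasure (?c w) B \<noteq> 0 then ?c w else gp_law e K D0) B \<noteq> \<infinity>"
      using pos by auto
  qed
  have sets\<kappa> [simp]: "sets (\<kappa> w) = sets (paths e)" for w
    by (simp add: \<kappa>_def)
  have em: "emeasure (\<kappa> w) A = (if emeasure (?c w) B \<noteq> 0 then trunc_prob B (data (Suc T) w) A
      else emeasure (uniform_measure (gp_law e K D0) B) A)" if "A \<in> sets (paths e)" for A w
    using that B_sets by (simp add: \<kappa>_def trunc_prob_def Int_commute)
  have ck: "?c \<in> M \<rightarrow>\<^sub>M subprob_algebra (paths e)"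
    unfolding sampled_data_eq
    by (rule M_measurable[OF measurable_cond_gp_law[OF measurable_random_data[OF order_refl] exact_random_data]])
  have \<kappa>: "\<kappa> \<in> M \<rightarrow>\<^sub>M subprob_algebra (paths e)"
  proof (rule measurable_subprob_algebra)
    show "subprob_space (\<kappa> w)" for w using prob by (rule prob_space_imp_subprob_space)
    show "(\<lambda>w. emeasure (\<kappa> w) A) \<in> borel_measurable M" if A: "A \<in> sets (paths e)" for A
    proof -
      note [measurable] = measurable_emeasure_kernel[OF ck B_sets] measurable_trunc_prob_data[OF order_refl A]
      show ?thesis unfolding em[OF A] by measurable
    qed
  qed simp
  have pair: "(\<lambda>(w, g). (w, v g)) \<in> M \<Otimes>\<^sub>M paths e \<rightarrow>\<^sub>M M \<Otimes>\<^sub>M N"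
    using v by measurable
  define k where "k w = distr (\<kappa> w) (M \<Otimes>\<^sub>M N) (\<lambda>g. (w, v g))" for w
  have k: "k \<in> M \<rightarrow>\<^sub>M subprob_algebra (M \<Otimes>\<^sub>M N)"
    unfolding k_def using measurable_distr2[OF _ \<kappa>, of "\<lambda>w g. (w, v g)"] pair by simp
  have vm: "(\<lambda>g. (w, v g)) \<in> \<kappa> w \<rightarrow>\<^sub>M M \<Otimes>\<^sub>M N" if "w \<in> space M" for w
    using measurable_compose[OF measurable_Pair1'[OF that] pair] by (simp cong: measurable_cong_sets)
  define M' where "M' = M \<bind> k"
  have sets': "sets M' = sets (M \<Otimes>\<^sub>M N)"
    unfolding M'_def by (rule sets_bind[OF sets_kernel[OF k] not_empty])
  have prob': "prob_space M'"
    unfolding M'_def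
  proof (rule prob_space_bind[OF _ k])
    show "AE w in M. prob_space (k w)"
      unfolding k_def by (intro AE_I2 prob_space.prob_space_distr[OF prob] vm)
  qed
  have kw: "distr (k w) L h = distr (\<kappa> w) L (\<lambda>g. h (w, v g))"
    if "w \<in> space M" "h \<in> M \<Otimes>\<^sub>M N \<rightarrow>\<^sub>M L" for w h and L :: "'l measure"
    unfolding k_def using distr_distr[OF that(2) vm[OF that(1)]] by (simp add: comp_def)
  have fst: "distr M' M fst = M"
  proof -
    have "distr M' M fst = M \<bind> (\<lambda>w. distr (k w) M fst)"
      unfolding M'_def by (rule distr_bind[OF k not_empty measurable_fst])
    also have "\<dots> = M \<bind> return M"
      by (rule bind_cong[OF refl]) (simp add: kw prob_space.distr_const[OF prob])
    finally show ?thesis by (simp add: bind_return'')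
  qed
  have snd: "distr M' N snd = distr (trunc_gp_law e S lo up K D0) N v"
  proof (rule measure_eqI)
    fix A assume "A \<in> sets (distr M' N snd)"
    then have A: "A \<in> sets N" by simp
    have vA: "v -` A \<inter> space (paths e) \<in> sets (paths e)"
      using v A by (rule measurable_sets)
    have distr_v: "emeasure (distr Q N v) A = emeasure Q (v -` A \<inter> space (paths e))"
      if Q: "sets Q = sets (paths e)" for Q
    proof -
      have "v \<in> Q \<rightarrow>\<^sub>M N" using v unfolding measurable_cong_sets[OF Q refl] .
      from emeasure_distr[OF this A] show ?thesis
        unfolding sets_eq_imp_space_eq[OF Q] .
    qed
    have "distr M' N snd = M \<bind> (\<lambda>w. distr (k w) N snd)"
      unfolding M'_def by (rule distr_bind[OF k not_empty measurable_snd])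
    then have "emeasure (distr M' N snd) A = (\<integral>\<^sup>+w. emeasure (distr (k w) N snd) A \<partial>M)"
      using emeasure_bind[OF not_empty measurable_compose[OF k measurable_distr[OF measurable_snd]] A] by simp
    also have "\<dots> = (\<integral>\<^sup>+w. trunc_prob B (data (Suc T) w) (v -` A \<inter> space (paths e)) \<partial>M)"
    proof (rule nn_integral_cong_AE)
      show "AE w in M. emeasure (distr (k w) N snd) A =
          trunc_prob B (data (Suc T) w) (v -` A \<inter> space (paths e))"
        using good AE_space
        by eventually_elim (simp add: kw distr_v[OF sets\<kappa>] em[OF vA])
    qed
    also have "\<dots> = trunc_prob B [] (v -` A \<inter> space (paths e))"
      using vA by (intro trunc_prob_data) auto
    also have "\<dots> = emeasure (distr (trunc_gp_law e S lo up K D0) N v) A"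
      using vA B_sets
      by (subst distr_v) (simp_all add: trunc_prob_def trunc_gp_law_def cond_gp_law_D0 Int_commute)
    finally show "emeasure (distr M' N snd) A = emeasure (distr (trunc_gp_law e S lo up K D0) N v) A" .
  qed simp
  have AE: "AE x in M'. P x"
    if P: "Measurable.pred (M \<Otimes>\<^sub>M N) P"
      and imp: "\<And>w g. w \<in> space M \<Longrightarrow> \<forall>r\<in>{1..T}. \<forall>i<m r. g (\<zeta> r i w) = G r i w \<Longrightarrow> P (w, v g)" for P
    unfolding M'_def AE_bind[OF k P]
    using good AE_space
  proof eventually_elim
    case (elim w)
    have \<kappa>_eq: "\<kappa> w = uniform_measure (?c w) B" using elim(1) by (simp add: \<kappa>_def)
    have "AE g in \<kappa> w. P (w, v g)"
      unfolding \<kappa>_eq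
    proof (rule AE_uniform_measureI)
      show "B \<in> sets (?c w)" using B_sets by simp
      show "AE g in ?c w. g \<in> B \<longrightarrow> P (w, v g)"
        using AE_cond_gp_law_data[of "Suc T" w]
      proof eventually_elim
        case (elim g)
        have "P (w, v g)"
        proof (rule imp[OF \<open>w \<in> space M\<close>])
          show "\<forall>r\<in>{1..T}. \<forall>i<m r. g (\<zeta> r i w) = G r i w"
            using elim by simp
        qed
        then show ?case ..
      qed
    qed
    then show "AE y in k w. P y"
      unfolding k_def using vm[OF elim(2)] P by (subst AE_distr_iff) auto
  qed
  show ?thesis
    by (rule that[OF prob' sets' fst snd], intro allI impI, rule AE) simp_all
qed

end

text \<open>Earlier iterations enter through their constraint \<open>dx n 0 = 0\<close>, which keeps
  the first state at \<open>x0\<close>. In iteration \<open>j\<close> the step is zero, so the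
  Jacobian terms vanish and the linearised dynamics constraint is the exact dynamics. The conclusion
  is about index \<open>Suc j\<close>, whose iterate equals that of \<open>j\<close>.\<close>

lemma dynamics_of_converged_qp:
  assumes feas: "\<And>j'. j' \<in> {1..j} \<Longrightarrow> qp_feasible f Bd h hH N H (xh j') (uh j') (Gs j') (dx j') (du j')"
    and j: "1 \<le> j" and n: "n \<in> {1..N}"
    and init: "xh 1 n 0 = x0"
    and upd: "\<And>j' i. j' \<in> {1..j} \<Longrightarrow> i \<le> H \<Longrightarrow> xh (Suc j') n i = xh j' n i + dx j' n i"
    and updu: "\<And>i. i < H \<Longrightarrow> uh (Suc j) i = uh j i + du j i"
    and dx: "\<And>i. i \<le> H \<Longrightarrow> dx j n i = 0" and du: "\<And>i. i < H \<Longrightarrow> du j i = 0"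
    and g: "\<And>i. i < H \<Longrightarrow> fst (Gs j n i) = g (xh j n i, uh j i)"
    and i: "i \<le> H"
  shows "xh (Suc j) n i = trajectory f Bd g x0 (uh (Suc j)) i"
  using i
proof (induction i)
  case 0
  have "xh (Suc j') n 0 = x0" if "j' \<le> j" for j'
    using that
  proof (induction j')
    case 0
    then show ?case using init by simp
  next
    case (Suc j')
    have "dx (Suc j') n 0 = 0"
      using feas[of "Suc j'"] Suc.prems n by (auto simp: qp_feasible_def)
    then show ?case using upd[of "Suc j'" 0] Suc by simp
  qed
  then show ?case by simp
next
  case (Suc i)
  then have i: "i < H" by simp
  have "dx j n (Suc i) = f (xh j n i, uh j i) + Bd *v vec (fst (Gs j n i)) - xh j n (Suc i)
      + A_hat f Bd (xh j n i, uh j i) (Gs j n i) *v dx j n i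
      + B_hat f Bd (xh j n i, uh j i) (Gs j n i) *v du j i"
    using feas[of j] j n i by (auto simp: qp_feasible_def)
  then have step: "xh j n (Suc i) = f (xh j n i, uh j i) + Bd *v vec (g (xh j n i, uh j i))"
    using dx[of i] dx[of "Suc i"] du[OF i] g[OF i] i by (simp add: matrix_vector_mult_0_right)
  have "xh (Suc j) n i' = xh j n i'" if "i' \<le> H" for i'
    using upd[of j i'] dx[OF that] that j by simp
  moreover have "uh (Suc j) i = uh j i" using updu[OF i] du[OF i] by simp
  ultimately show ?case using step Suc by (simp add: Suc_leD)
qed

text \<open>The sampled outputs are finitely many, so a whole function through them needs additional
  randomness. The space \<open>M'\<close> supplies it: its first marginal is \<open>M\<close>, which
  leaves the algorithm unchanged in law, its second marginal is the truncated process, and almost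
  surely the drawn function passes through the samples and generates the converged states.\<close>

theorem corollary4:
  fixes f :: "(real^'nx) \<times> (real^'nu) \<Rightarrow> real^'nx"
    and gtr :: "(real^'nx) \<times> (real^'nu) \<Rightarrow> real"
    and Bd :: "real^1^'nx"
    and h :: "(real^'nx) \<times> (real^'nu) \<Rightarrow> real^'nh"
    and hH :: "real^'nx \<Rightarrow> real^'nt"
    and l :: "nat \<Rightarrow> (real^'nx) \<times> (real^'nu) \<Rightarrow> real"
    and k :: "(real^'nx) \<times> (real^'nu) \<Rightarrow> (real^'nx) \<times> (real^'nu) \<Rightarrow> real"
    and x0bar :: "real^'nx"
    and Z :: "((real^'nx) \<times> (real^'nu)) list" and Y :: "real list"
    and lam \<beta> :: real
    and N H L R :: nat
    and M :: "'w measure" and F :: "nat \<Rightarrow> 'w measure"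
    and m :: "nat \<Rightarrow> nat"
    and \<zeta> :: "nat \<Rightarrow> nat \<Rightarrow> nat \<Rightarrow> 'w \<Rightarrow> (real^'nx) \<times> (real^'nu)"
    and G :: "nat \<Rightarrow> nat \<Rightarrow> nat \<Rightarrow> 'w \<Rightarrow> real \<times> (real^'nx) \<times> (real^'nu)"
    and Hess :: "nat \<Rightarrow> nat \<Rightarrow> nat \<Rightarrow> 'w \<Rightarrow> (real^'nx) \<times> (real^'nu) \<Rightarrow> (real^'nx) \<times> (real^'nu)"
    and xh dx :: "nat \<Rightarrow> nat \<Rightarrow> nat \<Rightarrow> 'w \<Rightarrow> real^'nx"
    and uh du :: "nat \<Rightarrow> nat \<Rightarrow> 'w \<Rightarrow> real^'nu"
  \<comment> \<open>setting\<close>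
  assumes "rank Bd = 1"
    and "twice_cont_diff f" and "twice_cont_diff gtr" and "twice_cont_diff h"
    and "twice_cont_diff hH" and "\<And>i. twice_cont_diff (l i)"
    and "psd_kernel k" and "twice_cont_diff (\<lambda>(z, z'). k z z')"
    and "length Z = length Y" and "lam > 0" and "sqrt \<beta> > 0"
    and "emeasure (gp_law (1, 0) (deriv_kernel k) (value_data (1, 0) Z Y lam))
           (bounded_paths (1, 0) {z. h z \<le> 0} (g_lower k Z Y lam \<beta>) (g_upper k Z Y lam \<beta>)) > 0"
  \<comment> \<open>\<open>F r\<close> is the information available before sampling round \<open>r\<close>; the rounds \<open>1, \<dots>, R\<close> produce
      the initial data beyond \<open>(Z, Y)\<close>, and round \<open>R + j\<close> belongs to the SQP iteration \<open>j\<close>\<close>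
    and "prob_space M"
    and "\<And>r. subalgebra M (F r)" and "\<And>r. sets (F r) \<subseteq> sets (F (Suc r))"
    and "\<And>r n i. r \<in> {1..R + L} \<Longrightarrow> n \<in> {1..N} \<Longrightarrow> i < m r \<Longrightarrow>
           \<zeta> r n i \<in> borel_measurable (F r) \<and> G r n i \<in> borel_measurable (F (Suc r))"
    and "\<And>r n. r \<in> {1..R + L} \<Longrightarrow> n \<in> {1..N} \<Longrightarrow>
           has_cond_law M (F r) (PiM {..<m r} (\<lambda>_. borel)) (\<lambda>\<omega>. \<lambda>i\<in>{..<m r}. G r n i \<omega>)
             (\<lambda>\<omega>. trunc_gp_at (1, 0) {z. h z \<le> 0} (g_lower k Z Y lam \<beta>) (g_upper k Z Y lam \<beta>)
               (deriv_kernel k)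
               (value_data (1, 0) Z Y lam @ sampled_data m (\<lambda>t i. \<zeta> t n i \<omega>) (\<lambda>t i. G t n i \<omega>) r)
               (m r) (\<lambda>i. \<zeta> r n i \<omega>))"
  \<comment> \<open>iterations \<open>j = 1, \<dots>, L\<close>, where \<open>xh j\<close>, \<open>uh j\<close> are the guesses at the start of iteration \<open>j\<close>\<close>
    and "\<And>n \<omega>. n \<in> {1..N} \<Longrightarrow> \<omega> \<in> space M \<Longrightarrow> xh 1 n 0 \<omega> = x0bar"
    and "\<And>j. j \<in> {1..L} \<Longrightarrow> m (R + j) = H"
    and "\<And>j n i \<omega>. j \<in> {1..L} \<Longrightarrow> n \<in> {1..N} \<Longrightarrow> i < H \<Longrightarrow> \<omega> \<in> space M \<Longrightarrow>
           \<zeta> (R + j) n i \<omega> = (xh j n i \<omega>, uh j i \<omega>)"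
    and "\<And>j n i. j \<in> {1..Suc L} \<Longrightarrow> n \<in> {1..N} \<Longrightarrow> i \<le> H \<Longrightarrow> xh j n i \<in> borel_measurable (F (R + j))"
    and "\<And>j i. j \<in> {1..Suc L} \<Longrightarrow> i < H \<Longrightarrow> uh j i \<in> borel_measurable (F (R + j))"
    and "\<And>j n i \<omega>. j \<in> {1..L} \<Longrightarrow> n \<in> {1..N} \<Longrightarrow> i < H \<Longrightarrow> \<omega> \<in> space M \<Longrightarrow> pos_def (Hess j n i \<omega>)"
    and "\<And>j n i \<omega>. j \<in> {1..L} \<Longrightarrow> n \<in> {1..N} \<Longrightarrow> i \<le> H \<Longrightarrow> \<omega> \<in> space M \<Longrightarrow>
           xh (Suc j) n i \<omega> = xh j n i \<omega> + dx j n i \<omega>"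
    and "\<And>j i \<omega>. j \<in> {1..L} \<Longrightarrow> i < H \<Longrightarrow> \<omega> \<in> space M \<Longrightarrow> uh (Suc j) i \<omega> = uh j i \<omega> + du j i \<omega>"
    and "n \<in> {1..N}"
  shows "\<exists>M' :: ('w \<times> ((real^'nx) \<times> (real^'nu) \<Rightarrow> real)) measure.
    prob_space M' \<and> sets M' = sets (M \<Otimes>\<^sub>M paths 1) \<and> distr M' M fst = M \<and>
    distr M' (paths 1) snd =
      trunc_gp_law 1 {z. h z \<le> 0} (g_lower k Z Y lam \<beta>) (g_upper k Z Y lam \<beta>)
        (scalar_kernel k) (value_data 1 Z Y lam) \<and>
    (AE (\<omega>, g) in M'.
      (\<forall>r\<in>{1..R + L}. \<forall>i<m r. fst (G r n i \<omega>) = g (\<zeta> r n i \<omega>)) \<and>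
      (\<forall>j\<in>{1..L}.
        (\<forall>j'\<in>{1..j}. qp_solution f Bd h hH l N H (\<lambda>n i. xh j' n i \<omega>) (\<lambda>i. uh j' i \<omega>)
           (\<lambda>n i. G (R + j') n i \<omega>) (\<lambda>n i. Hess j' n i \<omega>) (\<lambda>n i. dx j' n i \<omega>) (\<lambda>i. du j' i \<omega>)) \<and>
        (\<forall>n\<in>{1..N}. \<forall>i\<le>H. dx j n i \<omega> = 0) \<and> (\<forall>i<H. du j i \<omega> = 0) \<longrightarrow>
        (\<forall>i\<le>H. xh (Suc j) n i \<omega> = trajectory f Bd g x0bar (\<lambda>i. uh (Suc j) i \<omega>) i)))"
proof -
  define D0 where "D0 = value_data (1 :: real, 0 :: (real^'nx) \<times> (real^'nu)) Z Y lam"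
  define S where "S = {z. h z \<le> 0}"
  define lo where "lo = g_lower k Z Y lam \<beta>"
  define up where "up = g_upper k Z Y lam \<beta>"
  obtain F' F'' where "smooth_kernel k F' F''"
    using smooth_kernelE[OF assms(7,8)] .
  then interpret smooth_kernel k F' F'' .
  note pos = assms(12)[folded D0_def S_def lo_def up_def]
  interpret gp_posterior "deriv_kernel k" "(1, 0)" D0
    unfolding D0_def
    by (rule gp_posterior_value_data[OF gp_kernel_deriv_kernel \<open>lam > 0\<close> assms(12)])
  interpret sampling_rounds "deriv_kernel k" "(1, 0)" D0 S lo up M F m "R + L" "\<lambda>r i. \<zeta> r n i" "\<lambda>r i. G r n i"
  proof (intro sampling_rounds.intro sampling_rounds_axioms.intro)
    show "gp_posterior (deriv_kernel k) (1, 0) D0" by (rule gp_posterior_axioms)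
    show "emeasure (gp_law (1, 0) (deriv_kernel k) D0) (bounded_paths (1, 0) S lo up) > 0" by (rule pos)
    show "prob_space M" "\<And>r. subalgebra M (F r)" "\<And>r. sets (F r) \<subseteq> sets (F (Suc r))" by fact+
    show "\<zeta> r n i \<in> borel_measurable (F r) \<and> G r n i \<in> borel_measurable (F (Suc r))"
      if "r \<in> {1..R + L}" "i < m r" for r i
      using that \<open>n \<in> {1..N}\<close> by (intro assms(16))
    show "has_cond_law M (F r) (PiM {..<m r} (\<lambda>_. borel)) (\<lambda>\<omega>. \<lambda>i\<in>{..<m r}. G r n i \<omega>)
        (\<lambda>\<omega>. trunc_gp_at (1, 0) S lo up (deriv_kernel k)
          (D0 @ sampled_data m (\<lambda>t i. \<zeta> t n i \<omega>) (\<lambda>t i. G t n i \<omega>) r) (m r) (\<lambda>i. \<zeta> r n i \<omega>))"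
      if "r \<in> {1..R + L}" for r
      using assms(17)[OF that \<open>n \<in> {1..N}\<close>] unfolding D0_def S_def lo_def up_def .
  qed
  obtain M' where M': "prob_space M'" "sets M' = sets (M \<Otimes>\<^sub>M paths 1)" "distr M' M fst = M"
    "distr M' (paths 1) snd = distr (trunc_gp_law (1, 0) S lo up (deriv_kernel k) D0) (paths 1) (\<lambda>\<gamma> z. fst (\<gamma> z))"
    and AE: "\<forall>P. Measurable.pred (M \<Otimes>\<^sub>M paths 1) P \<longrightarrow>
      (\<forall>\<omega> \<gamma>. \<omega> \<in> space M \<longrightarrow> (\<forall>r\<in>{1..R + L}. \<forall>i<m r. \<gamma> (\<zeta> r n i \<omega>) = G r n i \<omega>) \<longrightarrow>
        P (\<omega>, \<lambda>z. fst (\<gamma> z))) \<longrightarrow>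
      (AE x in M'. P x)"
    using coupling[OF measurable_value_path] .
  \<comment> \<open>Interpolation is the measurable core of the claim. Once it holds at an outcome,
    the statement on the quadratic programs and trajectories follows there pointwise.\<close>
  define P where "P x \<longleftrightarrow> (\<forall>r\<in>{1..R + L}. \<forall>i\<in>{..<m r}. fst (G r n i (fst x)) = snd x (\<zeta> r n i (fst x)))"
    for x :: "'w \<times> ((real^'nx) \<times> (real^'nu) \<Rightarrow> real)"
  have P: "Measurable.pred (M \<Otimes>\<^sub>M paths 1) P"
    unfolding P_def
  proof (intro pred_intros_finite(3) finite_atLeastAtMost finite_lessThan)
    fix r i assume ri: "r \<in> {1..R + L}" "i \<in> {..<m r}"
    have G: "G r n i \<in> borel_measurable M" and \<zeta>: "\<zeta> r n i \<in> borel_measurable M"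
      using meas[of r i] ri M_measurable by auto
    have "fst \<in> borel_measurable (borel :: (real \<times> (real^'nx) \<times> (real^'nu)) measure)"
      by (simp add: borel_prod[symmetric])
    then have "(\<lambda>x. fst (G r n i (fst x))) \<in> borel_measurable (M \<Otimes>\<^sub>M paths 1)"
      by (rule measurable_compose[OF measurable_compose[OF measurable_fst G]])
    then show "Measurable.pred (M \<Otimes>\<^sub>M paths 1)
        (\<lambda>x. fst (G r n i (fst x)) = snd x (\<zeta> r n i (fst x)))"
      unfolding pred_def
      by (rule borel_measurable_eq[OF _ borel_measurable_eval[OF \<zeta>, unfolded case_prod_beta']])
  qed
  have "AE x in M'. P x"
    by (rule AE[rule_format, OF P]) (simp add: P_def)
  moreover have "AE x in M'. fst x \<in> space M"
    using sets_eq_imp_space_eq[OF M'(2)] by (intro AE_I2) (auto simp: space_pair_measure)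
  ultimately have res: "AE (\<omega>, g) in M'.
      (\<forall>r\<in>{1..R + L}. \<forall>i<m r. fst (G r n i \<omega>) = g (\<zeta> r n i \<omega>)) \<and>
      (\<forall>j\<in>{1..L}.
        (\<forall>j'\<in>{1..j}. qp_solution f Bd h hH l N H (\<lambda>n i. xh j' n i \<omega>) (\<lambda>i. uh j' i \<omega>)
           (\<lambda>n i. G (R + j') n i \<omega>) (\<lambda>n i. Hess j' n i \<omega>) (\<lambda>n i. dx j' n i \<omega>) (\<lambda>i. du j' i \<omega>)) \<and>
        (\<forall>n\<in>{1..N}. \<forall>i\<le>H. dx j n i \<omega> = 0) \<and> (\<forall>i<H. du j i \<omega> = 0) \<longrightarrow>
        (\<forall>i\<le>H. xh (Suc j) n i \<omega> = trajectory f Bd g x0bar (\<lambda>i. uh (Suc j) i \<omega>) i))"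
  proof eventually_elim
    case (elim x)
    obtain \<omega> g where x: "x = (\<omega>, g)" by (cases x)
    have \<omega>: "\<omega> \<in> space M" using elim(2) by (simp add: x)
    have Gg: "fst (G r n i \<omega>) = g (\<zeta> r n i \<omega>)" if "r \<in> {1..R + L}" "i < m r" for r i
      using elim(1) that by (simp add: P_def x)
    have "xh (Suc j) n i \<omega> = trajectory f Bd g x0bar (\<lambda>i. uh (Suc j) i \<omega>) i"
      if j: "j \<in> {1..L}"
        and sol: "\<forall>j'\<in>{1..j}. qp_solution f Bd h hH l N H (\<lambda>n i. xh j' n i \<omega>) (\<lambda>i. uh j' i \<omega>)
           (\<lambda>n i. G (R + j') n i \<omega>) (\<lambda>n i. Hess j' n i \<omega>) (\<lambda>n i. dx j' n i \<omega>) (\<lambda>i. du j' i \<omega>)"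
        and dx: "\<forall>n\<in>{1..N}. \<forall>i\<le>H. dx j n i \<omega> = 0" and du: "\<forall>i<H. du j i \<omega> = 0" and i: "i \<le> H" for j i
    proof (rule dynamics_of_converged_qp[where xh = "\<lambda>j n i. xh j n i \<omega>" and uh = "\<lambda>j i. uh j i \<omega>" and
        dx = "\<lambda>j n i. dx j n i \<omega>" and du = "\<lambda>j i. du j i \<omega>" and Gs = "\<lambda>j n i. G (R + j) n i \<omega>"])
      show "qp_feasible f Bd h hH N H (\<lambda>n i. xh j' n i \<omega>) (\<lambda>i. uh j' i \<omega>) (\<lambda>n i. G (R + j') n i \<omega>)
          (\<lambda>n i. dx j' n i \<omega>) (\<lambda>i. du j' i \<omega>)" if "j' \<in> {1..j}" for j'
        using sol that by (simp add: qp_solution_def)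
      show "fst (G (R + j) n i \<omega>) = g (xh j n i \<omega>, uh j i \<omega>)" if "i < H" for i
        using Gg[of "R + j" i] assms(19)[OF j] assms(20)[OF j \<open>n \<in> {1..N}\<close> that \<omega>] that j by simp
      show "xh 1 n 0 \<omega> = x0bar" using \<open>n \<in> {1..N}\<close> \<omega> by (rule assms(18))
      show "xh (Suc j') n i \<omega> = xh j' n i \<omega> + dx j' n i \<omega>" if "j' \<in> {1..j}" "i \<le> H" for j' i
        using that j \<omega> \<open>n \<in> {1..N}\<close> by (intro assms(24)) auto
      show "uh (Suc j) i \<omega> = uh j i \<omega> + du j i \<omega>" if "i < H" for i
        using j that \<omega> by (rule assms(25))
    qed (use j i dx du \<open>n \<in> {1..N}\<close> in auto)
    then show ?case using Gg by (auto simp: x)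
  qed
  have eq: "trunc_gp_law 1 S lo up (scalar_kernel k) (value_data 1 Z Y lam) =
      distr (trunc_gp_law (1, 0) S lo up (deriv_kernel k) D0) (paths 1) (\<lambda>\<gamma> z. fst (\<gamma> z))"
    unfolding D0_def
    by (rule trunc_gp_law_value_data[OF assms(7,8) \<open>lam > 0\<close> pos[unfolded D0_def]])
  show ?thesis
    unfolding S_def[symmetric] lo_def[symmetric] up_def[symmetric] eq
    by (intro exI[of _ M'] conjI M' res)
qed

end
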